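(* For every $3/2< p\leq 2$ there is a constant $C_p>0$ such that for all $N\in\mathbb{N}$ and every function $f:\mathbb{Z}\to\mathbb{R}$, $$\|A_{N}f\|_{p'}\leq C_p\, N^{2/p'-2/p}\|f\|_p,$$ where $A_N f(x)=\frac{1}{N}\sum_{k=1}^{N} f(x+k^2)$ for $x\in\mathbb{Z}$.
   Context: For $f:\mathbb{Z}\to\mathbb{R}$, $\|f\|_p$ denotes the $\ell^p(\mathbb{Z})$-norm, and $p'=\frac{p}{p-1}$ is the conjugate exponent. *)

theory Defs
  imports "HOL-Analysis.Analysis"
begin

definition lp_norm :: "real \<Rightarrow> (int \<Rightarrow> real) \<Rightarrow> ennreal" where
  "lp_norm p f =
     (if (\<lambda>x. \<bar>f x\<bar> powr p) summable_on UNIV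
      then ennreal ((\<Sum>\<^sub>\<infinity>x. \<bar>f x\<bar> powr p) powr (1 / p))
      else \<infinity>)"

definition conj_exp :: "real \<Rightarrow> real" where
  "conj_exp p = p / (p - 1)"

definition avg_sq :: "nat \<Rightarrow> (int \<Rightarrow> real) \<Rightarrow> int \<Rightarrow> real" where
  "avg_sq N f x = (1 / real N) * (\<Sum>k=1..N. f (x + int k ^ 2))"

end

theory Submission
  imports Defs "HOL-Computational_Algebra.Primes"
begin

text \<open>
  Let \<open>I(F, G)\<close> be the number of pairs \<open>(x, k)\<close> with \<open>x \<in> G\<close>, \<open>1 \<le> k \<le> N\<close> and \<open>x + k\<^sup>2 \<in> F\<close>.
  Everything follows from the endpoint estimate \<open>I(F, G) \<lesssim> N\<^bsup>1/3\<^esup> (|F| |G|)\<^bsup>2/3\<^esup>\<close>: splitting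
  \<open>f\<close> and the dual function \<open>g\<close> into dyadic level sets and using the trivial bound
  \<open>I(F, G) \<le> N (|F| |G|)\<^bsup>1/2\<^esup>\<close> as well gives, for \<open>3/2 < p < 2\<close>, a geometric gain away from the
  critical product of the two levels.

  By Cauchy-Schwarz in \<open>x\<close> the endpoint estimate reduces to counting \<open>y, y' \<in> F\<close> and \<open>k \<noteq> l\<close>
  with \<open>y - y' = k\<^sup>2 - l\<^sup>2\<close>, that is, pairs in \<open>F\<close> whose difference has a divisor \<open>e = k - l\<close> and is at
  most \<open>2 N e\<close>. For \<open>e\<close> of size \<open>E\<close> one may thus restrict \<open>F\<close> to an interval of length \<open>X\<close>
  comparable to \<open>N E\<close>; put \<open>T = X / |F|\<close>. If \<open>T\<close> is at least a power of \<open>X\<close>, the divisor bound suffices.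
  Otherwise the number of pairs is written as a sum of \<open>|S(a/q)|\<^sup>2 / q\<close> over Farey fractions, where
  \<open>S\<close> is the exponential sum of \<open>F\<close>; the fractions with \<open>q > T\<close> are controlled by the large sieve, and those with \<open>q \<le> T\<close> are compared with
  the same count for divisors of size \<open>T\<close>, which the fourth moment of the truncated divisor
  function handles. This avoids any loss of a power of \<open>N\<close> or of a logarithm.
\<close>

section \<open>The divisor bound\<close>

text \<open>The exponents are dictated by \<open>T\<close>. With n = |F|, the bound n^(5/3) X^(1/3)
  wanted for one block of divisors equals n^2 T^(1/3). The large sieve bounds the fractions with q >
  Q by about (X/Q + E) n, which is of order n^2 once Q is at least T and E at most n; hence the cut
  at T. Below the cut, a k-th moment of the divisor function with loss Q^d yields n^2 T^((1+d)/k): a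
  third moment leaves no room for any loss, a fourth one allows d = 1/3, which the elementary
  divisor bound supplies. The moment cannot be applied to the block at E itself, since products of
  four divisors must stay below X while E may be as large as the square root of X. The passage to
  the block at T is possible because a fraction of denominator q has weight about 1/q in every
  dyadic block above q. In the interpolation the two gains are 2p/3 - 1 and 1 - p/2. They vanish at
  p = 3/2 and p = 2; the second endpoint is recovered by the plain l^2 estimate.\<close>

lemma card_divisors_mult_le:
  fixes m n :: nat
  assumes "m > 0" "n > 0"
  shows "card {d. d dvd m * n} \<le> card {d. d dvd m} * card {d. d dvd n}"
proof -
  have "{d. d dvd m * n} \<subseteq> (\<lambda>(a, b). a * b) ` ({d. d dvd m} \<times> {d. d dvd n})"
  proof
    fix d assume "d \<in> {d. d dvd m * n}"
    then obtain a b where "d = a * b" "a dvd m" "b dvd n"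
      using division_decomp by blast
    then show "d \<in> (\<lambda>(a, b). a * b) ` ({d. d dvd m} \<times> {d. d dvd n})"
      by (intro image_eqI[of _ _ "(a, b)"]) auto
  qed
  moreover have "finite ({d. d dvd m} \<times> {d. d dvd n})"
    using assms by simp
  ultimately have "card {d. d dvd m * n} \<le> card ({d. d dvd m} \<times> {d. d dvd n})"
    using surj_card_le by blast
  then show ?thesis by (simp add: card_cartesian_product)
qed

lemma card_divisors_prime_power_le:
  fixes p :: nat
  assumes "prime p"
  shows "card {d. d dvd p ^ a} \<le> a + 1"
proof -
  have "{d. d dvd p ^ a} \<subseteq> (\<lambda>i. p ^ i) ` {..a}"
    using assms by (auto simp: divides_primepow_nat)
  then have "card {d. d dvd p ^ a} \<le> card {..a}"
    using surj_card_le by blast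
  then show ?thesis by simp
qed

text \<open>Splitting off one prime factor \<open>p\<close> divides the number of divisors by at
  most 2 and \<open>n powr \<epsilon>\<close> by \<open>p powr \<epsilon>\<close>, which is at least
  2 by assumption.\<close>

lemma divisor_bound_large_primes:
  fixes n :: nat and \<epsilon> :: real
  assumes "\<epsilon> > 0" "n > 0"
    and "\<And>p. prime p \<Longrightarrow> p dvd n \<Longrightarrow> 2 \<le> real p powr \<epsilon>"
  shows "real (card {d. d dvd n}) \<le> real n powr \<epsilon>"
  using assms(2,3)
proof (induction n rule: less_induct)
  case (less n)
  show ?case
  proof (cases "n = 1")
    case True
    then show ?thesis by simp
  next
    case False
    then obtain p where p: "prime p" "p dvd n" using prime_factor_nat by blast
    then obtain m where m: "n = p * m" by blast
    with less.prems(1) p have "m > 0" "m < n"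
      using prime_gt_1_nat[OF p(1)] by auto
    have IH: "real (card {d. d dvd m}) \<le> real m powr \<epsilon>"
      using less.IH[OF \<open>m < n\<close> \<open>m > 0\<close>] less.prems(2) m by (simp add: dvd_mult)
    have "card {d. d dvd p} \<le> 2"
      using card_divisors_prime_power_le[OF p(1), of 1] by simp
    then have "card {d. d dvd p} * card {d. d dvd m} \<le> 2 * card {d. d dvd m}" by simp
    then have "card {d. d dvd n} \<le> 2 * card {d. d dvd m}"
      unfolding m using card_divisors_mult_le[of p m] \<open>m > 0\<close> prime_gt_0_nat[OF p(1)]
      by (blast intro: order.trans)
    then have "real (card {d. d dvd n}) \<le> 2 * real (card {d. d dvd m})" by linarith
    also have "\<dots> \<le> real p powr \<epsilon> * real m powr \<epsilon>"
      using less.prems(2)[OF p] IH by (intro mult_mono) auto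
    also have "\<dots> = real n powr \<epsilon>" by (simp add: m powr_mult)
    finally show ?thesis .
  qed
qed

text \<open>Meant for \<open>b = q powr \<epsilon>\<close> with a small prime \<open>q\<close>: as
  \<open>q ^ a\<close> has \<open>a + 1\<close> divisors, such a prime costs the divisor bound a
  constant factor \<open>K\<close>, uniformly in \<open>a\<close>.\<close>

lemma Suc_le_const_mult_power:
  fixes b :: real
  assumes "b > 1"
  obtains K where "K \<ge> 1" "\<And>a::nat. real a + 1 \<le> K * b ^ a"
proof -
  define K where "K = 1 + 1 / (b - 1)"
  have "real a + 1 \<le> K * b ^ a" for a :: nat
  proof -
    have "1 + real a * (b - 1) \<le> b ^ a"
      using Bernoulli_inequality[of "b - 1" a] assms by simp
    moreover have "b ^ a \<ge> 1" using assms by simp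
    ultimately have "real a * (b - 1) \<le> b ^ a" by simp
    then have "real a \<le> 1 / (b - 1) * b ^ a" using assms by (simp add: field_simps)
    with \<open>b ^ a \<ge> 1\<close> show ?thesis by (simp add: K_def algebra_simps)
  qed
  moreover have "K \<ge> 1" using assms by (simp add: K_def)
  ultimately show ?thesis using that by blast
qed

text \<open>Only the primes below \<open>2 powr (1 / \<epsilon>)\<close> violate the hypothesis of
  \<open>divisor_bound_large_primes\<close>. They are finitely many, and the induction over this
  exceptional set strips from \<open>n\<close> the full power of one such prime at the price of a
  constant.\<close>

lemma divisor_bound:
  fixes \<epsilon> :: real
  assumes "\<epsilon> > 0"
  obtains C where "C > 0" "\<And>n::nat. n > 0 \<Longrightarrow> real (card {d. d dvd n}) \<le> C * real n powr \<epsilon>"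
proof -
  have *: "\<exists>C>0. \<forall>n::nat. n > 0 \<longrightarrow> (\<forall>p. prime p \<longrightarrow> p dvd n \<longrightarrow> p \<in> S \<or> 2 \<le> real p powr \<epsilon>) \<longrightarrow>
      real (card {d. d dvd n}) \<le> C * real n powr \<epsilon>"
    if "finite S" "\<And>p. p \<in> S \<Longrightarrow> prime p" for S :: "nat set"
    using that
  proof (induction S rule: finite_induct)
    case empty
    then show ?case
      using divisor_bound_large_primes[OF assms] by (intro exI[of _ 1]) auto
  next
    case (insert q S)
    then obtain C where C: "C > 0" "\<And>n::nat. n > 0 \<Longrightarrow>
        (\<forall>p. prime p \<longrightarrow> p dvd n \<longrightarrow> p \<in> S \<or> 2 \<le> real p powr \<epsilon>) \<Longrightarrow>
        real (card {d. d dvd n}) \<le> C * real n powr \<epsilon>" by auto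
    have q: "prime q" using insert.prems by simp
    then have "real q powr \<epsilon> > 1"
      using assms prime_gt_1_nat[OF q] by (simp add: gr_one_powr)
    then obtain K where K: "K \<ge> 1" "\<And>a::nat. real a + 1 \<le> K * (real q powr \<epsilon>) ^ a"
      using Suc_le_const_mult_power by blast
    have "real (card {d. d dvd n}) \<le> (K * C) * real n powr \<epsilon>"
      if n: "n > 0" "\<forall>p. prime p \<longrightarrow> p dvd n \<longrightarrow> p \<in> insert q S \<or> 2 \<le> real p powr \<epsilon>" for n :: nat
    proof -
      define a where "a = multiplicity q n"
      have "n \<noteq> 0" "\<not> is_unit q" using n(1) q by (auto simp: not_prime_unit)
      then obtain m where m: "n = q ^ a * m" "\<not> q dvd m"
        using multiplicity_decompose'[of n q] unfolding a_def by blast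
      then have "m > 0" using n(1) by (cases m) auto
      have "\<forall>p. prime p \<longrightarrow> p dvd m \<longrightarrow> p \<in> S \<or> 2 \<le> real p powr \<epsilon>"
        using n(2) m by (metis dvd_mult insertE)
      then have IH: "real (card {d. d dvd m}) \<le> C * real m powr \<epsilon>"
        using C(2) \<open>m > 0\<close> by blast
      have "card {d. d dvd n} \<le> (a + 1) * card {d. d dvd m}"
        using card_divisors_mult_le[of "q ^ a" m] card_divisors_prime_power_le[OF q, of a]
          \<open>m > 0\<close> prime_gt_0_nat[OF q] unfolding m(1)
        by (meson mult_le_mono1 order.trans zero_less_power)
      then have "real (card {d. d dvd n}) \<le> real ((a + 1) * card {d. d dvd m})"
        using of_nat_le_iff by blast
      also have "\<dots> = (real a + 1) * real (card {d. d dvd m})"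
        by (simp add: algebra_simps)
      also have "\<dots> \<le> (K * (real q powr \<epsilon>) ^ a) * (C * real m powr \<epsilon>)"
        using K(2)[of a] IH K(1) by (intro mult_mono) auto
      also have "\<dots> = (K * C) * real n powr \<epsilon>"
        using prime_gt_0_nat[OF q]
        by (simp add: m(1) powr_mult powr_realpow[symmetric] powr_powr mult.commute)
      finally show ?thesis .
    qed
    moreover have "K * C > 0" using K(1) C(1) by simp
    ultimately show ?case by blast
  qed
  define S where "S = {p. prime p \<and> real p < 2 powr (1 / \<epsilon>)}"
  have "S \<subseteq> {..nat \<lceil>2 powr (1 / \<epsilon>)\<rceil>}" by (auto simp: S_def) linarith
  then have "finite S" using finite_subset by blast
  have "p \<in> S \<or> 2 \<le> real p powr \<epsilon>" if "prime p" for p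
  proof (cases "p \<in> S")
    case False
    then have "2 powr (1 / \<epsilon>) \<le> real p" using that by (simp add: S_def)
    then have "(2 powr (1 / \<epsilon>)) powr \<epsilon> \<le> real p powr \<epsilon>"
      using assms by (intro powr_mono2) auto
    then show ?thesis using assms by (simp add: powr_powr)
  qed auto
  then show ?thesis using *[OF \<open>finite S\<close>] that by (auto simp: S_def)
qed

section \<open>Averages of powers of the divisor function\<close>

lemma sum_inverse_le:
  fixes \<kappa> :: real
  assumes "\<kappa> > 0"
  shows "(\<Sum>l=1..L::nat. 1 / real l) \<le> (1 + 1 / \<kappa>) * real L powr \<kappa>"
proof (cases "L = 0")
  case False
  have "(\<Sum>l=1..L. 1 / real l) \<le> 1 + ln (real L)"
    using False[unfolded neq0_conv]
  proof (induction L rule: nat_induct_non_zero)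
    case (Suc n)
    have "1 / real (Suc n) \<le> ln (real (Suc n)) - ln (real n)"
    proof -
      have "ln (real n / real (Suc n)) \<le> real n / real (Suc n) - 1"
        using Suc by (intro ln_le_minus_one) auto
      moreover have "ln (real n / real (Suc n)) = ln (real n) - ln (real (Suc n))"
        using Suc.hyps by (simp add: ln_div)
      moreover have "real n / real (Suc n) - 1 = - (1 / real (Suc n))" by (simp add: field_simps)
      ultimately show ?thesis by linarith
    qed
    then show ?case using Suc by simp
  qed auto
  also have "ln (real L) \<le> real L powr \<kappa> / \<kappa>"
    using ln_powr_bound[of "real L" \<kappa>] assms False by simp
  also have "1 \<le> real L powr \<kappa>" using False assms by (simp add: ge_one_powr_ge_zero)
  finally show ?thesis by (simp add: algebra_simps)
qed auto

text \<open>The exponent 1/12 is set by the later choice \<open>L = (2 * Q) ^ 4\<close>, which turns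
  it into 1/3. It splits as 1/24 from four factors of size \<open>l powr (1 / 96)\<close> and 1/24
  from the harmonic sum, whose constant is 1 + 24 = 25.\<close>

lemma sum_divisor_fourth_power_le:
  obtains C where "C > 0" "\<And>L::nat. (\<Sum>l=1..L. real (card {d. d dvd l}) ^ 4 / real l) \<le> C * real L powr (1 / 12)"
proof -
  obtain C where C: "C > 0" "\<And>n::nat. n > 0 \<Longrightarrow> real (card {d. d dvd n}) \<le> C * real n powr (1 / 96)"
    using divisor_bound[of "1/96"] by auto
  have "(\<Sum>l=1..L. real (card {d. d dvd l}) ^ 4 / real l) \<le> (C ^ 4 * 25) * real L powr (1 / 12)" for L :: nat
  proof -
    have "real (card {d. d dvd l}) ^ 4 / real l \<le> C ^ 4 * real L powr (1/24) * (1 / real l)"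
      if "l \<in> {1..L}" for l
    proof -
      have "real (card {d. d dvd l}) ^ 4 \<le> (C * real l powr (1 / 96)) ^ 4"
        using C that by (intro power_mono) auto
      also have "\<dots> = C ^ 4 * real l powr (1 / 24)"
        using that by (simp add: power_mult_distrib powr_power)
      also have "\<dots> \<le> C ^ 4 * real L powr (1 / 24)"
        using that C(1) by (intro mult_left_mono powr_mono2) auto
      finally show ?thesis by (simp add: divide_right_mono)
    qed
    then have "(\<Sum>l=1..L. real (card {d. d dvd l}) ^ 4 / real l)
        \<le> C ^ 4 * real L powr (1/24) * (\<Sum>l=1..L. 1 / real l)"
      unfolding sum_distrib_left by (intro sum_mono)
    also have "\<dots> \<le> C ^ 4 * real L powr (1/24) * (25 * real L powr (1/24))"
      using C(1) sum_inverse_le[of "1/24" L] by (intro mult_left_mono) auto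
    also have "\<dots> = (C ^ 4 * 25) * real L powr (1/12)"
      by (simp flip: powr_add)
    finally show ?thesis .
  qed
  then show ?thesis using that[of "C ^ 4 * 25"] C(1) by auto
qed

section \<open>The large sieve for Farey fractions\<close>

text \<open>Doubling \<open>y * cos y \<le> sin y\<close> at \<open>y = x / 2\<close> gives
  \<open>x * (cos y)^2 \<le> sin x\<close>, and \<open>cos x \<ge> 0\<close> forces
  \<open>(cos y)^2 \<ge> 1 / 2\<close>. This turns the sine in the kernel bound into a distance to
  the nearest integer.\<close>

lemma sin_ge_half:
  fixes x :: real
  assumes "0 \<le> x" "x \<le> pi / 2"
  shows "x / 2 \<le> sin x"
proof -
  define y where "y = x / 2"
  have y: "0 \<le> y" "y \<le> pi" "x = 2 * y" using assms pi_ge_zero by (auto simp: y_def)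
  have "sin 0 - 0 * cos 0 \<le> sin y - y * cos y"
  proof (rule DERIV_nonneg_imp_nondecreasing[OF y(1)])
    fix u assume u: "0 \<le> u" "u \<le> y"
    have "((\<lambda>u. sin u - u * cos u) has_real_derivative u * sin u) (at u)"
      by (auto intro!: derivative_eq_intros)
    moreover have "u * sin u \<ge> 0"
      using u y by (intro mult_nonneg_nonneg sin_ge_zero) auto
    ultimately show "\<exists>z. ((\<lambda>u. sin u - u * cos u) has_real_derivative z) (at u) \<and> 0 \<le> z"
      by blast
  qed
  then have "y * cos y \<le> sin y" by simp
  moreover have "cos y \<ge> 0" using assms y by (intro cos_ge_zero) auto
  ultimately have "y * cos y * cos y \<le> sin y * cos y" by (rule mult_right_mono)
  then have "x * (cos y)\<^sup>2 \<le> sin x"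
    by (simp add: y(3) sin_double power2_eq_square)
  moreover have "cos x \<ge> 0" using assms by (intro cos_ge_zero) auto
  then have "1 / 2 \<le> (cos y)\<^sup>2" by (simp add: y(3) cos_double_cos)
  then have "x * (1 / 2) \<le> x * (cos y)\<^sup>2" using assms(1) by (rule mult_left_mono)
  ultimately show ?thesis by simp
qed

lemma cmod_cis_minus_one: "cmod (cis (2 * t) - 1) = 2 * \<bar>sin t\<bar>"
proof -
  have "cis (2 * t) - 1 = 2 * \<i> * of_real (sin t) * cis t"
    by (simp add: complex_eq_iff cos_double_sin sin_double power2_eq_square)
  then show ?thesis by (simp add: norm_mult)
qed

text \<open>The geometric sum formula, multiplied out so that integral \<open>t\<close>, where the
  sine vanishes, is no exception.\<close>

lemma dirichlet_kernel_bound: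
  fixes t :: real
  shows "cmod (\<Sum>a<Y::nat. cis (2 * pi * real a * t)) * \<bar>sin (pi * t)\<bar> \<le> 1"
proof -
  define z where "z = cis (2 * (pi * t))"
  have "(\<Sum>a<Y. cis (2 * pi * real a * t)) = (\<Sum>a<Y. z ^ a)"
    by (intro sum.cong refl) (simp add: z_def Complex.DeMoivre mult_ac)
  then have "cmod (\<Sum>a<Y. cis (2 * pi * real a * t)) * cmod (z - 1) = cmod (z ^ Y - 1)"
    by (metis norm_mult power_diff_1_eq mult.commute)
  also have "\<dots> \<le> 2"
    using norm_triangle_ineq4[of "z ^ Y" 1] by (simp add: z_def norm_power)
  finally show ?thesis by (simp add: z_def cmod_cis_minus_one)
qed

text \<open>In (-1, 1) the nearest integer to \<open>t\<close> is -1, 0 or 1. The square of the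
  distance \<open>u\<close> to it is thus one of three denominators, and adding the other two terms
  spares a case distinction later.\<close>

lemma dirichlet_kernel_square_bound:
  fixes t :: real
  assumes "\<bar>t\<bar> < 1" "t \<noteq> 0"
  shows "(cmod (\<Sum>a<Y::nat. cis (2 * pi * real a * t)))\<^sup>2 \<le> 1 / t\<^sup>2 + 1 / (t - 1)\<^sup>2 + 1 / (t + 1)\<^sup>2"
proof -
  let ?D = "cmod (\<Sum>a<Y::nat. cis (2 * pi * real a * t))"
  define u where "u = min \<bar>t\<bar> (1 - \<bar>t\<bar>)"
  have u: "0 < u" "u \<le> 1 / 2" using assms by (auto simp: u_def min_def)
  have "\<bar>sin (pi * t)\<bar> = sin (pi * \<bar>t\<bar>)"
  proof -
    have "0 \<le> sin (pi * \<bar>t\<bar>)" using assms by (intro sin_ge_zero) auto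
    then show ?thesis by (cases "t \<ge> 0") auto
  qed
  also have "\<dots> = sin (pi * u)"
    by (auto simp: u_def min_def algebra_simps sin_diff)
  also have "\<dots> \<ge> pi * u / 2"
    using u by (intro sin_ge_half) auto
  also have "pi * u / 2 \<ge> u" using pi_ge_two u by simp
  finally have "u \<le> \<bar>sin (pi * t)\<bar>" .
  then have "?D * u \<le> 1"
    using dirichlet_kernel_bound[of t Y] by (meson mult_left_mono norm_ge_zero order.trans)
  then have "?D \<le> 1 / u" using u by (simp add: field_simps)
  then have "?D\<^sup>2 \<le> (1 / u)\<^sup>2" by (intro power_mono) auto
  also have "\<dots> \<le> 1 / t\<^sup>2 + 1 / (t - 1)\<^sup>2 + 1 / (t + 1)\<^sup>2"
  proof -
    have "u\<^sup>2 = t\<^sup>2 \<or> u\<^sup>2 = (t - 1)\<^sup>2 \<or> u\<^sup>2 = (t + 1)\<^sup>2"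
      by (auto simp: u_def min_def abs_if power2_eq_square algebra_simps)
    then show ?thesis by (auto simp: power_one_over)
  qed
  finally show ?thesis .
qed

lemma sum_inverse_squares_le: "(\<Sum>j=1..n::nat. 1 / (real j)\<^sup>2) \<le> 2"
proof -
  have "(\<Sum>j=1..n. 1 / (real j)\<^sup>2) \<le> 2 - 1 / real n" if "n > 0"
    using that
  proof (induction n rule: nat_induct_non_zero)
    case (Suc n)
    have "1 / (real (Suc n))\<^sup>2 \<le> 1 / real n - 1 / real (Suc n)"
      using Suc.hyps by (simp add: divide_simps power2_eq_square)
    then show ?case using Suc.IH by simp
  qed auto
  then show ?thesis by (cases "n = 0") (auto intro: order.trans)
qed

text \<open>The integer parts of \<open>s / \<delta>\<close> are positive and pairwise distinct, so
  the sum is dominated by that of \<open>1 / (\<delta> * j)^2\<close> over positive integers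
  \<open>j\<close>.\<close>

lemma sum_inverse_square_separated_right:
  fixes S :: "real set"
  assumes "finite S" "\<delta> > 0" "\<And>s. s \<in> S \<Longrightarrow> s \<ge> \<delta>"
    and sep: "\<And>s s'. s \<in> S \<Longrightarrow> s' \<in> S \<Longrightarrow> s \<noteq> s' \<Longrightarrow> \<bar>s - s'\<bar> \<ge> \<delta>"
  shows "(\<Sum>s\<in>S. 1 / s\<^sup>2) \<le> 2 / \<delta>\<^sup>2"
proof -
  define j where "j = (\<lambda>s::real. nat \<lfloor>s / \<delta>\<rfloor>)"
  have ge1: "1 \<le> \<lfloor>s / \<delta>\<rfloor>" if "s \<in> S" for s
    using assms(2,3) that by simp
  have inj: "inj_on j S"
  proof (rule inj_onI, rule ccontr)
    fix s s' assume s: "s \<in> S" "s' \<in> S" "j s = j s'" "s \<noteq> s'"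
    then have "\<lfloor>s / \<delta>\<rfloor> = \<lfloor>s' / \<delta>\<rfloor>" 
      using s(3) eq_nat_nat_iff[of "\<lfloor>s / \<delta>\<rfloor>" "\<lfloor>s' / \<delta>\<rfloor>"] ge1[OF s(1)] ge1[OF s(2)]
      unfolding j_def by linarith
    then have "\<bar>s / \<delta> - s' / \<delta>\<bar> < 1" by linarith
    then have "\<bar>s - s'\<bar> < \<delta>"
      using assms(2) by (simp add: field_simps abs_if split: if_splits)
    then show False using sep[OF s(1,2,4)] by simp
  qed
  have j1: "1 \<le> j s" if "s \<in> S" for s
    using ge1[OF that] unfolding j_def by linarith
  then have n: "j ` S \<subseteq> {1..Max (j ` S)}" using assms(1) by auto
  have "(\<Sum>s\<in>S. 1 / s\<^sup>2) \<le> (\<Sum>s\<in>S. 1 / \<delta>\<^sup>2 * (1 / (real (j s))\<^sup>2))"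
  proof (rule sum_mono)
    fix s assume s: "s \<in> S"
    have "real (j s) * \<delta> \<le> s"
      using ge1[OF s] assms(2) by (simp add: j_def flip: pos_le_divide_eq)
    then have "(real (j s) * \<delta>)\<^sup>2 \<le> s\<^sup>2"
      using assms(2) by (intro power_mono) auto
    moreover have "0 < real (j s) * \<delta>" using ge1[OF s] assms(2) by (simp add: j_def)
    ultimately have "1 / s\<^sup>2 \<le> 1 / (real (j s) * \<delta>)\<^sup>2"
      by (intro frac_le zero_less_power) auto
    then show "1 / s\<^sup>2 \<le> 1 / \<delta>\<^sup>2 * (1 / (real (j s))\<^sup>2)"
      by (simp add: power_mult_distrib mult.commute)
  qed
  also have "\<dots> = 1 / \<delta>\<^sup>2 * (\<Sum>i\<in>j ` S. 1 / (real i)\<^sup>2)"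
    by (simp add: sum_distrib_left sum.reindex[OF inj])
  also have "\<dots> \<le> 1 / \<delta>\<^sup>2 * (\<Sum>i=1..Max (j ` S). 1 / (real i)\<^sup>2)"
    using n by (intro mult_left_mono sum_mono2) auto
  also have "\<dots> \<le> 1 / \<delta>\<^sup>2 * 2"
    by (intro mult_left_mono sum_inverse_squares_le) auto
  finally show ?thesis by simp
qed

lemma sum_inverse_square_separated:
  fixes S :: "real set"
  assumes "finite S" "\<delta> > 0" "\<And>s. s \<in> S \<Longrightarrow> \<bar>s - \<alpha>\<bar> \<ge> \<delta>"
    and sep: "\<And>s s'. s \<in> S \<Longrightarrow> s' \<in> S \<Longrightarrow> s \<noteq> s' \<Longrightarrow> \<bar>s - s'\<bar> \<ge> \<delta>"
  shows "(\<Sum>s\<in>S. 1 / (s - \<alpha>)\<^sup>2) \<le> 4 / \<delta>\<^sup>2"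
proof -
  define R where "R = {s \<in> S. s > \<alpha>}"
  define L where "L = {s \<in> S. \<not> s > \<alpha>}"
  have "(\<Sum>s\<in>R. 1 / (s - \<alpha>)\<^sup>2) = (\<Sum>u\<in>(\<lambda>s. s - \<alpha>) ` R. 1 / u\<^sup>2)"
    by (subst sum.reindex) (auto simp: inj_on_def)
  also have "\<dots> \<le> 2 / \<delta>\<^sup>2"
  proof (rule sum_inverse_square_separated_right)
    fix s assume "s \<in> (\<lambda>s. s - \<alpha>) ` R"
    then show "\<delta> \<le> s" using assms(3) by (force simp: R_def)
  qed (use assms sep in \<open>auto simp: R_def\<close>)
  finally have 1: "(\<Sum>s\<in>R. 1 / (s - \<alpha>)\<^sup>2) \<le> 2 / \<delta>\<^sup>2" .
  have "(\<Sum>s\<in>L. 1 / (s - \<alpha>)\<^sup>2) = (\<Sum>u\<in>(\<lambda>s. \<alpha> - s) ` L. 1 / u\<^sup>2)"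
    by (subst sum.reindex) (auto simp: inj_on_def power2_commute)
  also have "\<dots> \<le> 2 / \<delta>\<^sup>2"
  proof (rule sum_inverse_square_separated_right)
    fix s assume "s \<in> (\<lambda>s. \<alpha> - s) ` L"
    then show "\<delta> \<le> s" using assms(3) by (force simp: L_def)
  next
    fix s s' assume "s \<in> (\<lambda>s. \<alpha> - s) ` L" "s' \<in> (\<lambda>s. \<alpha> - s) ` L" "s \<noteq> s'"
    then show "\<delta> \<le> \<bar>s - s'\<bar>"
      using sep by (force simp: L_def abs_minus_commute)
  qed (use assms in \<open>auto simp: L_def\<close>)
  finally have 2: "(\<Sum>s\<in>L. 1 / (s - \<alpha>)\<^sup>2) \<le> 2 / \<delta>\<^sup>2" .
  have "S = R \<union> L" "R \<inter> L = {}" "finite R" "finite L"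
    using assms(1) by (auto simp: R_def L_def)
  then have "(\<Sum>s\<in>S. 1 / (s - \<alpha>)\<^sup>2) = (\<Sum>s\<in>R. 1 / (s - \<alpha>)\<^sup>2) + (\<Sum>s\<in>L. 1 / (s - \<alpha>)\<^sup>2)"
    by (simp add: sum.union_disjoint)
  with 1 2 show ?thesis by simp
qed

section \<open>Spacing of Farey fractions\<close>

text \<open>Lowest terms are not demanded: as a set of reals each value occurs once, and
  \<open>farey_den\<close> below recovers the reduced denominator.\<close>

definition farey :: "nat \<Rightarrow> real set" where
  "farey R = {real a / real q | a q. 1 \<le> q \<and> q \<le> R \<and> a < q}"

lemma finite_farey [simp]: "finite (farey R)"
proof -
  have "farey R \<subseteq> (\<lambda>(a, q). real a / real q) ` ({..R} \<times> {..R})"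
    by (fastforce simp: farey_def image_iff)
  then show ?thesis by (rule finite_subset) simp
qed

lemma farey_bounds: "\<theta> \<in> farey R \<Longrightarrow> 0 \<le> \<theta> \<and> \<theta> < 1"
  by (auto simp: farey_def)

text \<open>The difference is a nonzero integer over \<open>q * q'\<close>, and
  \<open>q * q' \<le> R^2\<close>. The shift \<open>k\<close> makes this a spacing modulo 1, as the
  periodic kernel requires.\<close>

lemma farey_separated:
  assumes "\<theta> \<in> farey R" "\<theta>' \<in> farey R" "\<theta> - \<theta>' \<noteq> of_int k"
  shows "1 / (real R)\<^sup>2 \<le> \<bar>\<theta> - \<theta>' - of_int k\<bar>"
proof -
  from assms(1) obtain a q where q: "\<theta> = real a / real q" "1 \<le> q" "q \<le> R" by (auto simp: farey_def)
  from assms(2) obtain a' q' where q': "\<theta>' = real a' / real q'" "1 \<le> q'" "q' \<le> R"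
    by (auto simp: farey_def)
  define n :: int where "n = int a * int q' - int a' * int q - k * int q * int q'"
  have eq: "\<theta> - \<theta>' - of_int k = of_int n / (real q * real q')"
    unfolding q(1) q'(1) n_def using \<open>1 \<le> q\<close> \<open>1 \<le> q'\<close> by (simp add: field_simps)
  with assms(3) have "n \<noteq> 0" by auto
  then have "1 \<le> \<bar>real_of_int n\<bar>" by linarith
  moreover have "real q * real q' \<le> (real R)\<^sup>2"
    using q q' by (simp add: power2_eq_square mult_mono)
  moreover have "0 < real q * real q'" using q q' by simp
  ultimately have "1 / (real R)\<^sup>2 \<le> \<bar>real_of_int n\<bar> / (real q * real q')"
    by (intro frac_le) auto
  then show ?thesis using eq q q' by (simp add: abs_divide)
qed

text \<open>The diagonal term is \<open>Y^2\<close>. The other fractions are spaced by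
  \<open>1 / R^2\<close>, so each of the three integer shifts contributes at most
  \<open>4 * R^4\<close>.\<close>

lemma farey_kernel_row_sum:
  assumes "\<theta> \<in> farey R"
  shows "(\<Sum>\<theta>'\<in>farey R. (cmod (\<Sum>a<Y::nat. cis (2 * pi * real a * (\<theta> - \<theta>'))))\<^sup>2)
    \<le> (real Y)\<^sup>2 + 12 * real R ^ 4"
proof -
  have "R > 0" using assms by (auto simp: farey_def)
  define S where "S = farey R - {\<theta>}"
  define \<delta> where "\<delta> = 1 / (real R)\<^sup>2"
  have \<delta>: "\<delta> > 0" using \<open>R > 0\<close> by (simp add: \<delta>_def)
  have row: "(\<Sum>\<theta>'\<in>S. 1 / (\<theta> - \<theta>' - of_int k)\<^sup>2) \<le> 4 * real R ^ 4" if "k \<in> {-1, 0, 1}" for k :: int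
  proof -
    have ne: "\<theta> - \<theta>' \<noteq> of_int k" if "\<theta>' \<in> S" for \<theta>'
      using that \<open>k \<in> {-1, 0, 1}\<close> farey_bounds[of \<theta> R] farey_bounds[of \<theta>' R] assms
      by (auto simp: S_def)
    have "(\<Sum>\<theta>'\<in>S. 1 / (\<theta>' - (\<theta> - of_int k))\<^sup>2) \<le> 4 / \<delta>\<^sup>2"
    proof (rule sum_inverse_square_separated[OF _ \<delta>])
      fix s assume s: "s \<in> S"
      then have "\<delta> \<le> \<bar>\<theta> - s - of_int k\<bar>"
        unfolding \<delta>_def using assms ne by (intro farey_separated) (auto simp: S_def)
      then show "\<delta> \<le> \<bar>s - (\<theta> - of_int k)\<bar>" by linarith
    next
      fix s s' assume "s \<in> S" "s' \<in> S" "s \<noteq> s'"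
      then show "\<delta> \<le> \<bar>s - s'\<bar>"
        using farey_separated[of s R s' 0] by (auto simp: S_def \<delta>_def)
    qed (simp add: S_def)
    also have "4 / \<delta>\<^sup>2 = 4 * real R ^ 4"
      by (simp add: \<delta>_def power_one_over flip: power_mult)
    also have "(\<Sum>\<theta>'\<in>S. 1 / (\<theta>' - (\<theta> - of_int k))\<^sup>2) = (\<Sum>\<theta>'\<in>S. 1 / (\<theta> - \<theta>' - of_int k)\<^sup>2)"
      by (intro sum.cong refl arg_cong2[where f = "(/)"]) (simp add: power2_eq_square algebra_simps)
    finally show ?thesis .
  qed
  let ?D = "\<lambda>\<theta>'. (cmod (\<Sum>a<Y. cis (2 * pi * real a * (\<theta> - \<theta>'))))\<^sup>2"
  have "sum ?D S \<le> (\<Sum>\<theta>'\<in>S. 1 / (\<theta> - \<theta>' - of_int 0)\<^sup>2 + 1 / (\<theta> - \<theta>' - of_int 1)\<^sup>2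
      + 1 / (\<theta> - \<theta>' - of_int (-1))\<^sup>2)"
  proof (rule sum_mono)
    fix \<theta>' assume "\<theta>' \<in> S"
    then have "\<bar>\<theta> - \<theta>'\<bar> < 1" "\<theta> - \<theta>' \<noteq> 0"
      using farey_bounds[of \<theta> R] farey_bounds[of \<theta>' R] assms by (auto simp: S_def)
    then show "?D \<theta>' \<le> 1 / (\<theta> - \<theta>' - of_int 0)\<^sup>2 + 1 / (\<theta> - \<theta>' - of_int 1)\<^sup>2
      + 1 / (\<theta> - \<theta>' - of_int (-1))\<^sup>2"
      using dirichlet_kernel_square_bound[of "\<theta> - \<theta>'" Y] by simp
  qed
  also have "\<dots> \<le> 4 * real R ^ 4 + 4 * real R ^ 4 + 4 * real R ^ 4"
    unfolding sum.distrib by (intro add_mono row) auto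
  finally have "sum ?D S \<le> 12 * real R ^ 4" by simp
  moreover have "sum ?D (farey R) = ?D \<theta> + sum ?D S"
    unfolding S_def using assms by (intro sum.remove) auto
  moreover have "?D \<theta> = (real Y)\<^sup>2" by simp
  ultimately show ?thesis by linarith
qed

lemma sum_swap4:
  "(\<Sum>b\<in>B. \<Sum>a\<in>A. \<Sum>r\<in>T. \<Sum>s\<in>U. f a b r s) = (\<Sum>r\<in>T. \<Sum>s\<in>U. \<Sum>b\<in>B. \<Sum>a\<in>A. f a b r s)"
proof -
  have "(\<Sum>b\<in>B. \<Sum>a\<in>A. \<Sum>r\<in>T. \<Sum>s\<in>U. f a b r s) = (\<Sum>b\<in>B. \<Sum>r\<in>T. \<Sum>a\<in>A. \<Sum>s\<in>U. f a b r s)"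
    by (intro sum.cong refl sum.swap)
  also have "\<dots> = (\<Sum>r\<in>T. \<Sum>b\<in>B. \<Sum>a\<in>A. \<Sum>s\<in>U. f a b r s)" by (rule sum.swap)
  also have "\<dots> = (\<Sum>r\<in>T. \<Sum>b\<in>B. \<Sum>s\<in>U. \<Sum>a\<in>A. f a b r s)"
    by (intro sum.cong refl sum.swap)
  also have "\<dots> = (\<Sum>r\<in>T. \<Sum>s\<in>U. \<Sum>b\<in>B. \<Sum>a\<in>A. f a b r s)"
    by (intro sum.cong refl sum.swap)
  finally show ?thesis .
qed

section \<open>Fejer weights and the dual inequality\<close>

text \<open>The frequency \<open>c + a - b\<close> is a difference, so the phases summed over
  \<open>a\<close> and \<open>b\<close> factor as \<open>D * cnj D\<close>, a Fejer kernel. Its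
  decay like \<open>1 / t^2\<close> is summable over spaced points, where a single Dirichlet kernel
  would cost a logarithm.\<close>

lemma fejer_expansion_le:
  fixes u :: "real \<Rightarrow> complex" and c :: int
  shows "(\<Sum>b<Y::nat. \<Sum>a<Y. (cmod (\<Sum>\<theta>\<in>\<Theta>. u \<theta> * cis (2 * pi * of_int (c + int a - int b) * \<theta>)))\<^sup>2)
    \<le> (\<Sum>\<theta>\<in>\<Theta>. \<Sum>\<theta>'\<in>\<Theta>. cmod (u \<theta>) * cmod (u \<theta>') *
        (cmod (\<Sum>a<Y. cis (2 * pi * real a * (\<theta> - \<theta>'))))\<^sup>2)"
    (is "?L \<le> ?R")
proof -
  define e :: "real \<Rightarrow> real \<Rightarrow> complex" where "e = (\<lambda>y t. cis (2 * pi * y * t))"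
  define D where "D = (\<lambda>t. \<Sum>a<Y. e (real a) t)"
  have split: "(u \<theta> * e (of_int (c + int a - int b)) \<theta>) * cnj (u \<theta>' * e (of_int (c + int a - int b)) \<theta>')
      = (u \<theta> * cnj (u \<theta>') * e (of_int c) (\<theta> - \<theta>')) * (e (real a) (\<theta> - \<theta>') * cnj (e (real b) (\<theta> - \<theta>')))"
    for a b \<theta> \<theta>'
    by (simp add: e_def cis_cnj cis_mult mult_ac) (simp add: algebra_simps)
  have "complex_of_real ?L = (\<Sum>b<Y. \<Sum>a<Y. \<Sum>\<theta>\<in>\<Theta>. \<Sum>\<theta>'\<in>\<Theta>.
      (u \<theta> * cnj (u \<theta>') * e (of_int c) (\<theta> - \<theta>')) * (e (real a) (\<theta> - \<theta>') * cnj (e (real b) (\<theta> - \<theta>'))))"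
    unfolding of_real_sum complex_norm_square cnj_sum sum_product e_def
    by (intro sum.cong refl split[unfolded e_def])
  also have "\<dots> = (\<Sum>\<theta>\<in>\<Theta>. \<Sum>\<theta>'\<in>\<Theta>. \<Sum>b<Y. \<Sum>a<Y.
      (u \<theta> * cnj (u \<theta>') * e (of_int c) (\<theta> - \<theta>')) * (e (real a) (\<theta> - \<theta>') * cnj (e (real b) (\<theta> - \<theta>'))))"
    by (rule sum_swap4)
  also have "\<dots> = (\<Sum>\<theta>\<in>\<Theta>. \<Sum>\<theta>'\<in>\<Theta>. (u \<theta> * cnj (u \<theta>') * e (of_int c) (\<theta> - \<theta>')) *
      (D (\<theta> - \<theta>') * cnj (D (\<theta> - \<theta>'))))"
  proof (intro sum.cong refl)
    fix \<theta> \<theta>' :: real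
    have "D (\<theta> - \<theta>') * cnj (D (\<theta> - \<theta>')) = (\<Sum>b<Y. \<Sum>a<Y. e (real a) (\<theta> - \<theta>') * cnj (e (real b) (\<theta> - \<theta>')))"
      unfolding D_def cnj_sum sum_product by (rule sum.swap)
    then show "(\<Sum>b<Y. \<Sum>a<Y. (u \<theta> * cnj (u \<theta>') * e (of_int c) (\<theta> - \<theta>')) *
        (e (real a) (\<theta> - \<theta>') * cnj (e (real b) (\<theta> - \<theta>'))))
      = (u \<theta> * cnj (u \<theta>') * e (of_int c) (\<theta> - \<theta>')) * (D (\<theta> - \<theta>') * cnj (D (\<theta> - \<theta>')))"
      by (simp only: sum_distrib_left)
  qed
  finally have eq: "complex_of_real ?L = \<dots>" .
  have "?L \<le> cmod (complex_of_real ?L)" by (subst norm_of_real) (rule abs_ge_self)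
  also have "\<dots> \<le> (\<Sum>\<theta>\<in>\<Theta>. \<Sum>\<theta>'\<in>\<Theta>. cmod ((u \<theta> * cnj (u \<theta>') * e (of_int c) (\<theta> - \<theta>')) *
      (D (\<theta> - \<theta>') * cnj (D (\<theta> - \<theta>')))))"
    unfolding eq by (intro sum_norm_le order.refl)
  also have "\<dots> = ?R"
    unfolding norm_mult complex_mod_cnj by (simp add: e_def D_def power2_eq_square)
  finally show ?thesis .
qed

text \<open>The interval on the left is covered once by each shift \<open>b < Z\<close>, so the
  triangular weight of \<open>a - b\<close> is at least \<open>Z\<close> on it.\<close>

lemma sum_interval_le_fejer:
  fixes h :: "int \<Rightarrow> real"
  assumes "\<And>y. h y \<ge> 0"
  shows "real Z * (\<Sum>y\<in>{c..<c + int X}. h y) \<le> (\<Sum>b<X + Z. \<Sum>a<X + Z. h (c + int a - int b))"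
proof -
  have "(\<Sum>y\<in>{c..<c + int X}. h y) \<le> (\<Sum>a<X + Z. h (c + int a - int b))" if "b < Z" for b
  proof -
    have "(\<Sum>y\<in>{c..<c + int X}. h y) = (\<Sum>a\<in>{b..<b + X}. h (c + int a - int b))"
      by (rule sum.reindex_bij_witness[where i = "\<lambda>a. c + int a - int b" and j = "\<lambda>y. nat (y - c) + b"])
        auto
    also have "\<dots> \<le> (\<Sum>a<X + Z. h (c + int a - int b))"
      using that assms by (intro sum_mono2) auto
    finally show ?thesis .
  qed
  then have "(\<Sum>b<Z. \<Sum>y\<in>{c..<c + int X}. h y) \<le> (\<Sum>b<Z. \<Sum>a<X + Z. h (c + int a - int b))"
    by (intro sum_mono) auto
  also have "\<dots> \<le> (\<Sum>b<X + Z. \<Sum>a<X + Z. h (c + int a - int b))"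
    using assms by (intro sum_mono2 sum_nonneg) auto
  finally show ?thesis by simp
qed

definition expsum :: "int set \<Rightarrow> real \<Rightarrow> complex" where
  "expsum F \<theta> = (\<Sum>y\<in>F. cis (2 * pi * of_int y * \<theta>))"

text \<open>Duality: let \<open>g\<close> be the trigonometric polynomial with coefficients
  \<open>cnj (expsum F \<theta>)\<close>. Then \<open>S\<close> is the sum of \<open>g\<close> over
  \<open>F\<close>, and \<open>S^2\<close> is at most \<open>card F\<close> times the square sum of
  \<open>g\<close> on the interval. The dual inequality bounds the latter by a multiple of
  \<open>S\<close>, and one factor \<open>S\<close> cancels.\<close>

lemma large_sieve:
  assumes "F \<subseteq> {c..<c + int X}" "R > 0"
  shows "(\<Sum>\<theta>\<in>farey R. (cmod (expsum F \<theta>))\<^sup>2) \<le> 52 * (real X + (real R)\<^sup>2) * real (card F)"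
proof -
  have "finite F" using assms(1) finite_subset by blast
  define S where "S = (\<Sum>\<theta>\<in>farey R. (cmod (expsum F \<theta>))\<^sup>2)"
  define u where "u = (\<lambda>\<theta>. cnj (expsum F \<theta>))"
  define g where "g = (\<lambda>y. \<Sum>\<theta>\<in>farey R. u \<theta> * cis (2 * pi * of_int y * \<theta>))"
  \<comment> \<open>\<open>Z \<ge> X\<close> keeps \<open>Y \<le> 2 * Z\<close>, and
    \<open>Z \<ge> R^2\<close> absorbs \<open>12 * R^4\<close> into \<open>12 * Y^2\<close>; this
    gives the constant \<open>13 * 4 = 52\<close>.\<close>
  define Z where "Z = X + R\<^sup>2"
  define Y where "Y = X + Z"
  have S_nonneg: "S \<ge> 0" by (simp add: S_def sum_nonneg)
  have "complex_of_real S = (\<Sum>\<theta>\<in>farey R. u \<theta> * expsum F \<theta>)"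
    unfolding S_def of_real_sum complex_norm_square u_def by (simp add: mult.commute)
  also have "\<dots> = (\<Sum>y\<in>F. g y)"
    unfolding g_def expsum_def sum_distrib_left by (rule sum.swap)
  finally have "S = cmod (\<Sum>y\<in>F. g y)" using S_nonneg by (metis abs_of_nonneg norm_of_real)
  also have "\<dots> \<le> (\<Sum>y\<in>F. cmod (g y))" by (rule norm_sum)
  finally have "S\<^sup>2 \<le> (\<Sum>y\<in>F. cmod (g y))\<^sup>2" using S_nonneg by (intro power_mono) auto
  also have "\<dots> \<le> real (card F) * (\<Sum>y\<in>F. (cmod (g y))\<^sup>2)"
    using sum_squared_le_sum_of_squares[of "\<lambda>y. cmod (g y)" F] by (simp add: mult.commute)
  also have "\<dots> \<le> real (card F) * (\<Sum>y\<in>{c..<c + int X}. (cmod (g y))\<^sup>2)"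
    using assms(1) by (intro mult_left_mono sum_mono2) auto
  finally have 1: "S\<^sup>2 \<le> real (card F) * (\<Sum>y\<in>{c..<c + int X}. (cmod (g y))\<^sup>2)" .
  let ?K = "\<lambda>\<theta> \<theta>'. (cmod (\<Sum>a<Y. cis (2 * pi * real a * (\<theta> - \<theta>'))))\<^sup>2"
  have K_sym: "?K \<theta> \<theta>' = ?K \<theta>' \<theta>" for \<theta> \<theta>'
  proof -
    have "(\<Sum>a<Y. cis (2 * pi * real a * (\<theta> - \<theta>'))) = cnj (\<Sum>a<Y. cis (2 * pi * real a * (\<theta>' - \<theta>)))"
      unfolding cnj_sum cis_cnj by (intro sum.cong refl arg_cong[of _ _ cis]) (simp add: algebra_simps)
    then show ?thesis by (simp only: complex_mod_cnj)
  qed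
  have "real Z * (\<Sum>y\<in>{c..<c + int X}. (cmod (g y))\<^sup>2)
      \<le> (\<Sum>b<Y. \<Sum>a<Y. (cmod (g (c + int a - int b)))\<^sup>2)"
    unfolding Y_def by (rule sum_interval_le_fejer) simp
  also have "\<dots> \<le> (\<Sum>\<theta>\<in>farey R. \<Sum>\<theta>'\<in>farey R. cmod (u \<theta>) * cmod (u \<theta>') * ?K \<theta> \<theta>')"
    unfolding g_def by (rule fejer_expansion_le)
  \<comment> \<open>Schur test: the arithmetic-geometric mean inequality and the symmetry of the
    kernel reduce the quadratic form to row sums.\<close>
  also have "\<dots> \<le> (\<Sum>\<theta>\<in>farey R. \<Sum>\<theta>'\<in>farey R. (cmod (u \<theta>))\<^sup>2 / 2 * ?K \<theta> \<theta>' + (cmod (u \<theta>'))\<^sup>2 / 2 * ?K \<theta> \<theta>')"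
  proof (intro sum_mono)
    fix \<theta> \<theta>'
    have "cmod (u \<theta>) * cmod (u \<theta>') \<le> (cmod (u \<theta>))\<^sup>2 / 2 + (cmod (u \<theta>'))\<^sup>2 / 2"
      using sum_squares_bound[of "cmod (u \<theta>)" "cmod (u \<theta>')"] by simp
    then show "cmod (u \<theta>) * cmod (u \<theta>') * ?K \<theta> \<theta>' \<le> (cmod (u \<theta>))\<^sup>2 / 2 * ?K \<theta> \<theta>' + (cmod (u \<theta>'))\<^sup>2 / 2 * ?K \<theta> \<theta>'"
      unfolding distrib_right[symmetric] by (rule mult_right_mono) simp
  qed
  also have "\<dots> = (\<Sum>\<theta>\<in>farey R. \<Sum>\<theta>'\<in>farey R. (cmod (u \<theta>))\<^sup>2 / 2 * ?K \<theta> \<theta>')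
      + (\<Sum>\<theta>\<in>farey R. \<Sum>\<theta>'\<in>farey R. (cmod (u \<theta>'))\<^sup>2 / 2 * ?K \<theta> \<theta>')"
    by (simp add: sum.distrib)
  also have "(\<Sum>\<theta>\<in>farey R. \<Sum>\<theta>'\<in>farey R. (cmod (u \<theta>'))\<^sup>2 / 2 * ?K \<theta> \<theta>')
      = (\<Sum>\<theta>\<in>farey R. \<Sum>\<theta>'\<in>farey R. (cmod (u \<theta>))\<^sup>2 / 2 * ?K \<theta> \<theta>')"
    by (subst sum.swap) (simp only: K_sym)
  finally have "real Z * (\<Sum>y\<in>{c..<c + int X}. (cmod (g y))\<^sup>2)
      \<le> (\<Sum>\<theta>\<in>farey R. (cmod (u \<theta>))\<^sup>2 * (\<Sum>\<theta>'\<in>farey R. ?K \<theta> \<theta>'))"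
    by (simp flip: sum_distrib_left sum_divide_distrib sum.distrib)
  also have "\<dots> \<le> (\<Sum>\<theta>\<in>farey R. (cmod (u \<theta>))\<^sup>2 * (13 * (real Y)\<^sup>2))"
  proof (intro sum_mono mult_left_mono)
    fix \<theta> assume "\<theta> \<in> farey R"
    then have "(\<Sum>\<theta>'\<in>farey R. ?K \<theta> \<theta>') \<le> (real Y)\<^sup>2 + 12 * real R ^ 4"
      by (rule farey_kernel_row_sum)
    moreover have "((real R)\<^sup>2)\<^sup>2 \<le> (real Y)\<^sup>2"
      by (intro power_mono) (auto simp: Y_def Z_def)
    ultimately show "(\<Sum>\<theta>'\<in>farey R. ?K \<theta> \<theta>') \<le> 13 * (real Y)\<^sup>2"
      by simp
  qed simp
  also have "\<dots> = S * (13 * (real Y)\<^sup>2)"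
    unfolding S_def u_def sum_distrib_right by simp
  also have "\<dots> \<le> S * (13 * (2 * real Z)\<^sup>2)"
    using S_nonneg by (intro mult_left_mono power_mono) (auto simp: Y_def Z_def)
  finally have "real Z * (\<Sum>y\<in>{c..<c + int X}. (cmod (g y))\<^sup>2) \<le> real Z * (S * (52 * real Z))"
    by (simp add: power2_eq_square mult_ac)
  moreover have "real Z > 0" using assms(2) by (simp add: Z_def add_nonneg_pos)
  ultimately have 2: "(\<Sum>y\<in>{c..<c + int X}. (cmod (g y))\<^sup>2) \<le> S * (52 * real Z)"
    by (rule mult_left_le_imp_le)
  have "S * S \<le> S * (52 * real Z * real (card F))"
    using order.trans[OF 1 mult_left_mono[OF 2]] by (simp add: power2_eq_square mult_ac)
  then have "S \<le> 52 * real Z * real (card F)"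
    using S_nonneg by (cases "S = 0") (auto dest: mult_left_le_imp_le)
  then show ?thesis by (simp add: S_def Z_def)
qed

section \<open>Differences with a divisor of given size\<close>

text \<open>The diagonal \<open>y = y'\<close> is kept, so that the count is exactly a sum of
  squares of \<open>expsum F\<close>; \<open>offpairs\<close> below omits it.\<close>

definition divpairs :: "int set \<Rightarrow> nat \<Rightarrow> nat" where
  "divpairs F e = card {(y, y') \<in> F \<times> F. int e dvd y - y'}"

lemma sum_roots_of_unity:
  fixes d :: int
  assumes "e > 0"
  shows "(\<Sum>a<e. cis (2 * pi * of_int d * (real a / real e))) = (if int e dvd d then of_nat e else 0)"
proof -
  define z where "z = cis (2 * pi * of_int d / real e)"
  have "(\<Sum>a<e. cis (2 * pi * of_int d * (real a / real e))) = (\<Sum>a<e. z ^ a)"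
    by (intro sum.cong refl) (simp add: z_def Complex.DeMoivre mult_ac)
  also have "\<dots> = (if int e dvd d then of_nat e else 0)"
  proof (cases "int e dvd d")
    case True
    then obtain k where "d = int e * k" by blast
    then have "2 * pi * of_int d / real e = 2 * pi * of_int k" using assms by simp
    then have "z = 1" unfolding z_def by (simp only: cis_multiple_2pi Ints_of_int)
    with True show ?thesis by simp
  next
    case False
    have "z ^ e = cis (2 * pi * of_int d)"
      using assms by (simp add: z_def Complex.DeMoivre)
    then have "z ^ e = 1" by (simp add: cis_multiple_2pi)
    moreover have "z \<noteq> 1"
    proof
      assume "z = 1"
      then have "cos (2 * pi * of_int d / real e) = 1" by (simp add: z_def complex_eq_iff)
      then obtain k :: int where "2 * pi * of_int d / real e = of_int k * 2 * pi"
        by (auto simp: cos_one_2pi_int)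
      then have "of_int d = real_of_int (int e * k)" using assms by (simp add: field_simps)
      then have "d = int e * k" by (simp only: of_int_eq_iff)
      with False show False by simp
    qed
    ultimately have "(\<Sum>a<e. z ^ a) = 0" by (simp add: geometric_sum)
    with False show ?thesis by simp
  qed
  finally show ?thesis .
qed

text \<open>Parseval modulo \<open>e\<close>: after expanding the square, the roots of unity detect
  \<open>e dvd y - y'\<close>.\<close>

lemma sum_expsum_eq_divpairs:
  assumes "finite F" "e > 0"
  shows "(\<Sum>a<e. (cmod (expsum F (real a / real e)))\<^sup>2) = real e * real (divpairs F e)"
proof -
  have "complex_of_real (\<Sum>a<e. (cmod (expsum F (real a / real e)))\<^sup>2) =
      (\<Sum>a<e. \<Sum>y\<in>F. \<Sum>y'\<in>F. cis (2 * pi * of_int (y - y') * (real a / real e)))"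
    unfolding of_real_sum complex_norm_square expsum_def cnj_sum sum_product cis_cnj cis_mult
    by (intro sum.cong refl arg_cong[of _ _ cis]) (simp add: algebra_simps diff_divide_distrib)
  also have "\<dots> = (\<Sum>y\<in>F. \<Sum>a<e. \<Sum>y'\<in>F. cis (2 * pi * of_int (y - y') * (real a / real e)))"
    by (rule sum.swap)
  also have "\<dots> = (\<Sum>y\<in>F. \<Sum>y'\<in>F. \<Sum>a<e. cis (2 * pi * of_int (y - y') * (real a / real e)))"
    by (intro sum.cong refl sum.swap)
  also have "\<dots> = (\<Sum>y\<in>F. \<Sum>y'\<in>F. if int e dvd y - y' then of_nat e else 0)"
    by (simp only: sum_roots_of_unity[OF assms(2)])
  also have "\<dots> = (\<Sum>(y, y')\<in>F \<times> F. if int e dvd y - y' then of_nat e else 0)"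
    by (simp add: sum.cartesian_product)
  also have "\<dots> = (\<Sum>z\<in>{(y, y') \<in> F \<times> F. int e dvd y - y'}. of_nat e)"
    using assms(1) by (intro sum.mono_neutral_cong_right) (auto split: if_splits)
  also have "\<dots> = complex_of_real (real e * real (divpairs F e))"
    by (simp add: divpairs_def mult.commute)
  finally show ?thesis by (simp only: of_real_eq_iff)
qed

section \<open>Weights of Farey fractions in a block of divisors\<close>

lemma farey_multiples:
  assumes "1 \<le> e" "e \<le> R"
  shows "{\<theta> \<in> farey R. real e * \<theta> \<in> \<int>} = (\<lambda>a. real a / real e) ` {..<e}"
proof (intro equalityI subsetI)
  fix \<theta> assume \<theta>: "\<theta> \<in> {\<theta> \<in> farey R. real e * \<theta> \<in> \<int>}"
  then obtain k where k: "real e * \<theta> = of_int k" by (auto elim: Ints_cases)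
  have "0 \<le> real e * \<theta>" "real e * \<theta> < real e"
    using \<theta> farey_bounds[of \<theta> R] assms by auto
  then have "0 \<le> k" "k < int e" using k by auto
  then have "real e * \<theta> = real (nat k)" "nat k < e" using k by auto
  then show "\<theta> \<in> (\<lambda>a. real a / real e) ` {..<e}"
    using assms by (intro image_eqI[of _ _ "nat k"]) (auto simp: field_simps)
next
  fix \<theta> assume "\<theta> \<in> (\<lambda>a. real a / real e) ` {..<e}"
  then show "\<theta> \<in> {\<theta> \<in> farey R. real e * \<theta> \<in> \<int>}"
    using assms by (auto simp: farey_def)
qed

text \<open>For \<open>\<theta>\<close> with reduced denominator \<open>q\<close> the condition says
  \<open>q dvd e\<close>, so this is the sum of \<open>1 / e\<close> over the multiples of
  \<open>q\<close> in \<open>A\<close>.\<close>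

definition farey_weight :: "nat set \<Rightarrow> real \<Rightarrow> real" where
  "farey_weight A \<theta> = (\<Sum>e | e \<in> A \<and> real e * \<theta> \<in> \<int>. 1 / real e)"

lemma farey_weight_nonneg: "farey_weight A \<theta> \<ge> 0"
  by (auto simp: farey_weight_def intro: sum_nonneg)

text \<open>Each \<open>e\<close> in \<open>A\<close> contributes the fractions
  \<open>a / e\<close>, all lying in \<open>farey R\<close>; exchanging the sums collects the weight
  of each fraction. As \<open>R\<close> may exceed \<open>A\<close>, two different blocks can be
  written over the same set of fractions.\<close>

lemma sum_divpairs_eq:
  assumes "finite F" "A \<subseteq> {1..R}"
  shows "(\<Sum>e\<in>A. real (divpairs F e)) = (\<Sum>\<theta>\<in>farey R. farey_weight A \<theta> * (cmod (expsum F \<theta>))\<^sup>2)"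
proof -
  have fin: "finite A" using assms(2) finite_subset by blast
  have "real (divpairs F e) = (\<Sum>\<theta>\<in>farey R. if real e * \<theta> \<in> \<int> then 1 / real e * (cmod (expsum F \<theta>))\<^sup>2 else 0)"
    if "e \<in> A" for e
  proof -
    have e: "1 \<le> e" "e \<le> R" using that assms(2) by auto
    have "real (divpairs F e) = 1 / real e * (\<Sum>a<e. (cmod (expsum F (real a / real e)))\<^sup>2)"
      using sum_expsum_eq_divpairs[OF assms(1), of e] e by simp
    also have "\<dots> = (\<Sum>a<e. 1 / real e * (cmod (expsum F (real a / real e)))\<^sup>2)"
      by (rule sum_distrib_left)
    also have "\<dots> = (\<Sum>\<theta>\<in>(\<lambda>a. real a / real e) ` {..<e}. 1 / real e * (cmod (expsum F \<theta>))\<^sup>2)"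
      using e by (subst sum.reindex) (auto simp: inj_on_def)
    also have "\<dots> = (\<Sum>\<theta>\<in>farey R. if real e * \<theta> \<in> \<int> then 1 / real e * (cmod (expsum F \<theta>))\<^sup>2 else 0)"
      unfolding farey_multiples[OF e, symmetric] by (rule sum.inter_filter) simp
    finally show ?thesis .
  qed
  then have "(\<Sum>e\<in>A. real (divpairs F e)) =
      (\<Sum>e\<in>A. \<Sum>\<theta>\<in>farey R. if real e * \<theta> \<in> \<int> then 1 / real e * (cmod (expsum F \<theta>))\<^sup>2 else 0)"
    by (intro sum.cong) auto
  also have "\<dots> = (\<Sum>\<theta>\<in>farey R. \<Sum>e\<in>A. if real e * \<theta> \<in> \<int> then 1 / real e * (cmod (expsum F \<theta>))\<^sup>2 else 0)"
    by (rule sum.swap)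
  also have "\<dots> = (\<Sum>\<theta>\<in>farey R. farey_weight A \<theta> * (cmod (expsum F \<theta>))\<^sup>2)"
    unfolding farey_weight_def sum_distrib_right
    by (intro sum.cong refl sum.inter_filter[OF fin, symmetric])
  finally show ?thesis .
qed

text \<open>The reduced denominator of \<open>\<theta>\<close>. As the least positive multiplier it
  divides every other one, by division with remainder and without reference to coprime
  numerators.\<close>

definition farey_den :: "real \<Rightarrow> nat" where
  "farey_den \<theta> = (LEAST q. 1 \<le> q \<and> real q * \<theta> \<in> \<int>)"

lemma farey_den_props:
  assumes "\<theta> \<in> farey R"
  shows "1 \<le> farey_den \<theta>" "real (farey_den \<theta>) * \<theta> \<in> \<int>"
    and farey_den_dvd_iff: "real e * \<theta> \<in> \<int> \<longleftrightarrow> farey_den \<theta> dvd e"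
proof -
  define q where "q = farey_den \<theta>"
  obtain b a where "1 \<le> b" "\<theta> = real a / real b" using assms by (auto simp: farey_def)
  then have "1 \<le> b \<and> real b * \<theta> \<in> \<int>" by simp
  then have q: "1 \<le> q \<and> real q * \<theta> \<in> \<int>"
    unfolding q_def farey_den_def by (rule LeastI)
  then show "1 \<le> farey_den \<theta>" "real (farey_den \<theta>) * \<theta> \<in> \<int>" by (auto simp: q_def)
  have "q dvd e" if "real e * \<theta> \<in> \<int>"
  proof -
    have "real (e mod q) * \<theta> = real e * \<theta> - real (e div q) * (real q * \<theta>)"
      by (simp add: algebra_simps flip: of_nat_mult of_nat_add distrib_left)
    also have "\<dots> \<in> \<int>" using that q by auto
    finally have "\<not> 1 \<le> e mod q"
      using not_less_Least[of "e mod q" "\<lambda>q. 1 \<le> q \<and> real q * \<theta> \<in> \<int>"] q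
      by (auto simp: q_def farey_den_def)
    then show ?thesis by (simp add: dvd_eq_mod_eq_0)
  qed
  moreover have "real e * \<theta> \<in> \<int>" if "q dvd e"
  proof -
    from that obtain m where "e = q * m" by blast
    then have "real e * \<theta> = real m * (real q * \<theta>)" by simp
    also have "\<dots> \<in> \<int>" by (rule Ints_mult[OF Ints_of_nat conjunct2[OF q]])
    finally show ?thesis .
  qed
  ultimately show "real e * \<theta> \<in> \<int> \<longleftrightarrow> farey_den \<theta> dvd e" by (auto simp: q_def)
qed

lemma farey_mono: "R \<le> R' \<Longrightarrow> farey R \<subseteq> farey R'"
  unfolding farey_def using order.trans by blast

lemma farey_den_imp_farey:
  assumes "\<theta> \<in> farey R" "farey_den \<theta> \<le> R'"
  shows "\<theta> \<in> farey R'"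
proof -
  have "\<theta> \<in> {\<theta> \<in> farey (max R R'). real (farey_den \<theta>) * \<theta> \<in> \<int>}"
    using assms(1) farey_den_props(2)[OF assms(1)] farey_mono[of R "max R R'"] by auto
  then have "\<theta> \<in> {x \<in> farey (max R R'). real (farey_den \<theta>) * x \<in> \<int>}" by blast
  also have "\<dots> = (\<lambda>a. real a / real (farey_den \<theta>)) ` {..<farey_den \<theta>}"
    using farey_den_props(1)[OF assms(1)] assms(2) by (intro farey_multiples) auto
  finally show ?thesis
    using farey_den_props(1)[OF assms(1)] assms(2) by (auto simp: farey_def)
qed

text \<open>There are at most \<open>2 * E / q\<close> positive multiples of \<open>q\<close> up to
  \<open>2 * E\<close>, and each one in the block weighs at most \<open>1 / E\<close>.\<close>

lemma farey_weight_le: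
  assumes "\<theta> \<in> farey R" "E > 0"
  shows "farey_weight {E..2 * E} \<theta> \<le> 2 / real (farey_den \<theta>)"
proof -
  define q where "q = farey_den \<theta>"
  have q: "q > 0" using farey_den_props(1)[OF assms(1)] by (simp add: q_def)
  have eq: "{e. e \<in> {E..2 * E} \<and> real e * \<theta> \<in> \<int>} = {e \<in> {E..2 * E}. q dvd e}"
    using farey_den_dvd_iff[OF assms(1)] by (auto simp: q_def)
  have sub: "{e \<in> {E..2 * E}. q dvd e} \<subseteq> (\<lambda>j. q * j) ` {1..2 * E div q}"
  proof
    fix e assume e: "e \<in> {e \<in> {E..2 * E}. q dvd e}"
    then obtain j where j: "e = q * j" by auto
    have "1 \<le> j" using e assms(2) j by (cases j) auto
    moreover have "j \<le> 2 * E div q"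
      using e j q by (auto simp: less_eq_div_iff_mult_less_eq mult.commute)
    ultimately have "j \<in> {1..2 * E div q}" by simp
    with j show "e \<in> (\<lambda>j. q * j) ` {1..2 * E div q}" by auto
  qed
  have "card {e \<in> {E..2 * E}. q dvd e} \<le> card {1..2 * E div q}"
    using surj_card_le[OF _ sub] by simp
  then have "card {e \<in> {E..2 * E}. q dvd e} \<le> 2 * E div q" by simp
  then have c: "real (card {e \<in> {E..2 * E}. q dvd e}) \<le> 2 * real E / real q"
    using of_nat_div_le_of_nat[of "2 * E" q, where 'a = real] by simp
  have "farey_weight {E..2 * E} \<theta> \<le> (\<Sum>e\<in>{e \<in> {E..2 * E}. q dvd e}. 1 / real E)"
    unfolding farey_weight_def eq using assms(2) by (intro sum_mono frac_le) auto
  also have "\<dots> = real (card {e \<in> {E..2 * E}. q dvd e}) / real E" by simp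
  also have "\<dots> \<le> (2 * real E / real q) / real E"
    using c by (intro divide_right_mono) auto
  finally show ?thesis using assms(2) by (simp add: q_def)
qed

text \<open>With \<open>t = Q div q\<close>, the multiples \<open>q * i\<close> for \<open>i\<close>
  from \<open>t + 1\<close> to \<open>2 * t\<close> all lie in the block. There are
  \<open>t \<ge> Q / (2 * q)\<close> of them, each of weight at least
  \<open>1 / (2 * Q)\<close>.\<close>

lemma farey_weight_ge:
  assumes "\<theta> \<in> farey R" "farey_den \<theta> \<le> Q"
  shows "1 / (4 * real (farey_den \<theta>)) \<le> farey_weight {Q..2 * Q} \<theta>"
proof -
  define q where "q = farey_den \<theta>"
  have q: "q > 0" "q \<le> Q" using farey_den_props(1)[OF assms(1)] assms(2) by (auto simp: q_def)
  define t where "t = Q div q"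
  have t: "t \<ge> 1" "t * q \<le> Q" "Q < (t + 1) * q"
    using q dividend_less_div_times[of q Q] by (auto simp: t_def Suc_le_eq div_greater_zero_iff)
  have eq: "{e. e \<in> {Q..2 * Q} \<and> real e * \<theta> \<in> \<int>} = {e \<in> {Q..2 * Q}. q dvd e}"
    using farey_den_dvd_iff[OF assms(1)] by (auto simp: q_def)
  have sub: "(\<lambda>i. q * i) ` {t + 1..2 * t} \<subseteq> {e \<in> {Q..2 * Q}. q dvd e}"
  proof
    fix e assume "e \<in> (\<lambda>i. q * i) ` {t + 1..2 * t}"
    then obtain i where i: "e = q * i" "i \<in> {t + 1..2 * t}" by blast
    have "t + 1 \<le> i" "i \<le> 2 * t" using i(2) by auto
    then have "(t + 1) * q \<le> i * q" "i * q \<le> (2 * t) * q" by (simp_all only: mult_le_mono1)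
    then have "Q \<le> i * q" "i * q \<le> 2 * Q" using t by linarith+
    with i show "e \<in> {e \<in> {Q..2 * Q}. q dvd e}" by (simp add: mult.commute)
  qed
  have "inj_on (\<lambda>i. q * i) {t + 1..2 * t}" using q by (auto simp: inj_on_def)
  then have "t = card ((\<lambda>i. q * i) ` {t + 1..2 * t})" by (simp add: card_image)
  also have "\<dots> \<le> card {e \<in> {Q..2 * Q}. q dvd e}" using sub by (intro card_mono) auto
  finally have c: "t \<le> card {e \<in> {Q..2 * Q}. q dvd e}" .
  have "(t + 1) * q \<le> (2 * t) * q" using t(1) by (intro mult_le_mono1) simp
  then have "Q \<le> 2 * t * q" using t(3) by linarith
  then have "real Q \<le> 2 * real t * real q" by (metis of_nat_le_iff of_nat_mult of_nat_numeral)
  then have "1 / (4 * real q) \<le> real t * (1 / (2 * real Q))"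
    using q by (simp add: field_simps)
  also have "\<dots> \<le> real (card {e \<in> {Q..2 * Q}. q dvd e}) * (1 / (2 * real Q))"
    using c by (intro mult_right_mono) auto
  also have "\<dots> = (\<Sum>e\<in>{e \<in> {Q..2 * Q}. q dvd e}. 1 / (2 * real Q))" by simp
  also have "\<dots> \<le> farey_weight {Q..2 * Q} \<theta>"
    unfolding farey_weight_def eq using q by (intro sum_mono frac_le) auto
  finally show ?thesis by (simp add: q_def)
qed

text \<open>For \<open>q \<le> Q\<close> both weights are of order \<open>1 / q\<close>, and the
  constants have quotient 2 / (1/4) = 8. For larger \<open>q\<close> the weight \<open>2 / q\<close>
  is charged to the dyadic shell between \<open>2 ^ i * Q\<close> and \<open>2 ^ (i + 1) * Q\<close>
  that contains \<open>q\<close>. Beyond \<open>2 * E\<close> no multiple of \<open>q\<close> lies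
  in the block.\<close>

lemma farey_weight_compare:
  assumes "\<theta> \<in> farey R" "Q > 0" "E > 0" and n: "2 * E \<le> 2 ^ n * Q"
  shows "farey_weight {E..2 * E} \<theta> \<le> 8 * farey_weight {Q..2 * Q} \<theta> +
    (\<Sum>i | i < n \<and> \<theta> \<in> farey (2 ^ (i + 1) * Q). 2 / (2 ^ i * real Q))"
proof -
  define q where "q = farey_den \<theta>"
  let ?S = "\<Sum>i | i < n \<and> \<theta> \<in> farey (2 ^ (i + 1) * Q). 2 / (2 ^ i * real Q)"
  have S_nonneg: "?S \<ge> 0" by (intro sum_nonneg) auto
  have q: "q > 0" using farey_den_props(1)[OF assms(1)] by (simp add: q_def)
  show ?thesis
  proof (cases "q \<le> Q")
    case True
    then have "1 / (4 * real q) \<le> farey_weight {Q..2 * Q} \<theta>"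
      using farey_weight_ge[OF assms(1)] by (simp add: q_def)
    moreover have "farey_weight {E..2 * E} \<theta> \<le> 2 / real q"
      using farey_weight_le[OF assms(1,3)] by (simp add: q_def)
    moreover have "2 / real q = 8 * (1 / (4 * real q))" by simp
    ultimately show ?thesis using S_nonneg by linarith
  next
    case False
    show ?thesis
    proof (cases "q \<le> 2 * E")
      case True
      define j where "j = (LEAST j. q \<le> 2 ^ j * Q)"
      have ex: "q \<le> 2 ^ n * Q" using True n by simp
      have j: "q \<le> 2 ^ j * Q" unfolding j_def using ex by (rule LeastI)
      have "j \<le> n" unfolding j_def using ex by (rule Least_le)
      have "j \<noteq> 0" using j False by (cases j) auto
      then obtain i where i: "j = Suc i" by (cases j) auto
      have "\<not> q \<le> 2 ^ i * Q" using not_less_Least[of i "\<lambda>j. q \<le> 2 ^ j * Q"] i by (simp add: j_def)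
      then have "2 ^ i * Q \<le> q" by simp
      then have qi: "2 ^ i * real Q \<le> real q"
        by (metis of_nat_le_iff of_nat_mult of_nat_numeral of_nat_power)
      have "i < n" "\<theta> \<in> farey (2 ^ (i + 1) * Q)"
        using i j \<open>j \<le> n\<close> farey_den_imp_farey[OF assms(1)] by (auto simp: q_def)
      then have "2 / (2 ^ i * real Q) \<le> ?S"
        by (intro member_le_sum) auto
      moreover have "farey_weight {E..2 * E} \<theta> \<le> 2 / real q"
        using farey_weight_le[OF assms(1,3)] by (simp add: q_def)
      moreover have "2 / real q \<le> 2 / (2 ^ i * real Q)"
        using qi assms(2) by (intro frac_le) auto
      moreover have "farey_weight {Q..2 * Q} \<theta> \<ge> 0" by (rule farey_weight_nonneg)
      ultimately show ?thesis by linarith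
    next
      case False
      have "{e. e \<in> {E..2 * E} \<and> real e * \<theta> \<in> \<int>} = {}"
        using farey_den_dvd_iff[OF assms(1)] False assms(3) by (auto simp: q_def dest!: dvd_imp_le)
      then have "farey_weight {E..2 * E} \<theta> = 0" by (simp only: farey_weight_def sum.empty)
      then show ?thesis using S_nonneg farey_weight_nonneg[of "{Q..2 * Q}" \<theta>] by linarith
    qed
  qed
qed

text \<open>On the shell at \<open>U = 2 ^ i * Q\<close> the large sieve at level
  \<open>2 * U\<close> costs \<open>104 * (X / U + 4 * U)\<close> per element of \<open>F\<close>.
  Both terms are geometric in \<open>i\<close>, the first dominated by \<open>U = Q\<close> and the
  second by \<open>U\<close> near \<open>E\<close>, so no logarithm arises.\<close>

lemma divpairs_compare:
  assumes "F \<subseteq> {c..<c + int X}" "Q > 0" "E > 0"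
  shows "(\<Sum>e=E..2 * E. real (divpairs F e)) \<le> 8 * (\<Sum>e=Q..2 * Q. real (divpairs F e))
    + 1664 * (real X / real Q + real E) * real (card F)"
proof -
  have "finite F" using assms(1) finite_subset by blast
  define R where "R = max (2 * E) (2 * Q)"
  define G where "G = (\<lambda>\<theta>. (cmod (expsum F \<theta>))\<^sup>2)"
  have G_nonneg: "G \<theta> \<ge> 0" for \<theta> by (simp add: G_def)
  \<comment> \<open>The least such \<open>n\<close>: the shells have to reach \<open>2 * E\<close>,
    but the last one has to start below \<open>2 * E\<close> for the growing geometric sum to stay
    below \<open>4 * E\<close>.\<close>
  define n where "n = (LEAST n. 2 * E \<le> 2 ^ n * Q)"
  have "2 * E \<le> 2 ^ (2 * E) * Q"
    using less_exp[of "2 * E"] assms(2) mult_le_mono[of "2 * E" "2 ^ (2 * E)" 1 Q] by linarith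
  then have n: "2 * E \<le> 2 ^ n * Q" unfolding n_def by (rule LeastI)
  have n_min: "2 ^ i * Q < 2 * E" if "i < n" for i
    using not_less_Least[of i "\<lambda>n. 2 * E \<le> 2 ^ n * Q"] that by (simp add: n_def)
  have "(\<Sum>e=E..2 * E. real (divpairs F e)) = (\<Sum>\<theta>\<in>farey R. farey_weight {E..2 * E} \<theta> * G \<theta>)"
    unfolding G_def using assms(3) by (intro sum_divpairs_eq[OF \<open>finite F\<close>]) (auto simp: R_def)
  also have "\<dots> \<le> (\<Sum>\<theta>\<in>farey R. (8 * farey_weight {Q..2 * Q} \<theta> +
      (\<Sum>i | i < n \<and> \<theta> \<in> farey (2 ^ (i + 1) * Q). 2 / (2 ^ i * real Q))) * G \<theta>)"
    using assms n G_nonneg by (intro sum_mono mult_right_mono farey_weight_compare) auto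
  also have "\<dots> = 8 * (\<Sum>\<theta>\<in>farey R. farey_weight {Q..2 * Q} \<theta> * G \<theta>) +
      (\<Sum>\<theta>\<in>farey R. \<Sum>i | i < n \<and> \<theta> \<in> farey (2 ^ (i + 1) * Q). 2 / (2 ^ i * real Q) * G \<theta>)"
    by (simp only: distrib_right sum.distrib sum_distrib_left sum_distrib_right mult.assoc)
  also have "(\<Sum>\<theta>\<in>farey R. farey_weight {Q..2 * Q} \<theta> * G \<theta>) = (\<Sum>e=Q..2 * Q. real (divpairs F e))"
    unfolding G_def using assms(2) by (intro sum_divpairs_eq[OF \<open>finite F\<close>, symmetric]) (auto simp: R_def)
  also have "(\<Sum>\<theta>\<in>farey R. \<Sum>i | i < n \<and> \<theta> \<in> farey (2 ^ (i + 1) * Q). 2 / (2 ^ i * real Q) * G \<theta>)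
      \<le> 1664 * (real X / real Q + real E) * real (card F)"
  proof -
    have "(\<Sum>\<theta>\<in>farey R. \<Sum>i | i < n \<and> \<theta> \<in> farey (2 ^ (i + 1) * Q). 2 / (2 ^ i * real Q) * G \<theta>)
        = (\<Sum>\<theta>\<in>farey R. \<Sum>i<n. if \<theta> \<in> farey (2 ^ (i + 1) * Q) then 2 / (2 ^ i * real Q) * G \<theta> else 0)"
      by (intro sum.cong refl sum.mono_neutral_cong_left) auto
    also have "\<dots> = (\<Sum>i<n. \<Sum>\<theta>\<in>farey R. if \<theta> \<in> farey (2 ^ (i + 1) * Q) then 2 / (2 ^ i * real Q) * G \<theta> else 0)"
      by (rule sum.swap)
    also have "\<dots> \<le> (\<Sum>i<n. (104 * real (card F)) * (real X / real Q * (1 / 2) ^ i + 4 * real Q * 2 ^ i))"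
    proof (rule sum_mono)
      fix i
      define U where "U = 2 ^ i * real Q"
      have U: "U > 0" using assms(2) by (simp add: U_def)
      have "(\<Sum>\<theta>\<in>farey R. if \<theta> \<in> farey (2 ^ (i + 1) * Q) then 2 / U * G \<theta> else 0)
          = (\<Sum>\<theta>\<in>{\<theta> \<in> farey R. \<theta> \<in> farey (2 ^ (i + 1) * Q)}. 2 / U * G \<theta>)"
        by (rule sum.inter_filter[symmetric]) simp
      also have "\<dots> \<le> (\<Sum>\<theta>\<in>farey (2 ^ (i + 1) * Q). 2 / U * G \<theta>)"
        using U G_nonneg by (intro sum_mono2) auto
      also have "\<dots> = 2 / U * (\<Sum>\<theta>\<in>farey (2 ^ (i + 1) * Q). G \<theta>)"
        by (rule sum_distrib_left[symmetric])
      also have "\<dots> \<le> 2 / U * (52 * (real X + (real (2 ^ (i + 1) * Q))\<^sup>2) * real (card F))"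
        unfolding G_def using U assms by (intro mult_left_mono large_sieve[OF assms(1)]) auto
      also have "real (2 ^ (i + 1) * Q) = 2 * U" by (simp add: U_def)
      also have "2 / U * (52 * (real X + (2 * U)\<^sup>2) * real (card F))
          = (104 * real (card F)) * (real X / U + 4 * U)"
        using U by (simp add: field_simps power2_eq_square)
      also have "real X / U + 4 * U = real X / real Q * (1 / 2) ^ i + 4 * real Q * 2 ^ i"
        by (simp add: U_def power_one_over)
      finally show "(\<Sum>\<theta>\<in>farey R. if \<theta> \<in> farey (2 ^ (i + 1) * Q) then 2 / (2 ^ i * real Q) * G \<theta> else 0)
          \<le> (104 * real (card F)) * (real X / real Q * (1 / 2) ^ i + 4 * real Q * 2 ^ i)"
        unfolding U_def .
    qed
    also have "\<dots> = (104 * real (card F)) * (real X / real Q * (\<Sum>i<n. (1 / 2) ^ i) + 4 * (real Q * (\<Sum>i<n. 2 ^ i)))"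
      by (simp only: sum.distrib mult.assoc flip: sum_distrib_left)
    also have "\<dots> \<le> (104 * real (card F)) * (real X / real Q * 2 + 4 * (4 * real E))"
    proof (intro mult_left_mono add_mono)
      show "(\<Sum>i<n. (1 / 2 :: real) ^ i) \<le> 2" by (simp add: geometric_sum)
      have "real Q * (\<Sum>i<n. 2 ^ i) = real Q * (2 ^ n - 1)" by (simp add: geometric_sum)
      also have "\<dots> \<le> 4 * real E"
      proof (cases n)
        case (Suc m)
        then have "2 ^ m * Q < 2 * E" using n_min by simp
        then have "real (2 ^ m * Q) < real (2 * E)" by (simp only: of_nat_less_iff)
        then have "2 ^ m * real Q < 2 * real E" by simp
        moreover have "real Q \<ge> 0" by simp
        moreover have "real Q * (2 ^ n - 1) = 2 * (2 ^ m * real Q) - real Q"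
          by (simp add: Suc algebra_simps)
        ultimately show ?thesis by linarith
      qed auto
      finally show "real Q * (\<Sum>i<n. 2 ^ i) \<le> 4 * real E" .
    qed auto
    also have "\<dots> \<le> (104 * real (card F)) * (16 * (real X / real Q + real E))"
    proof (intro mult_left_mono)
      have "0 \<le> real X / real Q" by simp
      then show "real X / real Q * 2 + 4 * (4 * real E) \<le> 16 * (real X / real Q + real E)"
        by argo
    qed simp
    also have "\<dots> = 1664 * (real X / real Q + real E) * real (card F)" by simp
    finally show ?thesis .
  qed
  finally show ?thesis by simp
qed

section \<open>Fourth moment of the truncated divisor function\<close>

lemma card_multiples_le:
  assumes "l > 0"
  shows "real (card {d \<in> {- int X<..<int X}. int l dvd d}) \<le> 2 * real X / real l + 1"
proof -
  define m where "m = int (X div l)"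
  have sub: "{d \<in> {- int X<..<int X}. int l dvd d} \<subseteq> (\<lambda>j. int l * j) ` {- m..m}"
  proof
    fix d assume d: "d \<in> {d \<in> {- int X<..<int X}. int l dvd d}"
    then obtain j where j: "d = int l * j" by auto
    have "\<bar>j\<bar> * int l = \<bar>d\<bar>" by (simp add: j abs_mult)
    also have "\<dots> \<le> int X" using d by auto
    finally have "\<bar>j\<bar> \<le> int X div int l"
      using assms zdiv_mono1[of "\<bar>j\<bar> * int l" "int X" "int l"] by simp
    then have "j \<in> {- m..m}" by (auto simp: m_def zdiv_int)
    with j show "d \<in> (\<lambda>j. int l * j) ` {- m..m}" by blast
  qed
  have "card {d \<in> {- int X<..<int X}. int l dvd d} \<le> card {- m..m}"
    using surj_card_le[OF _ sub] by simp
  also have "\<dots> = 2 * (X div l) + 1" by (simp add: m_def)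
  finally have "real (card {d \<in> {- int X<..<int X}. int l dvd d}) \<le> 2 * real (X div l) + 1"
    by linarith
  also have "real (X div l) \<le> real X / real l"
    using of_nat_div_le_of_nat[of X l, where 'a = real] .
  finally show ?thesis by simp
qed

text \<open>The fourth power counts quadruples of divisors of \<open>d\<close> from the block. Their
  least common multiple \<open>l\<close> divides \<open>d\<close> and is at most
  \<open>(2 * Q) ^ 4\<close>, and at most \<open>tau l ^ 4\<close> quadruples share one
  \<open>l\<close>. Even \<open>d = 0\<close> is covered, because only divisors in the block are
  counted.\<close>

lemma divisor_fourth_moment:
  obtains C where "C > 0" "\<And>X Q::nat. Q > 0 \<Longrightarrow> (2 * Q) ^ 4 \<le> X \<Longrightarrow>
    (\<Sum>d\<in>{- int X<..<int X}. real (card {e \<in> {Q..2 * Q}. int e dvd d}) ^ 4) \<le> C * real X * real Q powr (1 / 3)"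
proof -
  obtain C where C: "C > 0"
    "\<And>L::nat. (\<Sum>l=1..L. real (card {d. d dvd l}) ^ 4 / real l) \<le> C * real L powr (1 / 12)"
    using sum_divisor_fourth_power_le by blast
  have "(\<Sum>d\<in>{- int X<..<int X}. real (card {e \<in> {Q..2 * Q}. int e dvd d}) ^ 4) \<le> (6 * C) * real X * real Q powr (1 / 3)"
    if Q: "Q > 0" and X: "(2 * Q) ^ 4 \<le> X" for X Q :: nat
  proof -
    define L where "L = (2 * Q) ^ 4"
    define tau where "tau = (\<lambda>l::nat. card {d. d dvd l})"
    have pt: "real (card {e \<in> {Q..2 * Q}. int e dvd d}) ^ 4
        \<le> (\<Sum>l=1..L. if int l dvd d then real (tau l) ^ 4 else 0)" for d :: int
    proof -
      define D where "D = {e \<in> {Q..2 * Q}. int e dvd d}"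
      define V where "V = (\<lambda>l::nat. {e. e dvd l})"
      have sub: "D \<times> D \<times> D \<times> D \<subseteq> (\<Union>l\<in>{l \<in> {1..L}. int l dvd d}. V l \<times> V l \<times> V l \<times> V l)"
      proof clarify
        fix a b c e assume D: "a \<in> D" "b \<in> D" "c \<in> D" "e \<in> D"
        define l where "l = lcm (lcm a b) (lcm c e)"
        have pos: "x > 0" "x \<le> 2 * Q" "int x dvd d" if "x \<in> D" for x
          using that Q by (auto simp: D_def)
        have "l > 0" using D pos(1) by (simp add: l_def lcm_pos_nat)
        have "l dvd (a * b) * (c * e)" unfolding l_def by (intro lcm_least) (auto intro: dvd_mult dvd_mult2)
        then have "l \<le> (a * b) * (c * e)" using D pos(1) by (intro dvd_imp_le) auto
        also have "\<dots> \<le> ((2 * Q) * (2 * Q)) * ((2 * Q) * (2 * Q))"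
          using D pos(2) by (intro mult_le_mono) auto
        finally have "l \<le> L" by (simp add: L_def power4_eq_xxxx mult.assoc)
        moreover have "int l dvd d"
          using D pos(3) unfolding dvd_nat_abs_iff[symmetric] l_def by (intro lcm_least) auto
        moreover have "a \<in> V l" "b \<in> V l" "c \<in> V l" "e \<in> V l"
          by (auto simp: V_def l_def intro: dvd_lcmI1 dvd_lcmI2)
        ultimately show "(a, b, c, e) \<in> (\<Union>l\<in>{l \<in> {1..L}. int l dvd d}. V l \<times> V l \<times> V l \<times> V l)"
          using \<open>l > 0\<close> by (intro UN_I[of l]) auto
      qed
      have "card D ^ 4 = card (D \<times> D \<times> D \<times> D)"
        by (simp add: card_cartesian_product power4_eq_xxxx mult.assoc)
      also have "\<dots> \<le> card (\<Union>l\<in>{l \<in> {1..L}. int l dvd d}. V l \<times> V l \<times> V l \<times> V l)"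
        using sub by (intro card_mono) (auto simp: V_def)
      also have "\<dots> \<le> (\<Sum>l\<in>{l \<in> {1..L}. int l dvd d}. card (V l \<times> V l \<times> V l \<times> V l))"
        by (intro card_UN_le) simp
      also have "\<dots> = (\<Sum>l\<in>{l \<in> {1..L}. int l dvd d}. tau l ^ 4)"
        by (simp add: card_cartesian_product power4_eq_xxxx mult.assoc tau_def V_def)
      finally have "real (card D ^ 4) \<le> real (\<Sum>l\<in>{l \<in> {1..L}. int l dvd d}. tau l ^ 4)"
        by (simp only: of_nat_le_iff)
      also have "\<dots> = (\<Sum>l\<in>{l \<in> {1..L}. int l dvd d}. real (tau l) ^ 4)" by simp
      also have "\<dots> = (\<Sum>l=1..L. if int l dvd d then real (tau l) ^ 4 else 0)"
        by (rule sum.inter_filter) simp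
      finally show ?thesis by (simp add: D_def)
    qed
    have "(\<Sum>d\<in>{- int X<..<int X}. real (card {e \<in> {Q..2 * Q}. int e dvd d}) ^ 4)
        \<le> (\<Sum>d\<in>{- int X<..<int X}. \<Sum>l=1..L. if int l dvd d then real (tau l) ^ 4 else 0)"
      by (intro sum_mono pt)
    also have "\<dots> = (\<Sum>l=1..L. \<Sum>d\<in>{- int X<..<int X}. if int l dvd d then real (tau l) ^ 4 else 0)"
      by (rule sum.swap)
    also have "\<dots> \<le> (\<Sum>l=1..L. 3 * real X * (real (tau l) ^ 4 / real l))"
    proof (rule sum_mono)
      fix l assume l: "l \<in> {1..L}"
      have "(\<Sum>d\<in>{- int X<..<int X}. if int l dvd d then real (tau l) ^ 4 else 0)
          = (\<Sum>d\<in>{d \<in> {- int X<..<int X}. int l dvd d}. real (tau l) ^ 4)"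
        by (rule sum.inter_filter[symmetric]) simp
      also have "\<dots> = real (card {d \<in> {- int X<..<int X}. int l dvd d}) * real (tau l) ^ 4" by simp
      also have "\<dots> \<le> (3 * real X / real l) * real (tau l) ^ 4"
      proof (intro mult_right_mono)
        \<comment> \<open>Here \<open>(2 * Q) ^ 4 \<le> X\<close> enters: as
          \<open>l \<le> X\<close>, the extra 1 in the number of multiples is absorbed into
          \<open>X / l\<close>.\<close>
        have "real l \<le> real X" using l X by (simp add: L_def)
        then have "1 \<le> real X / real l" using l by (simp add: field_simps)
        moreover have "3 * real X / real l = 2 * real X / real l + real X / real l"
          by (simp flip: add_divide_distrib)
        moreover have "real (card {d \<in> {- int X<..<int X}. int l dvd d}) \<le> 2 * real X / real l + 1"
          using l by (intro card_multiples_le) auto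
        ultimately show "real (card {d \<in> {- int X<..<int X}. int l dvd d}) \<le> 3 * real X / real l"
          by linarith
      qed simp
      finally show "(\<Sum>d\<in>{- int X<..<int X}. if int l dvd d then real (tau l) ^ 4 else 0)
          \<le> 3 * real X * (real (tau l) ^ 4 / real l)" by simp
    qed
    also have "\<dots> = 3 * real X * (\<Sum>l=1..L. real (tau l) ^ 4 / real l)"
      by (simp only: sum_distrib_left)
    also have "\<dots> \<le> 3 * real X * (C * real L powr (1 / 12))"
      unfolding tau_def by (intro mult_left_mono C(2)) auto
    also have "\<dots> \<le> 3 * real X * (C * (2 * real Q powr (1 / 3)))"
    proof (intro mult_left_mono)
      have "real L = (2 * real Q) powr 4" by (simp add: L_def)
      then have "real L powr (1 / 12) = (2 * real Q) powr (1 / 3)"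
        by (simp only: powr_powr) simp
      also have "\<dots> = 2 powr (1 / 3) * real Q powr (1 / 3)" by (simp add: powr_mult)
      also have "\<dots> \<le> 2 * real Q powr (1 / 3)"
        using powr_mono[of "1/3" 1 "2::real"] by (intro mult_right_mono) auto
      finally show "real L powr (1 / 12) \<le> 2 * real Q powr (1 / 3)" .
    qed (use C(1) in auto)
    finally show ?thesis by (simp add: mult_ac)
  qed
  then show ?thesis using that[of "6 * C"] C(1) by auto
qed

lemma sum_fourth_power_le:
  fixes f :: "'a \<Rightarrow> real"
  shows "(\<Sum>i\<in>I. f i) ^ 4 \<le> real (card I) ^ 3 * (\<Sum>i\<in>I. f i ^ 4)"
proof -
  have "(\<Sum>i\<in>I. f i) ^ 4 = ((\<Sum>i\<in>I. f i)\<^sup>2)\<^sup>2" by (simp flip: power_mult)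
  also have "\<dots> \<le> ((\<Sum>i\<in>I. (f i)\<^sup>2) * real (card I))\<^sup>2"
    by (intro power_mono sum_squared_le_sum_of_squares) auto
  also have "\<dots> = (real (card I))\<^sup>2 * (\<Sum>i\<in>I. (f i)\<^sup>2)\<^sup>2"
    by (simp add: power_mult_distrib mult.commute)
  also have "\<dots> \<le> (real (card I))\<^sup>2 * ((\<Sum>i\<in>I. ((f i)\<^sup>2)\<^sup>2) * real (card I))"
    by (intro mult_left_mono sum_squared_le_sum_of_squares) auto
  also have "\<dots> = real (card I) ^ 3 * (\<Sum>i\<in>I. f i ^ 4)"
    by (simp add: power2_eq_square power3_eq_cube power4_eq_xxxx mult_ac)
  finally show ?thesis .
qed

lemma sum_card_swap:
  assumes "finite A" "finite S"
  shows "(\<Sum>e\<in>A. card {z \<in> S. R e z}) = (\<Sum>z\<in>S. card {e \<in> A. R e z})"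
proof -
  have "(\<Sum>e\<in>A. card {z \<in> S. R e z}) = (\<Sum>e\<in>A. \<Sum>z\<in>S. if R e z then 1 else 0)"
    by (intro sum.cong refl, subst sum.inter_filter[OF assms(2), symmetric]) simp
  also have "\<dots> = (\<Sum>z\<in>S. \<Sum>e\<in>A. if R e z then 1 else 0)" by (rule sum.swap)
  also have "\<dots> = (\<Sum>z\<in>S. card {e \<in> A. R e z})"
    by (intro sum.cong refl, subst sum.inter_filter[OF assms(1), symmetric]) simp
  finally show ?thesis .
qed

lemma sum_divpairs_eq_sum_card:
  assumes "finite F" "finite A"
  shows "(\<Sum>e\<in>A. divpairs F e) = (\<Sum>y\<in>F. \<Sum>y'\<in>F. card {e \<in> A. int e dvd y - y'})"
proof -
  have "divpairs F e = card {z \<in> F \<times> F. int e dvd fst z - snd z}" for e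
    unfolding divpairs_def by (intro arg_cong[of _ _ card]) auto
  then have "(\<Sum>e\<in>A. divpairs F e) = (\<Sum>z\<in>F \<times> F. card {e \<in> A. int e dvd fst z - snd z})"
    using sum_card_swap[OF assms(2), of "F \<times> F" "\<lambda>e z. int e dvd fst z - snd z"] assms(1) by simp
  then show ?thesis by (simp add: sum.cartesian_product case_prod_beta)
qed

text \<open>For fixed \<open>y\<close> the differences \<open>y - y'\<close> are distinct, so each
  row has fourth moment at most \<open>M\<close>. Hoelder over \<open>y'\<close> and over
  \<open>y\<close> gives 3 + 3 in the exponent, and summing a constant over \<open>F\<close> gives
  the seventh factor.\<close>

lemma sum_divpairs_fourth_power_le:
  assumes F: "F \<subseteq> {c..<c + int X}"
    and M: "(\<Sum>d\<in>{- int X<..<int X}. real (card {e \<in> A. int e dvd d}) ^ 4) \<le> M" and "finite A"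
  shows "(\<Sum>e\<in>A. real (divpairs F e)) ^ 4 \<le> real (card F) ^ 7 * M"
proof -
  have fin: "finite F" using F finite_subset by blast
  define t where "t = (\<lambda>d. real (card {e \<in> A. int e dvd d}))"
  have row: "(\<Sum>y'\<in>F. t (y - y')) ^ 4 \<le> real (card F) ^ 3 * M" if "y \<in> F" for y
  proof -
    have "(\<Sum>y'\<in>F. t (y - y')) ^ 4 \<le> real (card F) ^ 3 * (\<Sum>y'\<in>F. t (y - y') ^ 4)"
      by (rule sum_fourth_power_le)
    also have "(\<Sum>y'\<in>F. t (y - y') ^ 4) = (\<Sum>d\<in>(\<lambda>y'. y - y') ` F. t d ^ 4)"
      by (subst sum.reindex) (auto simp: inj_on_def)
    also have "\<dots> \<le> (\<Sum>d\<in>{- int X<..<int X}. t d ^ 4)"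
    proof (rule sum_mono2)
      show "(\<lambda>y'. y - y') ` F \<subseteq> {- int X<..<int X}"
      proof clarify
        fix y' assume "y' \<in> F"
        then have "c \<le> y'" "y' < c + int X" "c \<le> y" "y < c + int X" using F that by auto
        then show "y - y' \<in> {- int X<..<int X}" by simp
      qed
    qed auto
    also have "\<dots> \<le> M" using M by (simp add: t_def)
    finally show ?thesis by (simp add: mult_left_mono)
  qed
  have "(\<Sum>e\<in>A. real (divpairs F e)) = real (\<Sum>e\<in>A. divpairs F e)" by simp
  also have "\<dots> = (\<Sum>y\<in>F. \<Sum>y'\<in>F. t (y - y'))"
    unfolding sum_divpairs_eq_sum_card[OF fin \<open>finite A\<close>] by (simp add: t_def)
  finally have "(\<Sum>e\<in>A. real (divpairs F e)) ^ 4 \<le> real (card F) ^ 3 * (\<Sum>y\<in>F. (\<Sum>y'\<in>F. t (y - y')) ^ 4)"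
    using sum_fourth_power_le[of "\<lambda>y. \<Sum>y'\<in>F. t (y - y')" F] by simp
  also have "\<dots> \<le> real (card F) ^ 3 * (\<Sum>y\<in>F. real (card F) ^ 3 * M)"
    by (intro mult_left_mono sum_mono row) auto
  also have "\<dots> = real (card F) ^ 7 * M" by (simp add: power_numeral_reduce mult_ac)
  finally show ?thesis .
qed

section \<open>Off-diagonal pairs in an interval\<close>

text \<open>The diagonal is left out since every \<open>e\<close> divides 0, where the divisor bound
  says nothing.\<close>

definition offpairs :: "int set \<Rightarrow> nat \<Rightarrow> nat" where
  "offpairs F e = card {z \<in> {z \<in> F \<times> F. fst z \<noteq> snd z}. int e dvd fst z - snd z}"

lemma offpairs_le_divpairs: "finite F \<Longrightarrow> offpairs F e \<le> divpairs F e"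
  unfolding offpairs_def divpairs_def by (intro card_mono) (auto intro: finite_subset[of _ "F \<times> F"])

lemma sum_offpairs_divisor_bound:
  assumes F: "F \<subseteq> {c..<c + int X}" and "finite A" "C > 0"
    and C: "\<And>n::nat. n > 0 \<Longrightarrow> real (card {d. d dvd n}) \<le> C * real n powr \<epsilon>" and "\<epsilon> > 0"
  shows "(\<Sum>e\<in>A. real (offpairs F e)) \<le> (real (card F))\<^sup>2 * (C * real X powr \<epsilon>)"
proof -
  have fin: "finite F" using F finite_subset by blast
  define S where "S = {z \<in> F \<times> F. fst z \<noteq> snd z}"
  have finS: "finite S" unfolding S_def using fin by simp
  have le: "real (card {e \<in> A. int e dvd fst z - snd z}) \<le> C * real X powr \<epsilon>" if "z \<in> S" for z
  proof -
    define n where "n = nat \<bar>fst z - snd z\<bar>"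
    have "fst z \<in> F" "snd z \<in> F" "fst z \<noteq> snd z" using that by (auto simp: S_def)
    moreover from this F have "c \<le> fst z" "fst z < c + int X" "c \<le> snd z" "snd z < c + int X" by auto
    ultimately have n: "n > 0" "n \<le> X" by (auto simp: n_def)
    have "{e \<in> A. int e dvd fst z - snd z} \<subseteq> {d. d dvd n}" by (auto simp: n_def)
    then have "card {e \<in> A. int e dvd fst z - snd z} \<le> card {d. d dvd n}"
      using n by (intro card_mono) auto
    then have "real (card {e \<in> A. int e dvd fst z - snd z}) \<le> C * real n powr \<epsilon>"
      using C[OF n(1)] by linarith
    also have "\<dots> \<le> C * real X powr \<epsilon>"
      using n assms(3,5) by (intro mult_left_mono powr_mono2) auto
    finally show ?thesis .
  qed
  have "(\<Sum>e\<in>A. real (offpairs F e)) = real (\<Sum>z\<in>S. card {e \<in> A. int e dvd fst z - snd z})"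
    unfolding sum_card_swap[OF assms(2) finS, symmetric] by (simp add: offpairs_def S_def)
  also have "\<dots> = (\<Sum>z\<in>S. real (card {e \<in> A. int e dvd fst z - snd z}))" by simp
  also have "\<dots> \<le> real (card S) * (C * real X powr \<epsilon>)"
    using le by (rule sum_bounded_above)
  also have "\<dots> \<le> (real (card F))\<^sup>2 * (C * real X powr \<epsilon>)"
  proof (rule mult_right_mono)
    have "card S \<le> card (F \<times> F)" unfolding S_def using fin by (intro card_mono) auto
    then show "real (card S) \<le> (real (card F))\<^sup>2"
      by (simp add: card_cartesian_product power2_eq_square flip: of_nat_mult)
  qed (use assms(3) in auto)
  finally show ?thesis .
qed

text \<open>The right side is \<open>n^2 * T powr (1 / 3)\<close> with \<open>n = card F\<close> and
  \<open>T = X / n\<close>. The cases differ in whether products of four divisors of size about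
  \<open>T\<close> stay below \<open>X\<close>.\<close>

lemma offpairs_bound:
  obtains C where "C > 0" "\<And>F c X E. F \<subseteq> {c..<c + int X} \<Longrightarrow> 0 < E \<Longrightarrow> E\<^sup>2 \<le> X \<Longrightarrow>
    (\<Sum>e=E..2 * E. real (offpairs F e)) \<le> C * real (card F) powr (5 / 3) * real X powr (1 / 3)"
proof -
  obtain C1 where C1: "C1 > 0" "\<And>n::nat. n > 0 \<Longrightarrow> real (card {d. d dvd n}) \<le> C1 * real n powr (1 / 12)"
    using divisor_bound[of "1/12"] by auto
  obtain C2 where C2: "C2 > 0" "\<And>X Q::nat. Q > 0 \<Longrightarrow> (2 * Q) ^ 4 \<le> X \<Longrightarrow>
      (\<Sum>d\<in>{- int X<..<int X}. real (card {e \<in> {Q..2 * Q}. int e dvd d}) ^ 4) \<le> C2 * real X * real Q powr (1 / 3)"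
    using divisor_fourth_moment by blast
  define K where "K = max 1 (2 * C2)"
  define C where "C = max (2 * C1) (8 * K + 3328)"
  have "(\<Sum>e=E..2 * E. real (offpairs F e)) \<le> C * real (card F) powr (5 / 3) * real X powr (1 / 3)"
    if F: "F \<subseteq> {c..<c + int X}" and E: "0 < E" "E\<^sup>2 \<le> X" for F c X E
  proof (cases "F = {}")
    case True
    then show ?thesis by (simp add: offpairs_def)
  next
    case False
    have fin: "finite F" using F finite_subset by blast
    define n where "n = real (card F)"
    define T where "T = real X / n"
    have "card F \<ge> 1" using False fin by (simp add: Suc_le_eq card_gt_0_iff)
    moreover have "card F \<le> X" using card_mono[OF _ F] by simp
    ultimately have n: "n \<ge> 1" "n \<le> real X" by (auto simp: n_def)
    have T: "T \<ge> 1" "real X = n * T" using n by (auto simp: T_def)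
    \<comment> \<open>\<open>T\<close> rounded up: this gives \<open>X / Q \<le> n\<close>, and
      \<open>T \<ge> 1\<close> keeps \<open>Q \<le> 2 * T\<close>.\<close>
    define Q where "Q = nat \<lceil>T\<rceil>"
    have Q: "Q > 0" "T \<le> real Q" "real Q \<le> 2 * T" using T by (auto simp: Q_def) linarith+
    have target: "n powr (5 / 3) * real X powr (1 / 3) = n\<^sup>2 * T powr (1 / 3)"
    proof -
      have "n powr (5 / 3) * real X powr (1 / 3) = (n powr (5 / 3) * n powr (1 / 3)) * T powr (1 / 3)"
        using n T by (simp add: powr_mult)
      also have "n powr (5 / 3) * n powr (1 / 3) = n powr 2" unfolding powr_add[symmetric] by simp
      also have "n powr 2 = n\<^sup>2" using n by simp
      finally show ?thesis .
    qed
    have "(\<Sum>e=E..2 * E. real (offpairs F e)) \<le> C * (n\<^sup>2 * T powr (1 / 3))"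
    proof (cases "(2 * Q) ^ 4 \<le> X")
      case True
      define DQ where "DQ = (\<Sum>e=Q..2 * Q. real (divpairs F e))"
      have "DQ ^ 4 \<le> n ^ 7 * (C2 * real X * real Q powr (1 / 3))"
        unfolding DQ_def n_def by (rule sum_divpairs_fourth_power_le[OF F C2(2)[OF Q(1) True]]) simp
      also have "\<dots> \<le> n ^ 7 * (C2 * (n * T) * (2 * T powr (1 / 3)))"
      proof -
        have "real Q powr (1 / 3) \<le> (2 * T) powr (1 / 3)" using Q by (intro powr_mono2) auto
        also have "\<dots> \<le> 2 * T powr (1 / 3)"
          using powr_mono[of "1/3" 1 "2::real"] T by (simp add: powr_mult mult_right_mono)
        finally show ?thesis using n C2(1) T by (intro mult_left_mono mult_mono) auto
      qed
      \<comment> \<open>\<open>n ^ 7 * (n * T) * T powr (1 / 3)\<close> is exactly the fourth power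
        of the target.\<close>
      also have "\<dots> = (2 * C2) * (n\<^sup>2 * T powr (1 / 3)) ^ 4"
      proof -
        have "(T powr (1 / 3)) ^ 4 = T * T powr (1 / 3)"
          using T by (simp add: powr_power powr_mult_base)
        then have "(n\<^sup>2 * T powr (1 / 3)) ^ 4 = n ^ 8 * (T * T powr (1 / 3))"
          by (simp add: power_mult_distrib flip: power_mult)
        moreover have "n ^ 8 = n ^ 7 * n" by (simp add: power_numeral_reduce)
        ultimately show ?thesis by simp
      qed
      also have "\<dots> \<le> K ^ 4 * (n\<^sup>2 * T powr (1 / 3)) ^ 4"
      proof (intro mult_right_mono)
        \<comment> \<open>The maximum with 1 in \<open>K\<close> lets \<open>K ^ 4\<close> replace
          \<open>2 * C2\<close>, so that the fourth root leaves the constant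
          \<open>K\<close>.\<close>
        have "K \<le> K ^ 4" using self_le_power[of K 4] by (simp add: K_def)
        then show "2 * C2 \<le> K ^ 4" by (simp add: K_def)
      qed simp
      also have "\<dots> = (K * (n\<^sup>2 * T powr (1 / 3))) ^ 4" by (simp add: power_mult_distrib)
      finally have DQ: "DQ \<le> K * (n\<^sup>2 * T powr (1 / 3))"
        using n by (subst (asm) power_mono_iff) (auto simp: K_def DQ_def sum_nonneg)
      have XQ: "real X / real Q \<le> n" using Q T n by (simp add: field_simps)
      \<comment> \<open>Both \<open>E^2\<close> and \<open>Q^2\<close> are at most \<open>X\<close>,
        so \<open>E * Q \<le> X\<close>. Thus the error term of the comparison, together with the
        diagonal counted by \<open>divpairs\<close>, is of order \<open>n^2\<close>.\<close>
      have "real E \<le> n"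
      proof -
        have "Q\<^sup>2 \<le> (2 * Q) ^ 4"
          using Q(1) power_increasing[of 2 4 "2 * Q"] power_mono[of Q "2 * Q" 2] by linarith
        then have "E\<^sup>2 * Q\<^sup>2 \<le> X * X" using E(2) True by (intro mult_le_mono) auto
        then have "(E * Q)\<^sup>2 \<le> X\<^sup>2" by (simp add: power_mult_distrib power2_eq_square[of X])
        then have "E * Q \<le> X" by (simp add: power2_nat_le_eq_le)
        then have "real E * real Q \<le> real X" by (metis of_nat_le_iff of_nat_mult)
        then have "real E \<le> real X / real Q" using Q(1) by (simp add: field_simps)
        then show ?thesis using XQ by linarith
      qed
      have "(\<Sum>e=E..2 * E. real (offpairs F e)) \<le> (\<Sum>e=E..2 * E. real (divpairs F e))"
        using offpairs_le_divpairs[OF fin] by (intro sum_mono) simp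
      also have "\<dots> \<le> 8 * DQ + 1664 * (real X / real Q + real E) * n"
        unfolding DQ_def n_def by (rule divpairs_compare[OF F Q(1) E(1)])
      also have "\<dots> \<le> 8 * (K * (n\<^sup>2 * T powr (1 / 3))) + 1664 * (n + n) * n"
        using DQ XQ \<open>real E \<le> n\<close> n by (intro add_mono mult_left_mono mult_right_mono) auto
      also have "1664 * (n + n) * n = 3328 * (n\<^sup>2 * 1)" by (simp add: power2_eq_square)
      also have "3328 * (n\<^sup>2 * 1) \<le> 3328 * (n\<^sup>2 * T powr (1 / 3))"
        using T by (intro mult_left_mono ge_one_powr_ge_zero) auto
      finally have "(\<Sum>e=E..2 * E. real (offpairs F e)) \<le> (8 * K + 3328) * (n\<^sup>2 * T powr (1 / 3))"
        by (simp add: algebra_simps)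
      also have "\<dots> \<le> C * (n\<^sup>2 * T powr (1 / 3))"
        by (intro mult_right_mono) (auto simp: C_def)
      finally show ?thesis .
    next
      case False
      have "(\<Sum>e=E..2 * E. real (offpairs F e)) \<le> n\<^sup>2 * (C1 * real X powr (1 / 12))"
        unfolding n_def by (rule sum_offpairs_divisor_bound[OF F _ C1]) auto
      \<comment> \<open>Now \<open>X\<close> is below \<open>(4 * T) ^ 4\<close>, so its twelfth
        root is at most \<open>(4 * T) powr (1 / 3)\<close>; this fixes the exponent 1/12 chosen for
        \<open>C1\<close>.\<close>
      also have "real X powr (1 / 12) \<le> 2 * T powr (1 / 3)"
      proof -
        have "real X \<le> real ((2 * Q) ^ 4)" using False by linarith
        also have "\<dots> = (2 * real Q) ^ 4" by simp
        also have "\<dots> \<le> (4 * T) ^ 4" using Q by (intro power_mono) auto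
        finally have "real X powr (1 / 12) \<le> ((4 * T) ^ 4) powr (1 / 12)"
          by (intro powr_mono2) auto
        also have "(4 * T) ^ 4 = (4 * T) powr 4" using T by simp
        also have "((4 * T) powr 4) powr (1 / 12) = (4 * T) powr (1 / 3)"
          unfolding powr_powr by simp
        also have "\<dots> = 4 powr (1 / 3) * T powr (1 / 3)" using T by (simp add: powr_mult)
        also have "(4::real) powr (1 / 3) \<le> 4 powr (1 / 2)" by (intro powr_mono) auto
        also have "(4::real) powr (1 / 2) = 2" by (simp add: powr_half_sqrt)
        finally show ?thesis by (simp add: mult_right_mono)
      qed
      then have "n\<^sup>2 * (C1 * real X powr (1 / 12)) \<le> n\<^sup>2 * (C1 * (2 * T powr (1 / 3)))"
        using C1(1) by (intro mult_left_mono) auto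
      also have "\<dots> = (2 * C1) * (n\<^sup>2 * T powr (1 / 3))" by simp
      also have "\<dots> \<le> C * (n\<^sup>2 * T powr (1 / 3))"
        by (intro mult_right_mono) (auto simp: C_def)
      finally show ?thesis .
    qed
    then show ?thesis using target by (simp add: n_def mult.assoc)
  qed
  moreover have "C > 0" using C1(1) by (simp add: C_def)
  ultimately show ?thesis using that by blast
qed

section \<open>Incidences along the squares\<close>

lemma sum_card_windows_le:
  fixes F :: "int set"
  assumes "finite F" "finite J" "H > 0"
  shows "(\<Sum>j\<in>J. card (F \<inter> {j * H..<j * H + 2 * H})) \<le> 2 * card F"
proof -
  have "(\<Sum>j\<in>J. card (F \<inter> {j * H..<j * H + 2 * H})) = (\<Sum>j\<in>J. card {y \<in> F. y \<in> {j * H..<j * H + 2 * H}})"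
    by (simp only: Int_def mem_Collect_eq)
  also have "\<dots> = (\<Sum>y\<in>F. card {j \<in> J. y \<in> {j * H..<j * H + 2 * H}})"
    by (rule sum_card_swap[OF assms(2,1)])
  also have "\<dots> \<le> (\<Sum>y\<in>F. 2)"
  proof (rule sum_mono)
    fix y
    have "{j \<in> J. y \<in> {j * H..<j * H + 2 * H}} \<subseteq> {y div H - 1, y div H}"
    proof
      fix j assume "j \<in> {j \<in> J. y \<in> {j * H..<j * H + 2 * H}}"
      then have j: "j * H \<le> y" "y < (j + 2) * H" by (auto simp: algebra_simps)
      have "j \<le> y div H" using j(1) assms(3) zdiv_mono1[of "j * H" y H] by simp
      moreover have "(y div H) * H \<le> y" using assms(3) by (simp flip: minus_mod_eq_div_mult)
      then have "(y div H) * H < (j + 2) * H" using j(2) by linarith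
      then have "y div H < j + 2" using assms(3) by (simp only: mult_less_cancel_right_pos)
      ultimately show "j \<in> {y div H - 1, y div H}" by auto
    qed
    then have "card {j \<in> J. y \<in> {j * H..<j * H + 2 * H}} \<le> card {y div H - 1, y div H}"
      by (intro card_mono) auto
    also have "\<dots> \<le> 2" by (simp add: card_insert_if)
    finally show "card {j \<in> J. y \<in> {j * H..<j * H + 2 * H}} \<le> 2" .
  qed
  finally show ?thesis by simp
qed

text \<open>Windows of length \<open>2 * H\<close> starting at multiples of
  \<open>H = 4 * N * E\<close> contain every pair at distance at most \<open>H\<close>, while each
  point lies in at most two windows. The bounds of \<open>offpairs_bound\<close> can be added up
  over the windows because the exponent 5/3 exceeds 1.\<close>

lemma close_divisible_pairs_bound:
  obtains C where "C > 0" "\<And>F N E. finite F \<Longrightarrow> 0 < E \<Longrightarrow> E \<le> N \<Longrightarrow>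
    real (\<Sum>e=E..2 * E. card {z \<in> F \<times> F. fst z \<noteq> snd z \<and> int e dvd fst z - snd z \<and>
        \<bar>fst z - snd z\<bar> \<le> 4 * int N * int E})
      \<le> C * (real N * real E) powr (1 / 3) * real (card F) powr (5 / 3)"
proof -
  obtain C where C: "C > 0" "\<And>F c X E. F \<subseteq> {c..<c + int X} \<Longrightarrow> 0 < E \<Longrightarrow> E\<^sup>2 \<le> X \<Longrightarrow>
    (\<Sum>e=E..2 * E. real (offpairs F e)) \<le> C * real (card F) powr (5 / 3) * real X powr (1 / 3)"
    using offpairs_bound by blast
  have "real (\<Sum>e=E..2 * E. card {z \<in> F \<times> F. fst z \<noteq> snd z \<and> int e dvd fst z - snd z \<and>
        \<bar>fst z - snd z\<bar> \<le> 4 * int N * int E})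
      \<le> (4 * C) * (real N * real E) powr (1 / 3) * real (card F) powr (5 / 3)"
    if fin: "finite F" and E: "0 < E" "E \<le> N" for F :: "int set" and N E
  proof -
    define H where "H = 4 * int N * int E"
    have H: "H > 0" using E by (simp add: H_def)
    define J where "J = (\<lambda>y. y div H) ` F"
    define W where "W = (\<lambda>j. F \<inter> {j * H..<j * H + 2 * H})"
    have finJ: "finite J" using fin by (simp add: J_def)
    have W_fin: "finite (W j)" for j using fin by (simp add: W_def)
    have "card {z \<in> F \<times> F. fst z \<noteq> snd z \<and> int e dvd fst z - snd z \<and> \<bar>fst z - snd z\<bar> \<le> H}
        \<le> (\<Sum>j\<in>J. offpairs (W j) e)" for e
    proof -
      have "{z \<in> F \<times> F. fst z \<noteq> snd z \<and> int e dvd fst z - snd z \<and> \<bar>fst z - snd z\<bar> \<le> H}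
          \<subseteq> (\<Union>j\<in>J. {z \<in> {z \<in> W j \<times> W j. fst z \<noteq> snd z}. int e dvd fst z - snd z})"
      proof
        fix z assume z: "z \<in> {z \<in> F \<times> F. fst z \<noteq> snd z \<and> int e dvd fst z - snd z \<and> \<bar>fst z - snd z\<bar> \<le> H}"
        \<comment> \<open>The window is chosen by the smaller entry; the larger one is then less
          than \<open>2 * H\<close> above its start.\<close>
        define m where "m = min (fst z) (snd z)"
        define j where "j = m div H"
        have "m \<in> F" using z by (auto simp: m_def min_def)
        then have "j \<in> J" by (simp add: j_def J_def)
        have "m = j * H + m mod H" by (simp add: j_def)
        moreover have "0 \<le> m mod H" "m mod H < H" using H by auto
        ultimately have m: "j * H \<le> m" "m < j * H + H" by linarith+
        have "fst z \<in> {j * H..<j * H + 2 * H}" "snd z \<in> {j * H..<j * H + 2 * H}"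
          using m z by (auto simp: m_def)
        then have "fst z \<in> W j" "snd z \<in> W j" using z by (auto simp: W_def)
        with z \<open>j \<in> J\<close> show "z \<in> (\<Union>j\<in>J. {z \<in> {z \<in> W j \<times> W j. fst z \<noteq> snd z}. int e dvd fst z - snd z})"
          by (intro UN_I[of j]) (auto simp: mem_Times_iff)
      qed
      then have "card {z \<in> F \<times> F. fst z \<noteq> snd z \<and> int e dvd fst z - snd z \<and> \<bar>fst z - snd z\<bar> \<le> H}
          \<le> card (\<Union>j\<in>J. {z \<in> {z \<in> W j \<times> W j. fst z \<noteq> snd z}. int e dvd fst z - snd z})"
        using finJ W_fin by (intro card_mono) auto
      also have "\<dots> \<le> (\<Sum>j\<in>J. card {z \<in> {z \<in> W j \<times> W j. fst z \<noteq> snd z}. int e dvd fst z - snd z})"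
        by (rule card_UN_le[OF finJ])
      finally show ?thesis by (simp add: offpairs_def)
    qed
    then have "(\<Sum>e=E..2 * E. card {z \<in> F \<times> F. fst z \<noteq> snd z \<and> int e dvd fst z - snd z \<and>
        \<bar>fst z - snd z\<bar> \<le> H}) \<le> (\<Sum>e=E..2 * E. \<Sum>j\<in>J. offpairs (W j) e)"
      by (intro sum_mono)
    also have "\<dots> = (\<Sum>j\<in>J. \<Sum>e=E..2 * E. offpairs (W j) e)" by (rule sum.swap)
    finally have "real (\<Sum>e=E..2 * E. card {z \<in> F \<times> F. fst z \<noteq> snd z \<and> int e dvd fst z - snd z \<and>
        \<bar>fst z - snd z\<bar> \<le> H}) \<le> real (\<Sum>j\<in>J. \<Sum>e=E..2 * E. offpairs (W j) e)"
      by (simp only: of_nat_le_iff)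
    also have "\<dots> = (\<Sum>j\<in>J. \<Sum>e=E..2 * E. real (offpairs (W j) e))" by simp
    also have "\<dots> \<le> (\<Sum>j\<in>J. C * (8 * real N * real E) powr (1 / 3) * real (card F) powr (2 / 3) * real (card (W j)))"
    proof (rule sum_mono)
      fix j
      have "(\<Sum>e=E..2 * E. real (offpairs (W j) e))
          \<le> C * real (card (W j)) powr (5 / 3) * real (8 * N * E) powr (1 / 3)"
      proof (rule C(2))
        show "W j \<subseteq> {j * H..<j * H + int (8 * N * E)}" by (auto simp: W_def H_def)
        have "E * E \<le> 8 * N * E" using E by (intro mult_le_mono1) simp
        then show "E\<^sup>2 \<le> 8 * N * E" by (simp add: power2_eq_square)
      qed (use E in auto)
      \<comment> \<open>One full factor \<open>card (W j)\<close> is kept for the sum over the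
        windows; the remaining power 2/3 is bounded through \<open>card F\<close>.\<close>
      also have "real (card (W j)) powr (5 / 3) = real (card (W j)) powr (2 / 3) * real (card (W j))"
        using powr_add[of "real (card (W j))" "2/3" 1] by simp
      also have "C * (real (card (W j)) powr (2 / 3) * real (card (W j))) * real (8 * N * E) powr (1 / 3)
          \<le> C * (real (card F) powr (2 / 3) * real (card (W j))) * real (8 * N * E) powr (1 / 3)"
        using fin C(1) by (intro mult_right_mono mult_left_mono powr_mono2)
          (auto simp: W_def intro: card_mono)
      finally show "(\<Sum>e=E..2 * E. real (offpairs (W j) e))
          \<le> C * (8 * real N * real E) powr (1 / 3) * real (card F) powr (2 / 3) * real (card (W j))"
        by (simp add: mult_ac)
    qed
    also have "\<dots> = C * (8 * real N * real E) powr (1 / 3) * real (card F) powr (2 / 3) * real (\<Sum>j\<in>J. card (W j))"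
      by (simp only: sum_distrib_left of_nat_sum)
    also have "\<dots> \<le> C * (8 * real N * real E) powr (1 / 3) * real (card F) powr (2 / 3) * real (2 * card F)"
    proof (intro mult_left_mono)
      show "real (\<Sum>j\<in>J. card (W j)) \<le> real (2 * card F)"
        unfolding W_def of_nat_le_iff by (rule sum_card_windows_le[OF fin finJ H])
    qed (use C(1) in auto)
    also have "(8 * real N * real E) powr (1 / 3) = 2 * (real N * real E) powr (1 / 3)"
    proof -
      have "(8::real) = 2 powr 3" by simp
      then have "(8::real) powr (1 / 3) = 2" by (simp only: powr_powr) simp
      then show ?thesis by (simp add: powr_mult)
    qed
    also have "C * (2 * (real N * real E) powr (1 / 3)) * real (card F) powr (2 / 3) * real (2 * card F)
        = (4 * C) * (real N * real E) powr (1 / 3) * (real (card F) powr (2 / 3) * real (card F))"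
      by simp
    also have "real (card F) powr (2 / 3) * real (card F) = real (card F) powr (5 / 3)"
      using powr_add[of "real (card F)" "2/3" 1] by simp
    finally show ?thesis by (simp only: H_def)
  qed
  then show ?thesis using that[of "4 * C"] C(1) by auto
qed

section \<open>Pairs of squares with a common base point\<close>

text \<open>The common point \<open>x = y - k^2 = y' - l^2\<close> is eliminated and may be any
  integer, so after Cauchy-Schwarz in \<open>x\<close> the set \<open>G\<close> enters only through
  its size.\<close>

definition sq_off :: "nat \<Rightarrow> int set \<Rightarrow> (int \<times> int \<times> nat \<times> nat) set" where
  "sq_off N F = {(y, y', k, l). y \<in> F \<and> y' \<in> F \<and> k \<in> {1..N} \<and> l \<in> {1..N} \<and> k \<noteq> l \<and>
     y - (int k)\<^sup>2 = y' - (int l)\<^sup>2}"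

lemma finite_sq_off: "finite F \<Longrightarrow> finite (sq_off N F)"
  by (rule finite_subset[of _ "F \<times> F \<times> {1..N} \<times> {1..N}"]) (auto simp: sq_off_def)

text \<open>Writing \<open>y - y' = k\<^sup>2 - l\<^sup>2 = (k - l) (k + l)\<close>, the solution is determined by
  \<open>y\<close>, \<open>y'\<close> and the divisor \<open>e = k - l\<close>, and \<open>k + l \<le> 2 N\<close> bounds \<open>y - y'\<close> by \<open>2 N e\<close>.\<close>

lemma card_sq_off_le_divisor_pairs:
  assumes "finite F" "N \<le> 2 ^ m"
  shows "card (sq_off N F) \<le> 2 * (\<Sum>i<m. \<Sum>e=2^i..2 * 2^i. card {z \<in> F \<times> F. fst z \<noteq> snd z \<and>
    int e dvd fst z - snd z \<and> \<bar>fst z - snd z\<bar> \<le> 4 * int N * int (2 ^ i)})"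
proof -
  define P where "P = {(y, y', k, l) \<in> sq_off N F. l < k}"
  define P' where "P' = {(y, y', k, l) \<in> sq_off N F. k < l}"
  have finP: "finite P" "finite P'" using finite_sq_off[OF assms(1), of N]
    by (auto simp: P_def P'_def intro: finite_subset)
  have "sq_off N F \<subseteq> P \<union> P'" by (auto simp: P_def P'_def sq_off_def)
  then have "card (sq_off N F) \<le> card P + card P'"
    using finP by (meson card_Un_le card_mono finite_UnI order.trans)
  moreover have "P' \<subseteq> (\<lambda>(y, y', k, l). (y', y, l, k)) ` P"
  proof
    fix w assume "w \<in> P'"
    moreover obtain y y' k l where "w = (y, y', k, l)" by (cases w)
    ultimately show "w \<in> (\<lambda>(y, y', k, l). (y', y, l, k)) ` P"
      by (intro image_eqI[of _ _ "(y', y, l, k)"]) (auto simp: P_def P'_def sq_off_def)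
  qed
  then have "card P' \<le> card P" using surj_card_le[OF finP(1)] by blast
  ultimately have 1: "card (sq_off N F) \<le> 2 * card P" by simp
  define Z where "Z = (\<lambda>i e. {z \<in> F \<times> F. fst z \<noteq> snd z \<and>
    int e dvd fst z - snd z \<and> \<bar>fst z - snd z\<bar> \<le> 4 * int N * int (2 ^ i)})"
  have finZ: "finite (Z i e)" for i e using assms(1) by (simp add: Z_def)
  define g :: "int \<times> int \<times> nat \<times> nat \<Rightarrow> nat \<times> int \<times> int" where "g = (\<lambda>(y, y', k, l). (k - l, (y, y')))"
  have "inj_on g P"
  proof (rule inj_onI)
    fix a b assume a: "a \<in> P" and b: "b \<in> P" and eq: "g a = g b"
    obtain y y' k l where a': "a = (y, y', k, l)" by (cases a)
    obtain x x' k' l' where b': "b = (x, x', k', l')" by (cases b)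
    have e: "x = y" "x' = y'" "k - l = k' - l'" using eq by (auto simp: g_def a' b')
    have k: "l < k" "y - y' = (int k)\<^sup>2 - (int l)\<^sup>2" using a by (auto simp: P_def a' sq_off_def)
    have k': "l' < k'" "y - y' = (int k')\<^sup>2 - (int l')\<^sup>2" using b e by (auto simp: P_def b' sq_off_def)
    have d: "int k - int l = int k' - int l'" "int k - int l > 0" using k(1) k'(1) e(3) by linarith+
    have "(int k - int l) * (int k + int l) = (int k' - int l') * (int k' + int l')"
      using trans[OF k(2)[symmetric] k'(2)] by (simp add: power2_eq_square algebra_simps)
    then have "(int k - int l) * (int k + int l) = (int k - int l) * (int k' + int l')"
      by (simp only: d(1))
    then have "int k + int l = int k' + int l'" using d(2) by simp
    then have "k = k'" "l = l'" using d(1) by linarith+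
    then show "a = b" using e by (simp add: a' b')
  qed
  then have "card P = card (g ` P)" by (simp add: card_image)
  also have "\<dots> \<le> card (\<Union>i<m. SIGMA e:{2^i..2 * 2^i}. Z i e)"
  proof (rule card_mono)
    show "finite (\<Union>i<m. SIGMA e:{2^i..2 * 2^i}. Z i e)" using finZ by auto
    show "g ` P \<subseteq> (\<Union>i<m. SIGMA e:{2^i..2 * 2^i}. Z i e)"
    proof
      fix w assume "w \<in> g ` P"
      then obtain y y' k l where w: "w = (k - l, (y, y'))" and P: "(y, y', k, l) \<in> P"
        by (auto simp: g_def)
      have kl: "y \<in> F" "y' \<in> F" "1 \<le> l" "l < k" "k \<le> N" "y - y' = (int k)\<^sup>2 - (int l)\<^sup>2"
        using P by (auto simp: P_def sq_off_def)
      define e where "e = k - l"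
      have e: "1 \<le> e" "e < N" "int e = int k - int l" using kl by (auto simp: e_def)
      have yy: "y - y' = int e * (int k + int l)"
        using kl(6) by (simp add: e(3) power2_eq_square algebra_simps)
      obtain i where i: "2 ^ i \<le> e" "e < 2 ^ (i + 1)"
        using ex_power_ivl1[of 2 e] e(1) by auto
      have "i < m"
      proof (rule ccontr)
        assume "\<not> i < m"
        then have "(2::nat) ^ m \<le> 2 ^ i" by (intro power_increasing) auto
        with i e assms(2) show False by linarith
      qed
      \<comment> \<open>Using \<open>2 * 2 ^ i\<close> in place of \<open>e\<close> makes the
        distance bound uniform over the block; this is the source of the factor 4.\<close>
      have "int e \<le> int (2 * 2 ^ i)" using i(2) by (simp only: of_nat_le_iff) simp
      then have "int e * (int k + int l) \<le> int (2 * 2 ^ i) * (2 * int N)"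
        using kl i by (intro mult_mono) auto
      then have up: "y - y' \<le> 4 * int N * int (2 ^ i)" using yy by (simp add: mult_ac)
      have "0 < int e * (int k + int l)" using e kl by (intro mult_pos_pos) auto
      then have pos: "0 < y - y'" using yy by simp
      have "(y, y') \<in> Z i e"
        using kl(1,2) pos up yy by (auto simp: Z_def)
      moreover have "e \<in> {2^i..2 * 2^i}" using i by auto
      ultimately show "w \<in> (\<Union>i<m. SIGMA e:{2^i..2 * 2^i}. Z i e)"
        using \<open>i < m\<close> w by (auto simp: e_def)
    qed
  qed
  also have "\<dots> \<le> (\<Sum>i<m. card (SIGMA e:{2^i..2 * 2^i}. Z i e))"
    by (rule card_UN_le) simp
  also have "\<dots> = (\<Sum>i<m. \<Sum>e=2^i..2 * 2^i. card (Z i e))"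
    using finZ by (intro sum.cong refl card_SigmaI) auto
  finally show ?thesis using 1 by (simp add: Z_def)
qed

lemma sum_powr_dyadic_le: "(\<Sum>i<m. (2 ^ i :: real) powr (1 / 3)) \<le> 4 * (2 ^ m) powr (1 / 3)"
proof -
  define b where "b = (2::real) powr (1 / 3)"
  have "b ^ 3 = 2 powr 1" unfolding b_def by (simp add: powr_power)
  then have b3: "b ^ 3 = 2" by simp
  have b1: "b > 1" unfolding b_def by simp
  \<comment> \<open>The cube of 5/4 is 125/64 < 2, and \<open>b - 1 \<ge> 1 / 4\<close> produces the
    factor 4 of the statement.\<close>
  have "b \<ge> 5 / 4"
  proof (rule ccontr)
    assume "\<not> b \<ge> 5 / 4"
    then have "b ^ 3 < (5 / 4) ^ 3" using b1 by (intro power_strict_mono) auto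
    then show False using b3 by (simp add: power3_eq_cube)
  qed
  have pw: "(2 ^ i :: real) powr (1 / 3) = b ^ i" for i
    by (induction i) (auto simp: powr_mult b_def)
  have "(\<Sum>i<m. b ^ i) = (b ^ m - 1) / (b - 1)" using b1 by (simp add: geometric_sum)
  also have "\<dots> \<le> b ^ m / (1 / 4)"
    using \<open>b \<ge> 5 / 4\<close> b1 by (intro frac_le) auto
  finally show ?thesis by (simp add: pw)
qed

text \<open>The block bounds grow like \<open>(N * 2 ^ i) powr (1 / 3)\<close>, geometrically in
  \<open>i\<close>, so the top block near \<open>N\<close> dominates and summing over the blocks
  costs only a constant.\<close>

lemma card_sq_off_bound:
  obtains C where "C > 0" "\<And>F N. finite F \<Longrightarrow> N > 0 \<Longrightarrow>
    real (card (sq_off N F)) \<le> C * real N powr (2 / 3) * real (card F) powr (5 / 3)"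
proof -
  obtain C where C: "C > 0" "\<And>F N E. finite F \<Longrightarrow> 0 < E \<Longrightarrow> E \<le> N \<Longrightarrow>
    real (\<Sum>e=E..2 * E. card {z \<in> F \<times> F. fst z \<noteq> snd z \<and> int e dvd fst z - snd z \<and>
        \<bar>fst z - snd z\<bar> \<le> 4 * int N * int E})
      \<le> C * (real N * real E) powr (1 / 3) * real (card F) powr (5 / 3)"
    using close_divisible_pairs_bound by blast
  have "real (card (sq_off N F)) \<le> (16 * C) * real N powr (2 / 3) * real (card F) powr (5 / 3)"
    if fin: "finite F" and N: "N > 0" for F :: "int set" and N
  proof -
    \<comment> \<open>The least \<open>m\<close> satisfies \<open>2 ^ m \<le> 2 * N\<close>, which
      keeps the top block comparable to \<open>N\<close>.\<close>
    define m where "m = (LEAST m. N \<le> 2 ^ m)"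
    have "N \<le> 2 ^ N" using less_exp[of N] by linarith
    then have m: "N \<le> 2 ^ m" unfolding m_def by (rule LeastI)
    have m_min: "2 ^ i < N" if "i < m" for i
      using not_less_Least[of i "\<lambda>m. N \<le> 2 ^ m"] that by (simp add: m_def)
    have m2: "(2::nat) ^ m \<le> 2 * N"
    proof (cases m)
      case 0
      then show ?thesis using N by simp
    next
      case (Suc i)
      then show ?thesis using m_min[of i] by simp
    qed
    define f where "f = real (card F) powr (5 / 3)"
    have "real (card (sq_off N F)) \<le> real (2 * (\<Sum>i<m. \<Sum>e=2^i..2 * 2^i. card {z \<in> F \<times> F. fst z \<noteq> snd z \<and>
        int e dvd fst z - snd z \<and> \<bar>fst z - snd z\<bar> \<le> 4 * int N * int (2 ^ i)}))"
      unfolding of_nat_le_iff by (rule card_sq_off_le_divisor_pairs[OF fin m])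
    also have "\<dots> = 2 * (\<Sum>i<m. real (\<Sum>e=2^i..2 * 2^i. card {z \<in> F \<times> F. fst z \<noteq> snd z \<and>
        int e dvd fst z - snd z \<and> \<bar>fst z - snd z\<bar> \<le> 4 * int N * int (2 ^ i)}))"
      by (simp only: of_nat_mult of_nat_sum of_nat_numeral)
    also have "\<dots> \<le> 2 * (\<Sum>i<m. C * (real N * real (2 ^ i)) powr (1 / 3) * f)"
      unfolding f_def
    proof (intro mult_left_mono sum_mono)
      fix i assume "i \<in> {..<m}"
      then have "2 ^ i \<le> N" using m_min[of i] by simp
      then show "real (\<Sum>e=2^i..2 * 2^i. card {z \<in> F \<times> F. fst z \<noteq> snd z \<and>
        int e dvd fst z - snd z \<and> \<bar>fst z - snd z\<bar> \<le> 4 * int N * int (2 ^ i)})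
        \<le> C * (real N * real (2 ^ i)) powr (1 / 3) * real (card F) powr (5 / 3)"
        by (intro C(2)[OF fin]) auto
    qed simp
    also have "\<dots> = 2 * C * f * real N powr (1 / 3) * (\<Sum>i<m. (2 ^ i) powr (1 / 3))"
      by (simp add: powr_mult sum_distrib_left mult_ac)
    also have "\<dots> \<le> 2 * C * f * real N powr (1 / 3) * (8 * real N powr (1 / 3))"
    proof (intro mult_left_mono)
      have "(\<Sum>i<m. (2 ^ i :: real) powr (1 / 3)) \<le> 4 * (2 ^ m) powr (1 / 3)" by (rule sum_powr_dyadic_le)
      also have "\<dots> \<le> 4 * (2 * real N powr (1 / 3))"
      proof (intro mult_left_mono)
        have "(2 ^ m :: real) powr (1 / 3) \<le> (2 * real N) powr (1 / 3)"
        proof (intro powr_mono2)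
          have "real (2 ^ m) \<le> real (2 * N)" using m2 by (simp only: of_nat_le_iff)
          then show "2 ^ m \<le> 2 * real N" by simp
        qed auto
        also have "(2 * real N) powr (1 / 3) = 2 powr (1 / 3) * real N powr (1 / 3)" by (simp add: powr_mult)
        also have "\<dots> \<le> 2 * real N powr (1 / 3)"
          using powr_mono[of "1/3" 1 "2::real"] by (intro mult_right_mono) auto
        finally show "(2 ^ m :: real) powr (1 / 3) \<le> 2 * real N powr (1 / 3)" .
      qed simp
      finally show "(\<Sum>i<m. (2 ^ i :: real) powr (1 / 3)) \<le> 8 * real N powr (1 / 3)" by simp
    qed (use C(1) in \<open>auto simp: f_def\<close>)
    also have "\<dots> = (16 * C) * (real N powr (1 / 3) * real N powr (1 / 3)) * f" by simp
    also have "real N powr (1 / 3) * real N powr (1 / 3) = real N powr (2 / 3)"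
      unfolding powr_add[symmetric] by simp
    finally show ?thesis by (simp add: f_def)
  qed
  then show ?thesis using that[of "16 * C"] C(1) by auto
qed

section \<open>Incidences between two finite sets\<close>

definition incidences :: "nat \<Rightarrow> int set \<Rightarrow> int set \<Rightarrow> nat" where
  "incidences N F G = card {(x, k) \<in> G \<times> {1..N}. x + (int k)\<^sup>2 \<in> F}"

lemma incidences_le_mult: "finite G \<Longrightarrow> incidences N F G \<le> card G * N"
proof -
  assume "finite G"
  then have "incidences N F G \<le> card (G \<times> {1..N})"
    unfolding incidences_def by (intro card_mono) auto
  then show ?thesis by (simp add: card_cartesian_product)
qed

text \<open>Sending \<open>(x, k)\<close> to \<open>(- (x + k^2), k)\<close> exchanges the roles of
  the two sets, so every estimate also holds with them interchanged, although only translates by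
  positive squares occur.\<close>

lemma incidences_reflect: "incidences N F G = incidences N (uminus ` G) (uminus ` F)"
  unfolding incidences_def
proof (rule bij_betw_same_card[of "\<lambda>(x, k). (- (x + (int k)\<^sup>2), k)"], rule bij_betw_imageI)
  show "inj_on (\<lambda>(x, k). (- (x + (int k)\<^sup>2), k)) {(x, k) \<in> G \<times> {1..N}. x + (int k)\<^sup>2 \<in> F}"
    by (auto simp: inj_on_def)
  show "(\<lambda>(x, k). (- (x + (int k)\<^sup>2), k)) ` {(x, k) \<in> G \<times> {1..N}. x + (int k)\<^sup>2 \<in> F}
      = {(x, k) \<in> uminus ` F \<times> {1..N}. x + (int k)\<^sup>2 \<in> uminus ` G}"
  proof (intro equalityI subsetI)
    fix w assume "w \<in> {(x, k) \<in> uminus ` F \<times> {1..N}. x + (int k)\<^sup>2 \<in> uminus ` G}"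
    then obtain y k x where w: "w = (- y, k)" "y \<in> F" "k \<in> {1..N}" "x \<in> G" "- y + (int k)\<^sup>2 = - x"
      by auto
    then have "y = x + (int k)\<^sup>2" by simp
    with w show "w \<in> (\<lambda>(x, k). (- (x + (int k)\<^sup>2), k)) ` {(x, k) \<in> G \<times> {1..N}. x + (int k)\<^sup>2 \<in> F}"
      by (intro image_eqI[of _ _ "(x, k)"]) auto
  next
    fix w assume "w \<in> (\<lambda>(x, k). (- (x + (int k)\<^sup>2), k)) ` {(x, k) \<in> G \<times> {1..N}. x + (int k)\<^sup>2 \<in> F}"
    then obtain x k where w: "w = (- (x + (int k)\<^sup>2), k)" "x \<in> G" "k \<in> {1..N}" "x + (int k)\<^sup>2 \<in> F"
      by auto
    then show "w \<in> {(x, k) \<in> uminus ` F \<times> {1..N}. x + (int k)\<^sup>2 \<in> uminus ` G}"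
      by (auto intro!: imageI simp del: minus_add_distrib)
  qed
qed

lemma incidences_le_mult': "finite F \<Longrightarrow> incidences N F G \<le> card F * N"
  using incidences_le_mult[of "uminus ` F" N "uminus ` G"] incidences_reflect[of N F G]
  by (simp add: card_image)

text \<open>A pair \<open>(x, k)\<close> is determined by \<open>x\<close> and
  \<open>x + k^2\<close>, as \<open>k\<close> is a natural number.\<close>

lemma incidences_le_prod:
  assumes "finite F" "finite G"
  shows "incidences N F G \<le> card F * card G"
proof -
  have "inj_on (\<lambda>(x, k). (x + (int k)\<^sup>2, x)) {(x, k) \<in> G \<times> {1..N}. x + (int k)\<^sup>2 \<in> F}"
    by (auto simp: inj_on_def)
  moreover have "(\<lambda>(x, k). (x + (int k)\<^sup>2, x)) ` {(x, k) \<in> G \<times> {1..N}. x + (int k)\<^sup>2 \<in> F} \<subseteq> F \<times> G"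
    by auto
  ultimately have "incidences N F G \<le> card (F \<times> G)"
    unfolding incidences_def using assms by (intro card_inj_on_le) auto
  then show ?thesis by (simp add: card_cartesian_product)
qed

text \<open>Cauchy-Schwarz in \<open>x\<close>. A term with \<open>k = l\<close> is determined by
  \<open>k\<close> and \<open>y = x + k^2\<close> in \<open>F\<close>; the other terms embed into
  \<open>sq_off N F\<close>.\<close>

lemma incidences_square_le:
  assumes "finite F" "finite G"
  shows "(incidences N F G)\<^sup>2 \<le> card G * (card F * N + card (sq_off N F))"
proof -
  define A where "A = (\<lambda>x. {k \<in> {1..N}. x + (int k)\<^sup>2 \<in> F})"
  have finA: "finite (A x)" for x by (simp add: A_def)
  have "{(x, k) \<in> G \<times> {1..N}. x + (int k)\<^sup>2 \<in> F} = (SIGMA x:G. A x)" by (auto simp: A_def)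
  then have inc: "incidences N F G = (\<Sum>x\<in>G. card (A x))"
    unfolding incidences_def using assms(2) finA by simp
  have "real ((incidences N F G)\<^sup>2) = (\<Sum>x\<in>G. real (card (A x)))\<^sup>2" by (simp add: inc)
  also have "\<dots> \<le> (\<Sum>x\<in>G. (real (card (A x)))\<^sup>2) * real (card G)"
    by (rule sum_squared_le_sum_of_squares)
  also have "\<dots> = real (card G * (\<Sum>x\<in>G. (card (A x))\<^sup>2))" by simp
  finally have 1: "(incidences N F G)\<^sup>2 \<le> card G * (\<Sum>x\<in>G. (card (A x))\<^sup>2)"
    by (simp only: of_nat_le_iff)
  have "(\<Sum>x\<in>G. (card (A x))\<^sup>2) = card (SIGMA x:G. A x \<times> A x)"
    using assms(2) finA by (simp add: card_SigmaI card_cartesian_product power2_eq_square)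
  also have "\<dots> \<le> card ((\<lambda>(y, k). (y, y, k, k)) ` (F \<times> {1..N}) \<union> sq_off N F)"
  proof (rule card_inj_on_le[where f = "\<lambda>(x, k, l). (x + (int k)\<^sup>2, x + (int l)\<^sup>2, k, l)"])
    show "inj_on (\<lambda>(x, k, l). (x + (int k)\<^sup>2, x + (int l)\<^sup>2, k, l)) (SIGMA x:G. A x \<times> A x)"
      by (auto simp: inj_on_def)
    show "(\<lambda>(x, k, l). (x + (int k)\<^sup>2, x + (int l)\<^sup>2, k, l)) ` (SIGMA x:G. A x \<times> A x)
        \<subseteq> (\<lambda>(y, k). (y, y, k, k)) ` (F \<times> {1..N}) \<union> sq_off N F"
    proof clarify
      fix x k l
      assume kl: "x \<in> G" "k \<in> A x" "l \<in> A x" "(x + (int k)\<^sup>2, x + (int l)\<^sup>2, k, l) \<notin> sq_off N F"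
      then have "k = l" by (auto simp: A_def sq_off_def)
      then show "(x + (int k)\<^sup>2, x + (int l)\<^sup>2, k, l) \<in> (\<lambda>(y, k). (y, y, k, k)) ` (F \<times> {1..N})"
        using kl by (intro image_eqI[of _ _ "(x + (int k)\<^sup>2, k)"]) (auto simp: A_def)
    qed
    show "finite ((\<lambda>(y, k). (y, y, k, k)) ` (F \<times> {1..N}) \<union> sq_off N F)"
      using assms(1) finite_sq_off by auto
  qed
  also have "\<dots> \<le> card ((\<lambda>(y, k). (y, y, k, k)) ` (F \<times> {1..N})) + card (sq_off N F)"
    by (rule card_Un_le)
  also have "card ((\<lambda>(y, k). (y, y, k, k)) ` (F \<times> {1..N})) \<le> card (F \<times> {1..N})"
    using assms(1) by (intro card_image_le) auto
  finally have "(\<Sum>x\<in>G. (card (A x))\<^sup>2) \<le> card F * N + card (sq_off N F)"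
    by (simp add: card_cartesian_product)
  then show ?thesis using 1 by (meson le_trans mult_le_mono2)
qed

text \<open>Put \<open>u = f * g\<close>. If \<open>u \<le> N\<close>, the trivial bound
  \<open>u\<close> suffices; otherwise the diagonal \<open>u * N\<close> is at most
  \<open>N powr (2 / 3) * u powr (4 / 3)\<close>. Off the diagonal,
  \<open>g * f powr (5 / 3)\<close> is at most \<open>u powr (4 / 3)\<close> precisely when
  \<open>f \<le> g\<close>, which reflection arranges.\<close>

lemma incidences_bound:
  obtains C where "C \<ge> 1" "\<And>F G N. finite F \<Longrightarrow> finite G \<Longrightarrow> N > 0 \<Longrightarrow>
    real (incidences N F G) \<le> C * real N powr (1 / 3) * (real (card F) * real (card G)) powr (2 / 3)"
proof -
  obtain C where C: "C > 0" "\<And>F N. finite F \<Longrightarrow> N > 0 \<Longrightarrow>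
      real (card (sq_off N F)) \<le> C * real N powr (2 / 3) * real (card F) powr (5 / 3)"
    using card_sq_off_bound by blast
  have *: "real (incidences N F G) \<le> (1 + C) * real N powr (1 / 3) * (real (card F) * real (card G)) powr (2 / 3)"
    if fin: "finite F" "finite G" and N: "N > 0" and le: "card F \<le> card G" for F G N
  proof (cases "F = {}")
    case True
    then show ?thesis using incidences_le_prod[OF fin, of N] by simp
  next
    case False
    define f where "f = real (card F)"
    define g where "g = real (card G)"
    define u where "u = f * g"
    have "card F > 0" using False fin by (simp add: card_gt_0_iff)
    then have fg: "f \<ge> 1" "f \<le> g" using le by (auto simp: f_def g_def)
    then have u: "u \<ge> 1" using mult_mono[of 1 f 1 g] by (simp add: u_def)
    show ?thesis
    proof (cases "u \<le> real N")
      case True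
      have "real (incidences N F G) \<le> real (card F * card G)"
        unfolding of_nat_le_iff by (rule incidences_le_prod[OF fin])
      also have "\<dots> = u powr (1 / 3) * u powr (2 / 3)"
        using u by (simp add: u_def f_def g_def flip: powr_add)
      also have "\<dots> \<le> real N powr (1 / 3) * u powr (2 / 3)"
        using True u by (intro mult_right_mono powr_mono2) auto
      also have "\<dots> \<le> (1 + C) * (real N powr (1 / 3) * u powr (2 / 3))"
        using C(1) mult_right_mono[of 1 "1 + C" "real N powr (1 / 3) * u powr (2 / 3)"] by simp
      finally show ?thesis by (simp add: u_def f_def g_def mult.assoc)
    next
      case False
      have "real ((incidences N F G)\<^sup>2) \<le> real (card G * (card F * N + card (sq_off N F)))"
        unfolding of_nat_le_iff by (rule incidences_square_le[OF fin])
      also have "\<dots> = g * (f * real N + real (card (sq_off N F)))" by (simp add: f_def g_def)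
      also have "\<dots> \<le> g * (f * real N + C * real N powr (2 / 3) * f powr (5 / 3))"
        using C(2)[OF fin(1) N] fg by (intro mult_left_mono add_left_mono) (auto simp: f_def)
      also have "\<dots> = real N powr (2 / 3) * (u * real N powr (1 / 3)) + C * real N powr (2 / 3) * (g * f powr (5 / 3))"
      proof -
        have "real N = real N powr (2 / 3) * real N powr (1 / 3)"
          using N by (simp flip: powr_add)
        then show ?thesis by (simp add: u_def distrib_left mult_ac)
      qed
      also have "\<dots> \<le> real N powr (2 / 3) * u powr (4 / 3) + C * real N powr (2 / 3) * u powr (4 / 3)"
      proof (intro add_mono mult_left_mono)
        have "u * real N powr (1 / 3) \<le> u * u powr (1 / 3)"
          using False u by (intro mult_left_mono powr_mono2) auto
        also have "\<dots> = u powr (4 / 3)" using u powr_add[of u 1 "1/3"] by simp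
        finally show "u * real N powr (1 / 3) \<le> u powr (4 / 3)" .
        have "g * f powr (5 / 3) = g * f powr (4 / 3) * f powr (1 / 3)"
          by (simp add: mult.assoc flip: powr_add)
        also have "\<dots> \<le> g * f powr (4 / 3) * g powr (1 / 3)"
          using fg by (intro mult_left_mono powr_mono2) auto
        also have "\<dots> = f powr (4 / 3) * (g powr 1 * g powr (1 / 3))" using fg by simp
        also have "g powr 1 * g powr (1 / 3) = g powr (4 / 3)" unfolding powr_add[symmetric] by simp
        also have "f powr (4 / 3) * g powr (4 / 3) = u powr (4 / 3)"
          using fg by (simp add: u_def powr_mult)
        finally show "g * f powr (5 / 3) \<le> u powr (4 / 3)" .
      qed (use C(1) in auto)
      also have "\<dots> = (1 + C) * (real N powr (2 / 3) * u powr (4 / 3))" by (simp add: algebra_simps)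
      also have "\<dots> \<le> (1 + C)\<^sup>2 * (real N powr (2 / 3) * u powr (4 / 3))"
        using C(1) by (intro mult_right_mono) (auto simp: power2_eq_square)
      also have "\<dots> = ((1 + C) * real N powr (1 / 3) * u powr (2 / 3))\<^sup>2"
        using N u by (simp add: power_mult_distrib powr_power)
      finally have "(real (incidences N F G))\<^sup>2 \<le> ((1 + C) * real N powr (1 / 3) * u powr (2 / 3))\<^sup>2"
        by simp
      then have "real (incidences N F G) \<le> (1 + C) * real N powr (1 / 3) * u powr (2 / 3)"
        using C(1) by (intro power2_le_imp_le[of "real (incidences N F G)"]) auto
      then show ?thesis by (simp add: u_def f_def g_def)
    qed
  qed
  have "real (incidences N F G) \<le> (1 + C) * real N powr (1 / 3) * (real (card F) * real (card G)) powr (2 / 3)"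
    if fin: "finite F" "finite G" and N: "N > 0" for F G N
  proof (cases "card F \<le> card G")
    case True
    then show ?thesis using *[OF fin N] by blast
  next
    case False
    then show ?thesis
      using *[of "uminus ` G" "uminus ` F" N] fin N incidences_reflect[of N F G]
      by (simp add: card_image mult.commute)
  qed
  then show ?thesis using that[of "1 + C"] C(1) by auto
qed

text \<open>The geometric mean of the trivial bounds \<open>card F * N\<close> and
  \<open>card G * N\<close>; this is the l^2 estimate for indicator functions.\<close>

lemma incidences_le_sqrt:
  assumes "finite F" "finite G"
  shows "real (incidences N F G) \<le> real N * (real (card F) * real (card G)) powr (1 / 2)"
proof -
  have "(incidences N F G)\<^sup>2 \<le> (card F * N) * (card G * N)"
    unfolding power2_eq_square
    using incidences_le_mult[OF assms(2)] incidences_le_mult'[OF assms(1)] by (intro mult_le_mono) auto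
  then have "real ((incidences N F G)\<^sup>2) \<le> real ((card F * N) * (card G * N))"
    by (simp only: of_nat_le_iff)
  also have "\<dots> = (real N * sqrt (real (card F) * real (card G)))\<^sup>2"
    by (simp add: power_mult_distrib power2_eq_square)
  finally have "real (incidences N F G) \<le> real N * sqrt (real (card F) * real (card G))"
    by (intro power2_le_imp_le[of "real (incidences N F G)"]) auto
  then show ?thesis by (simp add: powr_half_sqrt)
qed

section \<open>Interpolation\<close>

lemma sum_one_sided_geometric:
  fixes S :: "int set" and s \<gamma> :: real
  assumes "\<gamma> > 0" "finite S" "\<And>n. n \<in> S \<Longrightarrow> s \<le> real_of_int n"
  shows "(\<Sum>n\<in>S. 2 powr (- \<gamma> * (real_of_int n - s))) \<le> 1 / (1 - 2 powr (- \<gamma>))"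
proof -
  define b where "b = (2::real) powr (- \<gamma>)"
  have b: "0 < b" "b < 1" using assms(1) by (auto simp: b_def powr_less_one)
  define j where "j = (\<lambda>n. nat (n - \<lceil>s\<rceil>))"
  have ge: "\<lceil>s\<rceil> \<le> n" if "n \<in> S" for n using assms(3)[OF that] by (simp add: ceiling_le_iff)
  have inj: "inj_on j S"
  proof (rule inj_onI)
    fix n n' assume "n \<in> S" "n' \<in> S" "j n = j n'"
    then show "n = n'" using ge[of n] ge[of n'] by (simp add: j_def)
  qed
  have "(\<Sum>n\<in>S. 2 powr (- \<gamma> * (real_of_int n - s))) \<le> (\<Sum>n\<in>S. b ^ j n)"
  proof (rule sum_mono)
    fix n assume "n \<in> S"
    then have "real (j n) = real_of_int (n - \<lceil>s\<rceil>)" using ge by (simp add: j_def)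
    then have "real (j n) \<le> real_of_int n - s" using le_of_int_ceiling[of s] by simp
    then have "- \<gamma> * (real_of_int n - s) \<le> - \<gamma> * real (j n)" using assms(1) by simp
    then have "2 powr (- \<gamma> * (real_of_int n - s)) \<le> 2 powr (- \<gamma> * real (j n))"
      by (intro powr_mono) auto
    also have "\<dots> = b ^ j n" by (simp add: b_def powr_power mult.commute)
    finally show "2 powr (- \<gamma> * (real_of_int n - s)) \<le> b ^ j n" .
  qed
  also have "\<dots> = (\<Sum>i\<in>j ` S. b ^ i)" by (simp add: sum.reindex[OF inj])
  also have "\<dots> \<le> (\<Sum>i<Suc (Max (j ` S)). b ^ i)"
    using assms(2) b by (intro sum_mono2) (auto simp: less_Suc_eq_le)
  also have "\<dots> = (1 - b ^ Suc (Max (j ` S))) / (1 - b)"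
    using b by (simp add: geometric_sum divide_simps del: power_Suc) (simp add: algebra_simps)
  also have "\<dots> \<le> 1 / (1 - b)" using b by (intro divide_right_mono) auto
  finally show ?thesis by (simp add: b_def)
qed

text \<open>The bound is uniform in \<open>s\<close>, so in a double sum depending on
  \<open>m + n\<close> one index may act as a shift of the other.\<close>

lemma sum_two_sided_geometric:
  fixes S :: "int set" and s \<gamma> :: real
  assumes "\<gamma> > 0" "finite S"
  shows "(\<Sum>n\<in>S. 2 powr (- \<gamma> * \<bar>real_of_int n - s\<bar>)) \<le> 2 / (1 - 2 powr (- \<gamma>))"
proof -
  define P where "P = {n \<in> S. s \<le> real_of_int n}"
  define M where "M = {n \<in> S. \<not> s \<le> real_of_int n}"
  have fin: "finite P" "finite M" using assms(2) by (auto simp: P_def M_def)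
  have "(\<Sum>n\<in>P. 2 powr (- \<gamma> * \<bar>real_of_int n - s\<bar>)) = (\<Sum>n\<in>P. 2 powr (- \<gamma> * (real_of_int n - s)))"
    by (intro sum.cong) (auto simp: P_def)
  also have "\<dots> \<le> 1 / (1 - 2 powr (- \<gamma>))"
    using assms fin by (intro sum_one_sided_geometric) (auto simp: P_def)
  finally have 1: "(\<Sum>n\<in>P. 2 powr (- \<gamma> * \<bar>real_of_int n - s\<bar>)) \<le> 1 / (1 - 2 powr (- \<gamma>))" .
  have "(\<Sum>n\<in>M. 2 powr (- \<gamma> * \<bar>real_of_int n - s\<bar>)) = (\<Sum>n\<in>uminus ` M. 2 powr (- \<gamma> * (real_of_int n - (- s))))"
    by (subst sum.reindex) (auto simp: M_def intro!: sum.cong)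
  also have "\<dots> \<le> 1 / (1 - 2 powr (- \<gamma>))"
    using assms fin by (intro sum_one_sided_geometric) (auto simp: M_def)
  finally have 2: "(\<Sum>n\<in>M. 2 powr (- \<gamma> * \<bar>real_of_int n - s\<bar>)) \<le> 1 / (1 - 2 powr (- \<gamma>))" .
  have "S = P \<union> M" "P \<inter> M = {}" by (auto simp: P_def M_def)
  then have "(\<Sum>n\<in>S. 2 powr (- \<gamma> * \<bar>real_of_int n - s\<bar>)) =
      (\<Sum>n\<in>P. 2 powr (- \<gamma> * \<bar>real_of_int n - s\<bar>)) + (\<Sum>n\<in>M. 2 powr (- \<gamma> * \<bar>real_of_int n - s\<bar>))"
    using fin by (simp add: sum.union_disjoint)
  with 1 2 show ?thesis by simp
qed

lemma dyadic_level:
  fixes v :: real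
  assumes "v > 0"
  shows "2 powr of_int \<lfloor>log 2 v\<rfloor> \<le> v" "v \<le> 2 * 2 powr of_int \<lfloor>log 2 v\<rfloor>"
proof -
  have v: "v = 2 powr log 2 v" using assms by simp
  show "2 powr of_int \<lfloor>log 2 v\<rfloor> \<le> v" by (subst (2) v) (intro powr_mono, auto)
  have "v \<le> 2 powr (1 + of_int \<lfloor>log 2 v\<rfloor>)" by (subst v) (intro powr_mono, linarith, auto)
  then show "v \<le> 2 * 2 powr of_int \<lfloor>log 2 v\<rfloor>" by (simp add: powr_add)
qed

text \<open>Chebyshev on each level set, the levels being disjoint. The point is that the masses are
  summable over all levels and not merely bounded one by one.\<close>

lemma sum_level_mass_le:
  fixes f :: "int \<Rightarrow> real"
  assumes "finite Z" "finite M" "p > 0" "(\<Sum>z\<in>Z. f z powr p) \<le> 1"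
  shows "(\<Sum>m\<in>M. real (card {z \<in> Z. 0 < f z \<and> \<lfloor>log 2 (f z)\<rfloor> = m}) * 2 powr (of_int m * p)) \<le> 1"
proof -
  have "(\<Sum>m\<in>M. real (card {z \<in> Z. 0 < f z \<and> \<lfloor>log 2 (f z)\<rfloor> = m}) * 2 powr (of_int m * p))
      \<le> (\<Sum>m\<in>M. \<Sum>z\<in>{z \<in> Z. 0 < f z \<and> \<lfloor>log 2 (f z)\<rfloor> = m}. f z powr p)"
  proof (rule sum_mono)
    fix m
    have "2 powr (of_int m * p) \<le> f z powr p" if "z \<in> {z \<in> Z. 0 < f z \<and> \<lfloor>log 2 (f z)\<rfloor> = m}" for z
    proof -
      have "2 powr of_int m \<le> f z" using dyadic_level(1)[of "f z"] that by auto
      then have "(2 powr of_int m) powr p \<le> f z powr p" using assms(3) by (intro powr_mono2) auto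
      then show ?thesis by (simp add: powr_powr)
    qed
    then show "real (card {z \<in> Z. 0 < f z \<and> \<lfloor>log 2 (f z)\<rfloor> = m}) * 2 powr (of_int m * p)
        \<le> (\<Sum>z\<in>{z \<in> Z. 0 < f z \<and> \<lfloor>log 2 (f z)\<rfloor> = m}. f z powr p)"
      by (intro sum_bounded_below)
  qed
  also have "\<dots> = (\<Sum>z\<in>(\<Union>m\<in>M. {z \<in> Z. 0 < f z \<and> \<lfloor>log 2 (f z)\<rfloor> = m}). f z powr p)"
    using assms(1,2) by (intro sum.UNION_disjoint[symmetric]) auto
  also have "\<dots> \<le> (\<Sum>z\<in>Z. f z powr p)" using assms(1) by (intro sum_mono2) auto
  finally show ?thesis using assms(4) by linarith
qed

text \<open>Put \<open>k = m + n\<close>. As \<open>k\<close> grows, the first bound times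
  \<open>2 powr k\<close> decays like \<open>2 powr (k * (1 - 2 * p / 3))\<close> and the second
  grows like \<open>2 powr (k * (1 - p / 2))\<close>. Up to constants and masses they agree at
  \<open>k = t\<close>, where \<open>2 powr (- k * p / 6)\<close> equals
  \<open>N powr (2 / 3)\<close>, with common value \<open>N * N powr (2 - 4 / p)\<close>.\<close>

lemma dyadic_block_bound:
  fixes p C N a b :: real and m n :: int
  assumes p: "3 / 2 < p" "p < 2" and "C \<ge> 1" "N \<ge> 1" "a \<ge> 0" "b \<ge> 0" "I \<ge> 0"
    and I1: "I \<le> C * N powr (1 / 3) * (a * b) powr (2 / 3)"
    and I2: "I \<le> N * (a * b) powr (1 / 2)"
    and a1: "a * 2 powr (of_int m * p) \<le> 1" and b1: "b * 2 powr (of_int n * p) \<le> 1"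
  shows "2 powr of_int m * 2 powr of_int n * I \<le> C * N * N powr (2 - 4 / p) *
    2 powr (- min (2 * p / 3 - 1) (1 - p / 2) * \<bar>of_int (m + n) + 4 / p * log 2 N\<bar>) *
    ((a * 2 powr (of_int m * p) + b * 2 powr (of_int n * p)) / 2)"
proof -
  define c where "c = a * 2 powr (of_int m * p)"
  define d where "d = b * 2 powr (of_int n * p)"
  define k where "k = real_of_int (m + n)"
  define t where "t = - (4 / p) * log 2 N"
  define \<gamma> where "\<gamma> = min (2 * p / 3 - 1) (1 - p / 2)"
  have cd: "0 \<le> c" "0 \<le> d" "c \<le> 1" "d \<le> 1" using assms by (auto simp: c_def d_def)
  have ab: "a * b = c * d * 2 powr (- k * p)"
  proof -
    have "2 powr (of_int m * p) * 2 powr (of_int n * p) * 2 powr (- k * p) = 1"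
      unfolding powr_add[symmetric] by (simp add: k_def algebra_simps)
    then show ?thesis by (simp add: c_def d_def mult_ac)
  qed
  have pow: "(a * b) powr r = (c * d) powr r * 2 powr (- k * p * r)" for r
    unfolding ab using cd by (simp add: powr_mult powr_powr)
  \<comment> \<open>Powers of \<open>N\<close> become powers of 2, which reduces both product
    identities below to identities between exponents.\<close>
  have N2: "N powr r = 2 powr (- t * p / 4 * r)" for r
  proof -
    have "2 powr (- t * p / 4) = N" using assms p by (simp add: t_def)
    then show ?thesis by (metis powr_powr)
  qed
  have exp_eq: "- t * p / 4 * (2 - 4 / p) = - t / 4 * (2 * p - 4)" using p by (simp add: field_simps)
  \<comment> \<open>Trading the geometric mean for \<open>(c + d) / 2\<close> leaves, in each
    summand, one index that carries only the geometric decay.\<close>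
  have half: "(c * d) powr (1 / 2) \<le> (c + d) / 2"
    using cd arith_geo_mean_sqrt[of c d] by (simp add: powr_half_sqrt)
  have "2 powr k * I \<le> C * N * N powr (2 - 4 / p) * 2 powr (- \<gamma> * \<bar>k - t\<bar>) * (c * d) powr (1 / 2)"
  proof (cases "k \<ge> t")
    case True
    have "2 powr k * I \<le> 2 powr k * (C * N powr (1 / 3) * ((c * d) powr (2 / 3) * 2 powr (- k * p * (2 / 3))))"
      using I1 unfolding pow by (intro mult_left_mono) auto
    also have "\<dots> = C * (N powr (1 / 3) * 2 powr k * 2 powr (- k * p * (2 / 3))) * (c * d) powr (2 / 3)"
      by simp
    also have "N powr (1 / 3) * 2 powr k * 2 powr (- k * p * (2 / 3))
        = N powr 1 * N powr (2 - 4 / p) * 2 powr (- (2 * p / 3 - 1) * (k - t))"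
      unfolding N2 powr_add[symmetric] exp_eq by (intro arg_cong[where f = "\<lambda>v. 2 powr v"]) (simp add: field_simps)
    also have "N powr 1 = N" using assms by simp
    also have "C * (N * N powr (2 - 4 / p) * 2 powr (- (2 * p / 3 - 1) * (k - t))) * (c * d) powr (2 / 3)
        \<le> C * (N * N powr (2 - 4 / p) * 2 powr (- \<gamma> * \<bar>k - t\<bar>)) * (c * d) powr (1 / 2)"
    proof -
      have "\<gamma> * (k - t) \<le> (2 * p / 3 - 1) * (k - t)"
        using True by (intro mult_right_mono) (auto simp: \<gamma>_def)
      moreover have "\<bar>k - t\<bar> = k - t" using True by simp
      ultimately have "- (2 * p / 3 - 1) * (k - t) \<le> - \<gamma> * \<bar>k - t\<bar>"
        by (simp only: mult_minus_left neg_le_iff_le)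
      then have 1: "2 powr (- (2 * p / 3 - 1) * (k - t)) \<le> 2 powr (- \<gamma> * \<bar>k - t\<bar>)"
        by (intro powr_mono) auto
      \<comment> \<open>Masses at most 1 allow the exponent 2/3 to be lowered to the 1/2 that the
        other case yields.\<close>
      have "c * d \<le> 1" using cd mult_mono[of c 1 d 1] by simp
      then have 2: "(c * d) powr (2 / 3) \<le> (c * d) powr (1 / 2)"
        using cd by (intro powr_mono') auto
      show ?thesis using assms by (intro mult_mono[OF _ 2] mult_left_mono 1) auto
    qed
    finally show ?thesis by (simp only: mult.assoc)
  next
    case False
    have "2 powr k * I \<le> 2 powr k * (N * ((c * d) powr (1 / 2) * 2 powr (- k * p * (1 / 2))))"
      using I2 unfolding pow by (intro mult_left_mono) auto
    also have "\<dots> = 1 * (N * (2 powr k * 2 powr (- k * p * (1 / 2)))) * (c * d) powr (1 / 2)"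
      by simp
    also have "2 powr k * 2 powr (- k * p * (1 / 2)) = N powr (2 - 4 / p) * 2 powr (- (1 - p / 2) * (t - k))"
      unfolding N2 powr_add[symmetric] exp_eq by (intro arg_cong[where f = "\<lambda>v. 2 powr v"]) (simp add: field_simps)
    also have "1 * (N * (N powr (2 - 4 / p) * 2 powr (- (1 - p / 2) * (t - k)))) * (c * d) powr (1 / 2)
        \<le> C * (N * (N powr (2 - 4 / p) * 2 powr (- \<gamma> * \<bar>k - t\<bar>))) * (c * d) powr (1 / 2)"
    proof -
      have "\<gamma> * (t - k) \<le> (1 - p / 2) * (t - k)"
        using False by (intro mult_right_mono) (auto simp: \<gamma>_def)
      moreover have "\<bar>k - t\<bar> = t - k" using False by simp
      ultimately have "- (1 - p / 2) * (t - k) \<le> - \<gamma> * \<bar>k - t\<bar>"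
        by (simp only: mult_minus_left neg_le_iff_le)
      then have 1: "2 powr (- (1 - p / 2) * (t - k)) \<le> 2 powr (- \<gamma> * \<bar>k - t\<bar>)"
        by (intro powr_mono) auto
      show ?thesis
        using assms by (intro mult_right_mono mult_mono[OF \<open>C \<ge> 1\<close>] mult_left_mono 1) auto
    qed
    finally show ?thesis by (simp only: mult.assoc)
  qed
  also have "\<dots> \<le> C * N * N powr (2 - 4 / p) * 2 powr (- \<gamma> * \<bar>k - t\<bar>) * ((c + d) / 2)"
    using half assms by (intro mult_left_mono) auto
  finally show ?thesis by (simp add: c_def d_def \<gamma>_def k_def t_def powr_add)
qed

section \<open>Bilinear estimates\<close>

text \<open>A block decays only with the distance of \<open>m + n\<close> from \<open>s\<close>, not
  along the lines where \<open>m + n\<close> is constant. There the masses provide convergence: in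
  the part with \<open>c m\<close> the sum over \<open>n\<close> is geometric, after which the
  masses sum to at most 1; the part with \<open>d n\<close> is symmetric.\<close>

lemma bilinear_bound:
  fixes p :: real
  assumes p: "3 / 2 < p" "p < 2"
  obtains C where "C > 0" "\<And>N Y Z (f::int \<Rightarrow> real) (g::int \<Rightarrow> real). N > 0 \<Longrightarrow> finite Y \<Longrightarrow> finite Z \<Longrightarrow>
    (\<And>x k. x \<in> Y \<Longrightarrow> k \<in> {1..N} \<Longrightarrow> x + (int k)\<^sup>2 \<in> Z) \<Longrightarrow>
    (\<And>x. f x \<ge> 0) \<Longrightarrow> (\<And>x. g x \<ge> 0) \<Longrightarrow>
    (\<Sum>z\<in>Z. f z powr p) \<le> 1 \<Longrightarrow> (\<Sum>x\<in>Y. g x powr p) \<le> 1 \<Longrightarrow>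
    (\<Sum>x\<in>Y. \<Sum>k=1..N. f (x + (int k)\<^sup>2) * g x) \<le> C * real N * real N powr (2 - 4 / p)"
proof -
  obtain C where C: "C \<ge> 1" "\<And>F G N. finite F \<Longrightarrow> finite G \<Longrightarrow> N > 0 \<Longrightarrow>
      real (incidences N F G) \<le> C * real N powr (1 / 3) * (real (card F) * real (card G)) powr (2 / 3)"
    using incidences_bound by blast
  define \<gamma> where "\<gamma> = min (2 * p / 3 - 1) (1 - p / 2)"
  have \<gamma>: "\<gamma> > 0" using p by (simp add: \<gamma>_def)
  define K where "K = 2 / (1 - (2::real) powr (- \<gamma>))"
  have K: "K > 0" using \<gamma> by (simp add: K_def powr_less_one)
  have "(\<Sum>x\<in>Y. \<Sum>k=1..N. f (x + (int k)\<^sup>2) * g x) \<le> (4 * C * K) * real N * real N powr (2 - 4 / p)"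
    if N: "N > 0" and fin: "finite Y" "finite Z" and YZ: "\<And>x k. x \<in> Y \<Longrightarrow> k \<in> {1..N} \<Longrightarrow> x + (int k)\<^sup>2 \<in> Z"
      and nonneg: "\<And>x. f x \<ge> 0" "\<And>x. g x \<ge> 0"
      and f1: "(\<Sum>z\<in>Z. f z powr p) \<le> 1" and g1: "(\<Sum>x\<in>Y. g x powr p) \<le> 1"
    for N :: nat and Y Z and f g :: "int \<Rightarrow> real"
  proof -
    define lev where "lev = (\<lambda>v::real. \<lfloor>log 2 v\<rfloor>)"
    define F where "F = (\<lambda>m. {z \<in> Z. 0 < f z \<and> lev (f z) = m})"
    define G where "G = (\<lambda>n. {x \<in> Y. 0 < g x \<and> lev (g x) = n})"
    define M where "M = (\<lambda>z. lev (f z)) ` Z"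
    define M' where "M' = (\<lambda>x. lev (g x)) ` Y"
    have finM: "finite M" "finite M'" using fin by (auto simp: M_def M'_def)
    have finFG: "finite (F m)" "finite (G n)" for m n using fin by (auto simp: F_def G_def)
    \<comment> \<open>Zero values are dropped first, because dyadic levels make sense only for
      positive arguments.\<close>
    define P where "P = {w \<in> Y \<times> {1..N}. 0 < f (fst w + (int (snd w))\<^sup>2) \<and> 0 < g (fst w)}"
    define h where "h = (\<lambda>w. f (fst w + (int (snd w))\<^sup>2) * g (fst w))"
    define L where "L = (\<lambda>w::int \<times> nat. (lev (f (fst w + (int (snd w))\<^sup>2)), lev (g (fst w))))"
    define c where "c = (\<lambda>m. real (card (F m)) * 2 powr (of_int m * p))"
    define d where "d = (\<lambda>n. real (card (G n)) * 2 powr (of_int n * p))"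
    define s where "s = - (4 / p) * log 2 (real N)"
    have finP: "finite P" using fin by (simp add: P_def)
    have c_sum: "(\<Sum>m\<in>M. c m) \<le> 1"
      unfolding c_def F_def lev_def using p by (intro sum_level_mass_le fin finM f1) auto
    have d_sum: "(\<Sum>n\<in>M'. d n) \<le> 1"
      unfolding d_def G_def lev_def using p by (intro sum_level_mass_le fin finM g1) auto
    have cd_nonneg: "c m \<ge> 0" "d n \<ge> 0" for m n by (auto simp: c_def d_def)
    have c1: "c m \<le> 1" if "m \<in> M" for m
      using member_le_sum[OF that, of c] finM cd_nonneg c_sum by force
    have d1: "d n \<le> 1" if "n \<in> M'" for n
      using member_le_sum[OF that, of d] finM cd_nonneg d_sum by force
    define A where "A = C * real N * real N powr (2 - 4 / p)"
    have A: "A \<ge> 0" using C(1) by (simp add: A_def)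
    have block: "(\<Sum>w\<in>{w \<in> P. L w = (m, n)}. h w)
        \<le> 4 * A * (2 powr (- \<gamma> * \<bar>of_int (m + n) - s\<bar>) * ((c m + d n) / 2))"
      if mn: "m \<in> M" "n \<in> M'" for m n
    proof -
      have "(\<Sum>w\<in>{w \<in> P. L w = (m, n)}. h w) \<le> (\<Sum>w\<in>{w \<in> P. L w = (m, n)}. 4 * (2 powr of_int m * 2 powr of_int n))"
      proof (rule sum_mono)
        fix w assume w: "w \<in> {w \<in> P. L w = (m, n)}"
        have "f (fst w + (int (snd w))\<^sup>2) \<le> 2 * 2 powr of_int m" "g (fst w) \<le> 2 * 2 powr of_int n"
          using w dyadic_level(2)[of "f (fst w + (int (snd w))\<^sup>2)"] dyadic_level(2)[of "g (fst w)"]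
          by (auto simp: P_def L_def lev_def)
        then have "h w \<le> (2 * 2 powr of_int m) * (2 * 2 powr of_int n)"
          unfolding h_def using nonneg by (intro mult_mono) auto
        then show "h w \<le> 4 * (2 powr of_int m * 2 powr of_int n)" by simp
      qed
      also have "\<dots> = 4 * (2 powr of_int m * 2 powr of_int n * real (card {w \<in> P. L w = (m, n)}))"
        by simp
      also have "card {w \<in> P. L w = (m, n)} = incidences N (F m) (G n)"
        unfolding incidences_def using YZ by (intro arg_cong[of _ _ card]) (auto simp: P_def L_def F_def G_def)
      finally have 1: "(\<Sum>w\<in>{w \<in> P. L w = (m, n)}. h w)
          \<le> 4 * (2 powr of_int m * 2 powr of_int n * real (incidences N (F m) (G n)))" .
      have "2 powr of_int m * 2 powr of_int n * real (incidences N (F m) (G n))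
          \<le> A * 2 powr (- \<gamma> * \<bar>of_int (m + n) - s\<bar>) * ((c m + d n) / 2)"
        using dyadic_block_bound[OF p C(1) _ _ _ _ C(2)[OF finFG N] incidences_le_sqrt[OF finFG], of m n m n]
          N c1[OF mn(1)] d1[OF mn(2)]
        by (simp add: A_def \<gamma>_def s_def c_def d_def)
      with 1 show ?thesis by (simp only: mult.assoc)
    qed
    have "(\<Sum>x\<in>Y. \<Sum>k=1..N. f (x + (int k)\<^sup>2) * g x) = (\<Sum>w\<in>Y \<times> {1..N}. h w)"
      by (simp add: sum.cartesian_product h_def case_prod_beta)
    also have "\<dots> = (\<Sum>w\<in>P. h w)"
    proof (rule sum.mono_neutral_right)
      show "\<forall>w\<in>Y \<times> {1..N} - P. h w = 0"
        using nonneg by (auto simp: P_def h_def less_le)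
    qed (use fin in \<open>auto simp: P_def\<close>)
    also have "\<dots> = (\<Sum>mn\<in>M \<times> M'. \<Sum>w\<in>{w \<in> P. L w = mn}. h w)"
      using finP finM YZ by (intro sum.group[symmetric]) (auto simp: P_def L_def M_def M'_def)
    also have "\<dots> \<le> (\<Sum>(m, n)\<in>M \<times> M'. 4 * A * (2 powr (- \<gamma> * \<bar>of_int (m + n) - s\<bar>) * ((c m + d n) / 2)))"
      using block by (intro sum_mono) auto
    also have "\<dots> = 4 * A * (\<Sum>(m, n)\<in>M \<times> M'. 2 powr (- \<gamma> * \<bar>of_int (m + n) - s\<bar>) * ((c m + d n) / 2))"
      by (simp add: sum_distrib_left case_prod_beta)
    also have "(\<Sum>(m, n)\<in>M \<times> M'. 2 powr (- \<gamma> * \<bar>of_int (m + n) - s\<bar>) * ((c m + d n) / 2))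
        = (\<Sum>m\<in>M. \<Sum>n\<in>M'. c m / 2 * 2 powr (- \<gamma> * \<bar>of_int n - (s - of_int m)\<bar>))
          + (\<Sum>m\<in>M. \<Sum>n\<in>M'. d n / 2 * 2 powr (- \<gamma> * \<bar>of_int m - (s - of_int n)\<bar>))"
      unfolding sum.cartesian_product[symmetric] sum.distrib[symmetric]
      by (intro sum.cong refl) (simp add: algebra_simps)
    also have "\<dots> \<le> K / 2 + K / 2"
    proof (rule add_mono)
      have "(\<Sum>m\<in>M. \<Sum>n\<in>M'. c m / 2 * 2 powr (- \<gamma> * \<bar>of_int n - (s - of_int m)\<bar>)) \<le> (\<Sum>m\<in>M. c m / 2 * K)"
        unfolding sum_distrib_left[symmetric] K_def
        using cd_nonneg by (intro sum_mono mult_left_mono sum_two_sided_geometric \<gamma> finM) auto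
      also have "\<dots> = (\<Sum>m\<in>M. c m) * (K / 2)" by (simp add: sum_distrib_right)
      also have "\<dots> \<le> 1 * (K / 2)" using K c_sum by (intro mult_right_mono) auto
      finally show "(\<Sum>m\<in>M. \<Sum>n\<in>M'. c m / 2 * 2 powr (- \<gamma> * \<bar>of_int n - (s - of_int m)\<bar>)) \<le> K / 2" by simp
      have "(\<Sum>m\<in>M. \<Sum>n\<in>M'. d n / 2 * 2 powr (- \<gamma> * \<bar>of_int m - (s - of_int n)\<bar>))
          = (\<Sum>n\<in>M'. \<Sum>m\<in>M. d n / 2 * 2 powr (- \<gamma> * \<bar>of_int m - (s - of_int n)\<bar>))"
        by (rule sum.swap)
      also have "\<dots> \<le> (\<Sum>n\<in>M'. d n / 2 * K)"
        unfolding sum_distrib_left[symmetric] K_def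
        using cd_nonneg by (intro sum_mono mult_left_mono sum_two_sided_geometric \<gamma> finM) auto
      also have "\<dots> = (\<Sum>n\<in>M'. d n) * (K / 2)" by (simp add: sum_distrib_right)
      also have "\<dots> \<le> 1 * (K / 2)" using K d_sum by (intro mult_right_mono) auto
      finally show "(\<Sum>m\<in>M. \<Sum>n\<in>M'. d n / 2 * 2 powr (- \<gamma> * \<bar>of_int m - (s - of_int n)\<bar>)) \<le> K / 2" by simp
    qed
    finally have "(\<Sum>x\<in>Y. \<Sum>k=1..N. f (x + (int k)\<^sup>2) * g x) \<le> 4 * A * K"
      using A by (simp add: mult_left_mono)
    then show ?thesis by (simp add: A_def mult_ac)
  qed
  moreover have "4 * C * K > 0" using C(1) K by simp
  ultimately show ?thesis using that by blast
qed

text \<open>At \<open>p = 2\<close> the gain \<open>1 - p / 2\<close> vanishes, but so does the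
  exponent \<open>2 - 4 / p\<close>: the arithmetic-geometric mean inequality bounds each of the
  \<open>N\<close> translates by 1.\<close>

lemma bilinear_bound_2:
  fixes f g :: "int \<Rightarrow> real"
  assumes "finite Y" "finite Z" "\<And>x k. x \<in> Y \<Longrightarrow> k \<in> {1..N} \<Longrightarrow> x + (int k)\<^sup>2 \<in> Z"
    and nonneg: "\<And>x. f x \<ge> 0" "\<And>x. g x \<ge> 0"
    and "(\<Sum>z\<in>Z. f z powr 2) \<le> 1" "(\<Sum>x\<in>Y. g x powr 2) \<le> 1"
  shows "(\<Sum>x\<in>Y. \<Sum>k=1..N. f (x + (int k)\<^sup>2) * g x) \<le> real N"
proof -
  have "(\<Sum>x\<in>Y. f (x + (int k)\<^sup>2) * g x) \<le> 1" if k: "k \<in> {1..N}" for k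
  proof -
    have "(\<Sum>x\<in>Y. f (x + (int k)\<^sup>2) * g x) \<le> (\<Sum>x\<in>Y. (f (x + (int k)\<^sup>2) powr 2) / 2 + (g x powr 2) / 2)"
    proof (rule sum_mono)
      fix x
      show "f (x + (int k)\<^sup>2) * g x \<le> (f (x + (int k)\<^sup>2) powr 2) / 2 + (g x powr 2) / 2"
        using sum_squares_bound[of "f (x + (int k)\<^sup>2)" "g x"] nonneg by simp
    qed
    also have "\<dots> = (\<Sum>x\<in>Y. f (x + (int k)\<^sup>2) powr 2) / 2 + (\<Sum>x\<in>Y. g x powr 2) / 2"
      by (simp only: sum.distrib sum_divide_distrib)
    also have "(\<Sum>x\<in>Y. f (x + (int k)\<^sup>2) powr 2) = (\<Sum>z\<in>(\<lambda>x. x + (int k)\<^sup>2) ` Y. f z powr 2)"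
      by (subst sum.reindex) (auto simp: inj_on_def)
    also have "\<dots> \<le> (\<Sum>z\<in>Z. f z powr 2)"
      using assms(2,3) k by (intro sum_mono2) auto
    finally show ?thesis using assms(6,7) by linarith
  qed
  then have "(\<Sum>k=1..N. \<Sum>x\<in>Y. f (x + (int k)\<^sup>2) * g x) \<le> (\<Sum>k=1..N. 1)"
    by (intro sum_mono) auto
  then show ?thesis by (subst sum.swap) simp
qed

section \<open>Duality and the final estimate\<close>

text \<open>The usual dual function \<open>h powr (q - 1)\<close> is inserted for \<open>g\<close>
  on a finite set \<open>Y\<close>. All sums are then finite, and the bound is uniform in
  \<open>Y\<close>, so that summability of the average comes out as a conclusion.\<close>

lemma lp_improving_of_bilinear:
  fixes p K :: real and f :: "int \<Rightarrow> real"
  assumes p: "p > 1" and K: "K > 0" and N: "N > 0"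
    and bilinear: "\<And>Y Z (f::int \<Rightarrow> real) (g::int \<Rightarrow> real). finite Y \<Longrightarrow> finite Z \<Longrightarrow>
      (\<And>x k. x \<in> Y \<Longrightarrow> k \<in> {1..N} \<Longrightarrow> x + (int k)\<^sup>2 \<in> Z) \<Longrightarrow>
      (\<And>x. f x \<ge> 0) \<Longrightarrow> (\<And>x. g x \<ge> 0) \<Longrightarrow>
      (\<Sum>z\<in>Z. f z powr p) \<le> 1 \<Longrightarrow> (\<Sum>x\<in>Y. g x powr p) \<le> 1 \<Longrightarrow>
      (\<Sum>x\<in>Y. \<Sum>k=1..N. f (x + (int k)\<^sup>2) * g x) \<le> real N * K"
  shows "lp_norm (conj_exp p) (avg_sq N f) \<le> ennreal K * lp_norm p f"
proof (cases "(\<lambda>x. \<bar>f x\<bar> powr p) summable_on UNIV")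
  \<comment> \<open>If \<open>f\<close> is not in l^p, the right side is infinite, by
    \<open>K > 0\<close>.\<close>
  case False
  then show ?thesis using K by (simp add: lp_norm_def ennreal_mult_top)
next
  case True
  define q where "q = conj_exp p"
  have q: "q > 1" "(q - 1) * p = q" "1 / q = 1 - 1 / p"
    using p by (auto simp: q_def conj_exp_def field_simps)
  define A where "A = (\<Sum>\<^sub>\<infinity>x. \<bar>f x\<bar> powr p)"
  define B where "B = (K * A powr (1 / p)) powr q"
  have fin_le: "(\<Sum>z\<in>Z. \<bar>f z\<bar> powr p) \<le> A" if "finite Z" for Z
    unfolding A_def using that True by (intro finite_sum_le_infsum) auto
  have A_nonneg: "A \<ge> 0" using fin_le[of "{}"] by simp
  \<comment> \<open>The average of the absolute value dominates that of \<open>f\<close> and meets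
    the sign condition of \<open>bilinear\<close>.\<close>
  define h where "h = (\<lambda>x. 1 / real N * (\<Sum>k=1..N. \<bar>f (x + (int k)\<^sup>2)\<bar>))"
  have h_nonneg: "h x \<ge> 0" for x by (simp add: h_def sum_nonneg)
  have avg_le: "\<bar>avg_sq N f x\<bar> \<le> h x" for x
    unfolding avg_sq_def h_def abs_mult
    using sum_abs[of "\<lambda>k. f (x + (int k)\<^sup>2)" "{1..N}"] by (simp add: divide_right_mono)
  have h_bound: "(\<Sum>x\<in>Y. h x powr q) \<le> B" if Y: "finite Y" for Y
  proof -
    define S where "S = (\<Sum>x\<in>Y. h x powr q)"
    have "S \<ge> 0" by (simp add: S_def sum_nonneg)
    \<comment> \<open>The vanishing cases are separated because the test functions are normalised by
      division by \<open>a\<close> and \<open>s\<close>.\<close>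
    consider "S = 0" | "A = 0" | "S > 0" "A > 0" using \<open>S \<ge> 0\<close> A_nonneg by linarith
    then have "S \<le> B"
    proof cases
      case 1
      then show ?thesis by (simp add: B_def)
    next
      case 2
      have "f z = 0" for z
      proof -
        have "\<not> 0 < \<bar>f z\<bar> powr p" using fin_le[of "{z}"] 2 by simp
        then show ?thesis by (simp add: powr_gt_zero)
      qed
      then have "S = 0" by (simp add: S_def h_def)
      then show ?thesis by (simp add: B_def)
    next
      case 3
      define Z where "Z = (\<lambda>(x, k). x + (int k)\<^sup>2) ` (Y \<times> {1..N})"
      define a where "a = A powr (1 / p)"
      define s where "s = S powr (1 / p)"
      have as: "a > 0" "s > 0" "a powr p = A" "s powr p = S"
        using 3 p by (auto simp: a_def s_def powr_powr)
      have "(\<Sum>x\<in>Y. \<Sum>k=1..N. \<bar>f (x + (int k)\<^sup>2)\<bar> / a * (h x powr (q - 1) / s)) \<le> real N * K"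
      proof (rule bilinear)
        show "finite Y" "finite Z" using Y by (auto simp: Z_def)
        show "x + (int k)\<^sup>2 \<in> Z" if "x \<in> Y" "k \<in> {1..N}" for x k
          unfolding Z_def using that by (intro image_eqI[of _ _ "(x, k)"]) auto
        then have "finite Z" using Y by (simp add: Z_def)
        have "(\<Sum>z\<in>Z. (\<bar>f z\<bar> / a) powr p) = (\<Sum>z\<in>Z. \<bar>f z\<bar> powr p) / A"
          using as by (simp add: powr_divide sum_divide_distrib)
        also have "\<dots> \<le> 1" using fin_le[OF \<open>finite Z\<close>] 3 by simp
        finally show "(\<Sum>z\<in>Z. (\<bar>f z\<bar> / a) powr p) \<le> 1" .
        \<comment> \<open>The identity \<open>(q - 1) * p = q\<close> turns the p-th powers of the
          dual function into the summands of \<open>S\<close>.\<close>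
        have "(\<Sum>x\<in>Y. (h x powr (q - 1) / s) powr p) = (\<Sum>x\<in>Y. h x powr q) / S"
          using as q by (simp add: powr_divide powr_powr sum_divide_distrib)
        also have "\<dots> = 1" using 3 by (simp add: S_def)
        finally show "(\<Sum>x\<in>Y. (h x powr (q - 1) / s) powr p) \<le> 1" by simp
      qed (use as in auto)
      moreover have "(\<Sum>x\<in>Y. \<Sum>k=1..N. \<bar>f (x + (int k)\<^sup>2)\<bar> / a * (h x powr (q - 1) / s)) = real N * (S / (a * s))"
      proof -
        have "(\<Sum>k=1..N. \<bar>f (x + (int k)\<^sup>2)\<bar> / a * (h x powr (q - 1) / s)) = real N / (a * s) * h x powr q" for x
        proof -
          have "(\<Sum>k=1..N. \<bar>f (x + (int k)\<^sup>2)\<bar> / a * (h x powr (q - 1) / s))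
              = (\<Sum>k=1..N. \<bar>f (x + (int k)\<^sup>2)\<bar>) * (h x powr (q - 1) / (a * s))"
            by (simp add: sum_distrib_right sum_divide_distrib)
          also have "(\<Sum>k=1..N. \<bar>f (x + (int k)\<^sup>2)\<bar>) = real N * h x" using N by (simp add: h_def)
          also have "real N * h x * (h x powr (q - 1) / (a * s)) = real N / (a * s) * (h x * h x powr (q - 1))"
            by simp
          also have "h x * h x powr (q - 1) = h x powr q"
            using h_nonneg[of x] by (simp add: powr_mult_base)
          finally show ?thesis .
        qed
        then have "(\<Sum>x\<in>Y. \<Sum>k=1..N. \<bar>f (x + (int k)\<^sup>2)\<bar> / a * (h x powr (q - 1) / s))
            = (\<Sum>x\<in>Y. real N / (a * s) * h x powr q)"
          by (intro sum.cong refl)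
        also have "\<dots> = real N / (a * s) * S" by (simp only: S_def sum_distrib_left)
        finally show ?thesis by simp
      qed
      ultimately have "real N * (S / (a * s)) \<le> real N * K" by (simp only:)
      then have "S / (a * s) \<le> K" using N by (simp only: mult_le_cancel_left_pos of_nat_0_less_iff)
      then have "S / s \<le> K * a" using as by (simp add: field_simps)
      \<comment> \<open>Dividing by \<open>s = S powr (1 / p)\<close> leaves the exponent
        \<open>1 - 1 / p = 1 / q\<close>, that is, the l^q norm of \<open>h\<close> on
        \<open>Y\<close>.\<close>
      also have "S / s = S powr (1 / q)"
        using 3 by (simp add: s_def q(3) powr_diff)
      finally have "(S powr (1 / q)) powr q \<le> (K * a) powr q"
        using q by (intro powr_mono2) auto
      then show ?thesis using 3(1) q(1) by (simp add: powr_powr B_def a_def)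
    qed
    then show ?thesis by (simp add: S_def)
  qed
  have bound: "(\<Sum>x\<in>Y. \<bar>avg_sq N f x\<bar> powr q) \<le> B" if "finite Y" for Y
  proof -
    have "(\<Sum>x\<in>Y. \<bar>avg_sq N f x\<bar> powr q) \<le> (\<Sum>x\<in>Y. h x powr q)"
      using q avg_le by (intro sum_mono powr_mono2) auto
    then show ?thesis using h_bound[OF that] by linarith
  qed
  have summable: "(\<lambda>x. \<bar>avg_sq N f x\<bar> powr q) summable_on UNIV"
    using bound by (intro nonneg_bdd_above_summable_on) (auto intro!: bdd_aboveI2)
  have "(\<Sum>\<^sub>\<infinity>x. \<bar>avg_sq N f x\<bar> powr q) \<le> B"
    using bound by (intro infsum_le_finite_sums summable) auto
  then have "(\<Sum>\<^sub>\<infinity>x. \<bar>avg_sq N f x\<bar> powr q) powr (1 / q) \<le> B powr (1 / q)"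
    using q(1) by (intro powr_mono2 infsum_nonneg) auto
  also have "\<dots> = K * A powr (1 / p)" using q(1) K by (simp add: B_def powr_powr)
  finally have "lp_norm q (avg_sq N f) \<le> ennreal (K * A powr (1 / p))"
    using summable by (simp add: lp_norm_def ennreal_leI)
  also have "\<dots> = ennreal K * lp_norm p f"
    using True K by (simp add: lp_norm_def A_def ennreal_mult)
  finally show ?thesis by (simp add: q_def)
qed

theorem theorem1:
  fixes p :: real
  assumes "3 / 2 < p" and "p \<le> 2"
  shows "\<exists>C>0. \<forall>N::nat. N \<ge> 1 \<longrightarrow> (\<forall>f :: int \<Rightarrow> real.
           lp_norm (conj_exp p) (avg_sq N f)
             \<le> ennreal (C * real N powr (2 / conj_exp p - 2 / p)) * lp_norm p f)"
proof -
  have exponent: "2 / conj_exp p - 2 / p = 2 - 4 / p"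
    using assms by (simp add: conj_exp_def field_simps)
  show ?thesis
  proof (cases "p = 2")
    case True
    have "lp_norm (conj_exp p) (avg_sq N f) \<le> ennreal 1 * lp_norm p f" if "N \<ge> 1" for N f
      using that bilinear_bound_2 by (intro lp_improving_of_bilinear) (auto simp: True)
    then show ?thesis unfolding exponent by (intro exI[of _ 1]) (auto simp: True)
  next
    case False
    then have "p < 2" using assms by simp
    then obtain C where C: "C > 0" "\<And>N Y Z (f::int \<Rightarrow> real) (g::int \<Rightarrow> real). N > 0 \<Longrightarrow> finite Y \<Longrightarrow> finite Z \<Longrightarrow>
        (\<And>x k. x \<in> Y \<Longrightarrow> k \<in> {1..N} \<Longrightarrow> x + (int k)\<^sup>2 \<in> Z) \<Longrightarrow>
        (\<And>x. f x \<ge> 0) \<Longrightarrow> (\<And>x. g x \<ge> 0) \<Longrightarrow>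
        (\<Sum>z\<in>Z. f z powr p) \<le> 1 \<Longrightarrow> (\<Sum>x\<in>Y. g x powr p) \<le> 1 \<Longrightarrow>
        (\<Sum>x\<in>Y. \<Sum>k=1..N. f (x + (int k)\<^sup>2) * g x) \<le> C * real N * real N powr (2 - 4 / p)"
      using bilinear_bound assms(1) by blast
    have "lp_norm (conj_exp p) (avg_sq N f) \<le> ennreal (C * real N powr (2 - 4 / p)) * lp_norm p f"
      if "N \<ge> 1" for N f
    proof (rule lp_improving_of_bilinear)
      fix Y Z and f g :: "int \<Rightarrow> real"
      assume "finite Y" "finite Z" "\<And>x k. x \<in> Y \<Longrightarrow> k \<in> {1..N} \<Longrightarrow> x + (int k)\<^sup>2 \<in> Z"
        "\<And>x. f x \<ge> 0" "\<And>x. g x \<ge> 0" "(\<Sum>z\<in>Z. f z powr p) \<le> 1" "(\<Sum>x\<in>Y. g x powr p) \<le> 1"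
      then have "(\<Sum>x\<in>Y. \<Sum>k=1..N. f (x + (int k)\<^sup>2) * g x) \<le> C * real N * real N powr (2 - 4 / p)"
        using that by (intro C(2)) auto
      then show "(\<Sum>x\<in>Y. \<Sum>k=1..N. f (x + (int k)\<^sup>2) * g x) \<le> real N * (C * real N powr (2 - 4 / p))"
        by (simp add: mult_ac)
    qed (use that assms C(1) in auto)
    then show ?thesis unfolding exponent using C(1) by blast
  qed
qed

end
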